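(* Let $\overline{\mathbf{C}}=(\mathbf{C},\perp)$ be an orthogonal category. Then $$\mathsf{Free}(R_{\overline{\mathbf{C}}})\;\underset{r_{\overline{\mathbf{C}},2}}{\overset{r_{\overline{\mathbf{C}},1}}{\rightrightarrows}}\;\mathsf{Free}(G_{\mathbf{C}})\;\xrightarrow{\;p_{\overline{\mathbf{C}}}\,q_{\mathbf{C}}\;}\;\mathcal{O}_{\overline{\mathbf{C}}}$$ is a coequalizer in the category $\mathbf{Op}_{\mathbf{C}_0}$ of $\mathbf{C}_0$-colored operads.
   Context: Colored operads are symmetric and $\mathbf{Set}$-valued: a colored operad $\mathcal{O}$ has a set of colors, sets of operations $\mathcal{O}\binom{t}{\underline{c}}$ for each color $t$ and each tuple of colors $\underline{c}=(c_1,\dots,c_n)$, $n\ge 0$, maps $\mathcal{O}(\sigma):\mathcal{O}\binom{t}{\underline{c}}\to\mathcal{O}\binom{t}{\underline{c}\sigma}$ for $\sigma\in\Sigma_n$ with $\underline{c}\sigma=(c_{\sigma(1)},\dots,c_{\sigma(n)})$, compositions $\gamma$ and units $\mathbb{1}$, subject to the usual axioms. $\mathbf{Op}_{\mathfrak{C}}$ is the category of operads with color set $\mathfrak{C}$ and morphisms that are the identity on colors. $\mathbf{Seq}_{\mathfrak{C}}$ is the category of $\mathfrak{C}$-colored sequences (only the sets $X\binom{t}{\underline{c}}$, no further structure), and $\mathsf{Free}:\mathbf{Seq}_{\mathfrak{C}}\to\mathbf{Op}_{\mathfrak{C}}$ is the left adjoint of the forgetful functor. Orthogonal category: a pair $\overline{\mathbf{C}}=(\mathbf{C},\perp)$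 of a small category $\mathbf{C}$ and a set $\perp$ of pairs $(f_1,f_2)$ of $\mathbf{C}$-morphisms with common target (written $f_1\perp f_2$) that is symmetric and stable under post-composition ($f_1\perp f_2\Rightarrow gf_1\perp gf_2$) and pre-composition ($f_1\perp f_2\Rightarrow f_1h_1\perp f_2h_2$). The operad $\mathcal{O}_{\mathbf{C}}$: the colors are the objects $\mathbf{C}_0$ of $\mathbf{C}$; $\mathcal{O}_{\mathbf{C}}\binom{t}{\underline{c}}=\Sigma_n\times\prod_{i=1}^n\mathbf{C}(c_i,t)$ with elements $(\sigma,\underline{f})$; permutations act by $(\sigma,\underline{f})\mapsto(\sigma\sigma',\underline{f}\sigma')$ with $\underline{f}\sigma'=(f_{\sigma'(1)},\dots,f_{\sigma'(n)})$; composition is $\gamma\big((\sigma,\underline{f}),((\sigma_1,\underline{g}_1),\dots,(\sigma_m,\underline{g}_m))\big)=\big(\sigma(\sigma_1,\dots,\sigma_m),(f_1g_{11},\dots,f_1g_{1k_1},\dots,f_mg_{m1},\dots,f_mg_{mk_m})\big)$, where $\sigma(\sigma_1,\dots,\sigma_m)\in\Sigma_{k_1+\cdots+k_m}$ is the composition of the associative operad, i.e. the sum permutation $\sigma_1\oplus\cdots\oplus\sigma_m$ followed by the block permutation moving the $i$-th block (of length $k_i$) to the $\sigma(i)$-th block position; the units are $(e,\mathrm{id}_t)$. The operad $\mathcal{O}_{\overline{\mathbf{C}}}$, with canonical morphism $p_{\overline{\mathbf{C}}}:\mathcal{O}_{\mathbf{C}}\to\mathcal{O}_{\overline{\mathbf{C}}}$,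 is the coequalizer in $\mathbf{Op}_{\mathbf{C}_0}$ that universally identifies the operations $(e,(f_1,f_2))$ and $(\tau,(f_1,f_2))$ of $\mathcal{O}_{\mathbf{C}}$ for all $f_1\perp f_2$, where $e,\tau\in\Sigma_2$ are the identity and the transposition. Generators: $G_{\mathbf{C}}\in\mathbf{Seq}_{\mathbf{C}_0}$ has one generator $f\in G_{\mathbf{C}}\binom{c'}{c}$ for each $\mathbf{C}$-morphism $f:c\to c'$, and generators $1_t\in G_{\mathbf{C}}\binom{t}{\emptyset}$ and $\mu_t\in G_{\mathbf{C}}\binom{t}{(t,t)}$ for each $t\in\mathbf{C}_0$. The morphism $q_{\mathbf{C}}:\mathsf{Free}(G_{\mathbf{C}})\to\mathcal{O}_{\mathbf{C}}$ is determined by $1_t\mapsto(e,\ast)$, $f\mapsto(e,f)$, $\mu_t\mapsto(e,(\mathrm{id}_t,\mathrm{id}_t))$. Relations: $R_{\overline{\mathbf{C}}}\in\mathbf{Seq}_{\mathbf{C}_0}$ is the sequence indexing the following relations in $\mathsf{Free}(G_{\mathbf{C}})$, and $r_{\overline{\mathbf{C}},1}$, $r_{\overline{\mathbf{C}},2}$ send each relation to its left and right hand side (extended to operad morphisms on $\mathsf{Free}(R_{\overline{\mathbf{C}}})$): (Functoriality) $\mathbb{1}=\mathrm{id}_t$ in $\mathsf{Free}(G_{\mathbf{C}})\binom{t}{t}$ for all $t$, and $\gamma(f,g)=f\,g$ (composite in $\mathbf{C}$) for all composable $f,g$; (Algebra) $\gamma(\mu_t,(1_t,\mathbb{1}))=\mathbb{1}$,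 $\gamma(\mu_t,(\mathbb{1},1_t))=\mathbb{1}$ and $\gamma(\mu_t,(\mu_t,\mathbb{1}))=\gamma(\mu_t,(\mathbb{1},\mu_t))$ for all $t$; (Compatibility) $\gamma(f,1_c)=1_{c'}$ and $\gamma(f,\mu_c)=\gamma(\mu_{c'},(f,f))$ for all $f:c\to c'$; ($\perp$-commutativity) $\gamma(\mu_c,(f_1,f_2))=\mathsf{Free}(G_{\mathbf{C}})(\tau)\,\gamma(\mu_c,(f_2,f_1))$ in $\mathsf{Free}(G_{\mathbf{C}})\binom{c}{(c_1,c_2)}$ for all $(f_1:c_1\to c)\perp(f_2:c_2\to c)$. *)

theory Defs
  imports "HOL-Combinatorics.Permutations" "HOL-Library.FuncSet"
begin

section \<open>Block permutations\<close>

text \<open>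
  Elements of \<open>\<Sigma>\<^sub>n\<close> are functions \<open>\<sigma>\<close> with \<open>\<sigma> permutes {..<n}\<close> (inputs are numbered from 0), and
  \<open>c\<sigma> = (c\<^bsub>\<sigma>(0)\<^esub>, \<dots>, c\<^bsub>\<sigma>(n-1)\<^esub>)\<close> is \<open>permute_list \<sigma> c\<close>.

  \<open>sum_perm ks \<sigma>s\<close> is \<open>\<sigma>\<^sub>0 \<oplus> \<dots> \<oplus> \<sigma>\<^bsub>m-1\<^esub>\<close> with \<open>\<sigma>\<^sub>i \<in> \<Sigma>\<^bsub>k_i\<^esub>\<close>. \<open>block_perm \<sigma> ks\<close> moves the
  \<open>i\<close>-th block (of length \<open>k\<^sub>i\<close>) to the \<open>\<sigma>(i)\<close>-th block position, i.e. behind exactly those blocks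
  \<open>j\<close> with \<open>\<sigma>(j) < \<sigma>(i)\<close>.
\<close>

fun sum_perm :: "nat list \<Rightarrow> (nat \<Rightarrow> nat) list \<Rightarrow> nat \<Rightarrow> nat" where
  "sum_perm (k # ks) (s # ss) n = (if n < k then s n else k + sum_perm ks ss (n - k))"
| "sum_perm _ _ n = n"

fun block_index :: "nat list \<Rightarrow> nat \<Rightarrow> nat" where
  "block_index (k # ks) n = (if n < k then 0 else Suc (block_index ks (n - k)))"
| "block_index [] n = 0"

definition block_perm :: "(nat \<Rightarrow> nat) \<Rightarrow> nat list \<Rightarrow> nat \<Rightarrow> nat" where
  "block_perm \<sigma> ks n =
     (if n < sum_list ks then
        let i = block_index ks n
        in (\<Sum>j | j < length ks \<and> \<sigma> j < \<sigma> i. ks ! j) + (n - sum_list (take i ks))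
      else n)"


section \<open>Colored operads\<close>

text \<open>
  \<open>ops P t c\<close> is the set of operations with inputs \<open>c\<close> and output \<open>t\<close>, and
  \<open>act P t c \<sigma> : ops P t c \<rightarrow> ops P t (c\<sigma>)\<close>. For inputs \<open>a = [a\<^sub>0, \<dots>]\<close> and \<open>bs = [b\<^sub>0, \<dots>]\<close> the
  composition is \<open>gam P t a bs : ops P t a \<times> (\<Prod>i. ops P a\<^sub>i b\<^sub>i) \<rightarrow> ops P t (concat bs)\<close>.
  The sets \<open>ops P t c\<close> for different profiles may overlap, hence the profile arguments.
\<close>

record ('o, 'x) operad_data =
  ops :: "'o \<Rightarrow> 'o list \<Rightarrow> 'x set"
  act :: "'o \<Rightarrow> 'o list \<Rightarrow> (nat \<Rightarrow> nat) \<Rightarrow> 'x \<Rightarrow> 'x"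
  gam :: "'o \<Rightarrow> 'o list \<Rightarrow> 'o list list \<Rightarrow> 'x \<Rightarrow> 'x list \<Rightarrow> 'x"
  one :: "'o \<Rightarrow> 'x"

definition ops_list ::
  "('o, 'x, 'z) operad_data_scheme \<Rightarrow> 'o list \<Rightarrow> 'o list list \<Rightarrow> 'x list \<Rightarrow> bool" where
  "ops_list P a bs ys \<longleftrightarrow> length bs = length a \<and> length ys = length a \<and>
     (\<forall>i<length a. ys ! i \<in> ops P (a ! i) (bs ! i))"

text \<open>A colored sequence; families are required to be empty outside the color set.\<close>

definition colored_seq :: "'o set \<Rightarrow> ('o \<Rightarrow> 'o list \<Rightarrow> 'x set) \<Rightarrow> bool" where
  "colored_seq K X \<longleftrightarrow> (\<forall>t c. X t c \<noteq> {} \<longrightarrow> t \<in> K \<and> set c \<subseteq> K)"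

text \<open>Operad data that is well-typed but not yet subject to the operad axioms.\<close>

definition pre_operad :: "'o set \<Rightarrow> ('o, 'x) operad_data \<Rightarrow> bool" where
  "pre_operad K P \<longleftrightarrow>
     colored_seq K (ops P) \<and>
     (\<forall>t c \<sigma> x. x \<in> ops P t c \<longrightarrow> \<sigma> permutes {..<length c} \<longrightarrow>
        act P t c \<sigma> x \<in> ops P t (permute_list \<sigma> c)) \<and>
     (\<forall>t a bs x ys. x \<in> ops P t a \<longrightarrow> ops_list P a bs ys \<longrightarrow>
        gam P t a bs x ys \<in> ops P t (concat bs)) \<and>
     (\<forall>t\<in>K. one P t \<in> ops P t [t])"

text \<open>
  \<open>op_law P t c x y\<close>: the elements \<open>x\<close> and \<open>y\<close> of \<open>ops P t c\<close> are the two sides of an instance of an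
  operad axiom.
\<close>

inductive op_law :: "('o, 'x) operad_data \<Rightarrow> 'o \<Rightarrow> 'o list \<Rightarrow> 'x \<Rightarrow> 'x \<Rightarrow> bool"
  for P :: "('o, 'x) operad_data" where
  act_id: "x \<in> ops P t c \<Longrightarrow> op_law P t c (act P t c id x) x"
| act_comp:
  "x \<in> ops P t c \<Longrightarrow> \<sigma> permutes {..<length c} \<Longrightarrow> \<tau> permutes {..<length c} \<Longrightarrow>
   op_law P t (permute_list (\<sigma> \<circ> \<tau>) c)
     (act P t c (\<sigma> \<circ> \<tau>) x)
     (act P t (permute_list \<sigma> c) \<tau> (act P t c \<sigma> x))"
| unit_left: "x \<in> ops P t c \<Longrightarrow> op_law P t c (gam P t [t] [c] (one P t) [x]) x"
| unit_right:
  "x \<in> ops P t c \<Longrightarrow>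
   op_law P t c (gam P t c (map (\<lambda>s. [s]) c) x (map (one P) c)) x"
| assoc:
  "x \<in> ops P t a \<Longrightarrow> ops_list P a bs ys \<Longrightarrow>
   length ccs = length a \<Longrightarrow> length zss = length a \<Longrightarrow>
   (\<forall>i<length a. ops_list P (bs ! i) (ccs ! i) (zss ! i)) \<Longrightarrow>
   op_law P t (concat (concat ccs))
     (gam P t (concat bs) (concat ccs) (gam P t a bs x ys) (concat zss))
     (gam P t a (map concat ccs) x
       (map (\<lambda>i. gam P (a ! i) (bs ! i) (ccs ! i) (ys ! i) (zss ! i)) [0..<length a]))"
| equivariance_outer:
  "x \<in> ops P t a \<Longrightarrow> ops_list P a bs ys \<Longrightarrow> \<sigma> permutes {..<length a} \<Longrightarrow>
   op_law P t (concat (permute_list \<sigma> bs))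
     (gam P t (permute_list \<sigma> a) (permute_list \<sigma> bs) (act P t a \<sigma> x) (permute_list \<sigma> ys))
     (act P t (concat bs) (block_perm \<sigma> (map length (permute_list \<sigma> bs)))
       (gam P t a bs x ys))"
| equivariance_inner:
  "x \<in> ops P t a \<Longrightarrow> ops_list P a bs ys \<Longrightarrow> length \<tau>s = length a \<Longrightarrow>
   (\<forall>i<length a. \<tau>s ! i permutes {..<length (bs ! i)}) \<Longrightarrow>
   op_law P t (concat (map2 permute_list \<tau>s bs))
     (gam P t a (map2 permute_list \<tau>s bs) x
       (map (\<lambda>i. act P (a ! i) (bs ! i) (\<tau>s ! i) (ys ! i)) [0..<length a]))
     (act P t (concat bs) (sum_perm (map length bs) \<tau>s) (gam P t a bs x ys))"

text \<open>The objects of \<open>Op\<^sub>K\<close>.\<close>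

definition operad :: "'o set \<Rightarrow> ('o, 'x) operad_data \<Rightarrow> bool" where
  "operad K P \<longleftrightarrow> pre_operad K P \<and> (\<forall>t c x y. op_law P t c x y \<longrightarrow> x = y)"

text \<open>
  The morphisms of \<open>Op\<^sub>K\<close>: families of maps \<open>ops P t c \<rightarrow> ops Q t c\<close>. They are extensional, so that
  equality of morphisms is equality of families.
\<close>

definition op_hom ::
  "'o set \<Rightarrow> ('o, 'x) operad_data \<Rightarrow> ('o, 'y) operad_data \<Rightarrow> ('o \<Rightarrow> 'o list \<Rightarrow> 'x \<Rightarrow> 'y) \<Rightarrow> bool" where
  "op_hom K P Q h \<longleftrightarrow>
     (\<forall>t c. h t c \<in> ops P t c \<rightarrow>\<^sub>E ops Q t c) \<and>
     (\<forall>t c \<sigma> x. x \<in> ops P t c \<longrightarrow> \<sigma> permutes {..<length c} \<longrightarrow>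
        h t (permute_list \<sigma> c) (act P t c \<sigma> x) = act Q t c \<sigma> (h t c x)) \<and>
     (\<forall>t a bs x ys. x \<in> ops P t a \<longrightarrow> ops_list P a bs ys \<longrightarrow>
        h t (concat bs) (gam P t a bs x ys) =
        gam Q t a bs (h t a x) (map (\<lambda>i. h (a ! i) (bs ! i) (ys ! i)) [0..<length a])) \<and>
     (\<forall>t\<in>K. h t [t] (one P t) = one Q t)"

text \<open>The composite \<open>h \<circ> k\<close> of a morphism \<open>k\<close> with domain \<open>P\<close> and a morphism \<open>h\<close>.\<close>

definition op_compose ::
  "('o, 'x) operad_data \<Rightarrow> ('o \<Rightarrow> 'o list \<Rightarrow> 'y \<Rightarrow> 'w) \<Rightarrow> ('o \<Rightarrow> 'o list \<Rightarrow> 'x \<Rightarrow> 'y) \<Rightarrow>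
   'o \<Rightarrow> 'o list \<Rightarrow> 'x \<Rightarrow> 'w" where
  "op_compose P h k = (\<lambda>t c. compose (ops P t c) (h t c) (k t c))"

text \<open>
  \<open>p : F \<rightarrow> P\<close> is a coequalizer of \<open>r1, r2 : R \<rightarrow> F\<close> in \<open>Op\<^sub>K\<close>. HOL cannot quantify over types inside a
  formula; the type in which the test operads \<open>Q\<close> live is the parameter \<open>'q\<close>.
\<close>

definition op_coequalizer ::
  "'q itself \<Rightarrow> 'o set \<Rightarrow>
   ('o, 'r) operad_data \<Rightarrow> ('o, 'f) operad_data \<Rightarrow> ('o, 'p) operad_data \<Rightarrow>
   ('o \<Rightarrow> 'o list \<Rightarrow> 'r \<Rightarrow> 'f) \<Rightarrow> ('o \<Rightarrow> 'o list \<Rightarrow> 'r \<Rightarrow> 'f) \<Rightarrow>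
   ('o \<Rightarrow> 'o list \<Rightarrow> 'f \<Rightarrow> 'p) \<Rightarrow> bool" where
  "op_coequalizer _ K R F P r1 r2 p \<longleftrightarrow>
     operad K R \<and> operad K F \<and> operad K P \<and>
     op_hom K R F r1 \<and> op_hom K R F r2 \<and> op_hom K F P p \<and>
     op_compose R p r1 = op_compose R p r2 \<and>
     (\<forall>(Q :: ('o, 'q) operad_data) m.
        operad K Q \<longrightarrow> op_hom K F Q m \<longrightarrow> op_compose R m r1 = op_compose R m r2 \<longrightarrow>
        (\<exists>!h. op_hom K P Q h \<and> op_compose F h p = m))"


section \<open>Quotients of operads\<close>

text \<open>
  \<open>op_cong P E\<close> is the congruence generated by \<open>E\<close> and the operad axioms (which contribute nothing if
  \<open>P\<close> is already an operad).
\<close>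

inductive op_cong ::
  "('o, 'x) operad_data \<Rightarrow> ('o \<Rightarrow> 'o list \<Rightarrow> 'x \<Rightarrow> 'x \<Rightarrow> bool) \<Rightarrow> 'o \<Rightarrow> 'o list \<Rightarrow> 'x \<Rightarrow> 'x \<Rightarrow> bool"
  for P :: "('o, 'x) operad_data" and E :: "'o \<Rightarrow> 'o list \<Rightarrow> 'x \<Rightarrow> 'x \<Rightarrow> bool" where
  base: "E t c x y \<Longrightarrow> x \<in> ops P t c \<Longrightarrow> y \<in> ops P t c \<Longrightarrow> op_cong P E t c x y"
| law: "op_law P t c x y \<Longrightarrow> op_cong P E t c x y"
| refl: "x \<in> ops P t c \<Longrightarrow> op_cong P E t c x x"
| sym: "op_cong P E t c x y \<Longrightarrow> op_cong P E t c y x"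
| trans: "op_cong P E t c x y \<Longrightarrow> op_cong P E t c y z \<Longrightarrow> op_cong P E t c x z"
| act: "op_cong P E t c x y \<Longrightarrow> \<sigma> permutes {..<length c} \<Longrightarrow>
    op_cong P E t (permute_list \<sigma> c) (act P t c \<sigma> x) (act P t c \<sigma> y)"
| gam: "op_cong P E t a x x' \<Longrightarrow>
    length bs = length a \<Longrightarrow> length ys = length a \<Longrightarrow> length ys' = length a \<Longrightarrow>
    (\<forall>i<length a. op_cong P E (a ! i) (bs ! i) (ys ! i) (ys' ! i)) \<Longrightarrow>
    op_cong P E t (concat bs) (gam P t a bs x ys) (gam P t a bs x' ys')"

definition op_class ::
  "('o, 'x) operad_data \<Rightarrow> ('o \<Rightarrow> 'o list \<Rightarrow> 'x \<Rightarrow> 'x \<Rightarrow> bool) \<Rightarrow> 'o \<Rightarrow> 'o list \<Rightarrow> 'x \<Rightarrow> 'x set" where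
  "op_class P E t c x = {y. op_cong P E t c x y}"

definition rep :: "'x set \<Rightarrow> 'x" where
  "rep A = (SOME x. x \<in> A)"

definition op_quotient ::
  "('o, 'x) operad_data \<Rightarrow> ('o \<Rightarrow> 'o list \<Rightarrow> 'x \<Rightarrow> 'x \<Rightarrow> bool) \<Rightarrow> ('o, 'x set) operad_data" where
  "op_quotient P E =
     \<lparr>ops = (\<lambda>t c. op_class P E t c ` ops P t c),
      act = (\<lambda>t c \<sigma> A. op_class P E t (permute_list \<sigma> c) (act P t c \<sigma> (rep A))),
      gam = (\<lambda>t a bs A Bs. op_class P E t (concat bs) (gam P t a bs (rep A) (map rep Bs))),
      one = (\<lambda>t. op_class P E t [t] (one P t))\<rparr>"

definition op_proj ::
  "('o, 'x) operad_data \<Rightarrow> ('o \<Rightarrow> 'o list \<Rightarrow> 'x \<Rightarrow> 'x \<Rightarrow> bool) \<Rightarrow> 'o \<Rightarrow> 'o list \<Rightarrow> 'x \<Rightarrow> 'x set" where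
  "op_proj P E = (\<lambda>t c. restrict (op_class P E t c) (ops P t c))"


section \<open>Free operads\<close>

text \<open>
  The free operad on a sequence \<open>X\<close> is realized as formal operadic terms over \<open>X\<close> modulo the operad
  axioms; see \<open>free_operad_universal\<close> below for its universal property.
\<close>

datatype ('o, 'x) op_term =
    Gen 'o "'o list" 'x
  | One 'o
  | Act 'o "'o list" "nat \<Rightarrow> nat" "('o, 'x) op_term"
  | Gam 'o "'o list" "'o list list" "('o, 'x) op_term" "('o, 'x) op_term list"

inductive wf_term :: "'o set \<Rightarrow> ('o \<Rightarrow> 'o list \<Rightarrow> 'x set) \<Rightarrow> 'o \<Rightarrow> 'o list \<Rightarrow> ('o, 'x) op_term \<Rightarrow> bool"
  for K :: "'o set" and X :: "'o \<Rightarrow> 'o list \<Rightarrow> 'x set" where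
  Gen: "x \<in> X t c \<Longrightarrow> wf_term K X t c (Gen t c x)"
| One: "t \<in> K \<Longrightarrow> wf_term K X t [t] (One t)"
| Act: "wf_term K X t c T \<Longrightarrow> \<sigma> permutes {..<length c} \<Longrightarrow>
    wf_term K X t (permute_list \<sigma> c) (Act t c \<sigma> T)"
| Gam: "wf_term K X t a T \<Longrightarrow> length bs = length a \<Longrightarrow> length Us = length a \<Longrightarrow>
    (\<forall>i<length a. wf_term K X (a ! i) (bs ! i) (Us ! i)) \<Longrightarrow>
    wf_term K X t (concat bs) (Gam t a bs T Us)"

definition term_operad ::
  "'o set \<Rightarrow> ('o \<Rightarrow> 'o list \<Rightarrow> 'x set) \<Rightarrow> ('o, ('o, 'x) op_term) operad_data" where
  "term_operad K X =
     \<lparr>ops = (\<lambda>t c. {T. wf_term K X t c T}), act = Act, gam = Gam, one = One\<rparr>"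

definition free_operad ::
  "'o set \<Rightarrow> ('o \<Rightarrow> 'o list \<Rightarrow> 'x set) \<Rightarrow> ('o, ('o, 'x) op_term set) operad_data" where
  "free_operad K X = op_quotient (term_operad K X) (\<lambda>_ _ _ _. False)"

definition free_gen ::
  "'o set \<Rightarrow> ('o \<Rightarrow> 'o list \<Rightarrow> 'x set) \<Rightarrow> 'o \<Rightarrow> 'o list \<Rightarrow> 'x \<Rightarrow> ('o, 'x) op_term set" where
  "free_gen K X t c x = op_class (term_operad K X) (\<lambda>_ _ _ _. False) t c (Gen t c x)"

text \<open>The operad morphism \<open>free_operad K X \<rightarrow> P\<close> determined by its values \<open>\<phi>\<close> on generators.\<close>

definition free_ext ::
  "'o set \<Rightarrow> ('o \<Rightarrow> 'o list \<Rightarrow> 'x set) \<Rightarrow> ('o, 'y) operad_data \<Rightarrow> ('o \<Rightarrow> 'o list \<Rightarrow> 'x \<Rightarrow> 'y) \<Rightarrow>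
   'o \<Rightarrow> 'o list \<Rightarrow> ('o, 'x) op_term set \<Rightarrow> 'y" where
  "free_ext K X P \<phi> =
     (THE h. op_hom K (free_operad K X) P h \<and>
        (\<forall>t c. \<forall>x\<in>X t c. h t c (free_gen K X t c x) = \<phi> t c x))"


section \<open>Orthogonal categories\<close>

record ('o, 'm) cat_data =
  Ob :: "'o set"
  Mor :: "'m set"
  src :: "'m \<Rightarrow> 'o"
  tgt :: "'m \<Rightarrow> 'o"
  idm :: "'o \<Rightarrow> 'm"
  cmp :: "'m \<Rightarrow> 'm \<Rightarrow> 'm"

locale small_category =
  fixes C :: "('o, 'm) cat_data"
  assumes src_Ob: "f \<in> Mor C \<Longrightarrow> src C f \<in> Ob C"
    and tgt_Ob: "f \<in> Mor C \<Longrightarrow> tgt C f \<in> Ob C"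
    and idm_Mor: "t \<in> Ob C \<Longrightarrow> idm C t \<in> Mor C"
    and src_idm: "t \<in> Ob C \<Longrightarrow> src C (idm C t) = t"
    and tgt_idm: "t \<in> Ob C \<Longrightarrow> tgt C (idm C t) = t"
    and cmp_Mor: "f \<in> Mor C \<Longrightarrow> g \<in> Mor C \<Longrightarrow> tgt C g = src C f \<Longrightarrow> cmp C f g \<in> Mor C"
    and src_cmp: "f \<in> Mor C \<Longrightarrow> g \<in> Mor C \<Longrightarrow> tgt C g = src C f \<Longrightarrow> src C (cmp C f g) = src C g"
    and tgt_cmp: "f \<in> Mor C \<Longrightarrow> g \<in> Mor C \<Longrightarrow> tgt C g = src C f \<Longrightarrow> tgt C (cmp C f g) = tgt C f"
    and idm_left: "f \<in> Mor C \<Longrightarrow> cmp C (idm C (tgt C f)) f = f"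
    and idm_right: "f \<in> Mor C \<Longrightarrow> cmp C f (idm C (src C f)) = f"
    and cmp_assoc: "f \<in> Mor C \<Longrightarrow> g \<in> Mor C \<Longrightarrow> h \<in> Mor C \<Longrightarrow>
      tgt C h = src C g \<Longrightarrow> tgt C g = src C f \<Longrightarrow>
      cmp C (cmp C f g) h = cmp C f (cmp C g h)"

locale orthogonal_category = small_category C
  for C :: "('o, 'm) cat_data" +
  fixes perp :: "('m \<times> 'm) set"
  assumes perp_Mor: "(f1, f2) \<in> perp \<Longrightarrow> f1 \<in> Mor C \<and> f2 \<in> Mor C \<and> tgt C f1 = tgt C f2"
    and perp_sym: "(f1, f2) \<in> perp \<Longrightarrow> (f2, f1) \<in> perp"
    and perp_post: "(f1, f2) \<in> perp \<Longrightarrow> g \<in> Mor C \<Longrightarrow> src C g = tgt C f1 \<Longrightarrow>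
      (cmp C g f1, cmp C g f2) \<in> perp"
    and perp_pre: "(f1, f2) \<in> perp \<Longrightarrow> h1 \<in> Mor C \<Longrightarrow> h2 \<in> Mor C \<Longrightarrow>
      tgt C h1 = src C f1 \<Longrightarrow> tgt C h2 = src C f2 \<Longrightarrow> (cmp C f1 h1, cmp C f2 h2) \<in> perp"


section \<open>The operads \<open>O\<^sub>C\<close> and their quotients by orthogonality relations\<close>

definition cat_operad :: "('o, 'm) cat_data \<Rightarrow> ('o, (nat \<Rightarrow> nat) \<times> 'm list) operad_data" where
  "cat_operad C =
     \<lparr>ops = (\<lambda>t c. {(\<sigma>, fs). t \<in> Ob C \<and> set c \<subseteq> Ob C \<and>
               \<sigma> permutes {..<length c} \<and> length fs = length c \<and>
               (\<forall>i<length c. fs ! i \<in> Mor C \<and> src C (fs ! i) = c ! i \<and> tgt C (fs ! i) = t)}),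
      act = (\<lambda>t c \<sigma>' (\<sigma>, fs). (\<sigma> \<circ> \<sigma>', permute_list \<sigma>' fs)),
      gam = (\<lambda>t a bs (\<sigma>, fs) ys.
               (block_perm \<sigma> (map length bs) \<circ> sum_perm (map length bs) (map fst ys),
                concat (map2 (\<lambda>f gs. map (cmp C f) gs) fs (map snd ys)))),
      one = (\<lambda>t. (id, [idm C t]))\<rparr>"

definition perp_rel ::
  "('o, 'm) cat_data \<Rightarrow> ('m \<times> 'm) set \<Rightarrow>
   'o \<Rightarrow> 'o list \<Rightarrow> (nat \<Rightarrow> nat) \<times> 'm list \<Rightarrow> (nat \<Rightarrow> nat) \<times> 'm list \<Rightarrow> bool" where
  "perp_rel C perp t c x y \<longleftrightarrow>
     (\<exists>f1 f2. (f1, f2) \<in> perp \<and> t = tgt C f1 \<and> c = [src C f1, src C f2] \<and>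
        x = (id, [f1, f2]) \<and> y = (transpose 0 1, [f1, f2]))"

text \<open>
  The universal property defining \<open>orth_operad\<close> and its canonical morphism \<open>orth_proj\<close> is
  \<open>orth_operad_universal\<close> below.
\<close>

definition orth_operad ::
  "('o, 'm) cat_data \<Rightarrow> ('m \<times> 'm) set \<Rightarrow> ('o, ((nat \<Rightarrow> nat) \<times> 'm list) set) operad_data" where
  "orth_operad C perp = op_quotient (cat_operad C) (perp_rel C perp)"

definition orth_proj ::
  "('o, 'm) cat_data \<Rightarrow> ('m \<times> 'm) set \<Rightarrow>
   'o \<Rightarrow> 'o list \<Rightarrow> (nat \<Rightarrow> nat) \<times> 'm list \<Rightarrow> ((nat \<Rightarrow> nat) \<times> 'm list) set" where
  "orth_proj C perp = op_proj (cat_operad C) (perp_rel C perp)"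


section \<open>Generators and relations\<close>

datatype ('o, 'm) generator = Arrow 'm | Unit 'o | Mult 'o

definition gen_seq :: "('o, 'm) cat_data \<Rightarrow> 'o \<Rightarrow> 'o list \<Rightarrow> ('o, 'm) generator set" where
  "gen_seq C t c =
     {Arrow f | f. f \<in> Mor C \<and> t = tgt C f \<and> c = [src C f]} \<union>
     {Unit t | _ :: unit. t \<in> Ob C \<and> c = []} \<union>
     {Mult t | _ :: unit. t \<in> Ob C \<and> c = [t, t]}"

abbreviation free_G :: "('o, 'm) cat_data \<Rightarrow> ('o, ('o, ('o, 'm) generator) op_term set) operad_data" where
  "free_G C \<equiv> free_operad (Ob C) (gen_seq C)"

fun q_gen :: "('o, 'm) cat_data \<Rightarrow> ('o, 'm) generator \<Rightarrow> (nat \<Rightarrow> nat) \<times> 'm list" where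
  "q_gen C (Unit t) = (id, [])"
| "q_gen C (Arrow f) = (id, [f])"
| "q_gen C (Mult t) = (id, [idm C t, idm C t])"

definition q_mor ::
  "('o, 'm) cat_data \<Rightarrow> 'o \<Rightarrow> 'o list \<Rightarrow> ('o, ('o, 'm) generator) op_term set \<Rightarrow> (nat \<Rightarrow> nat) \<times> 'm list" where
  "q_mor C = free_ext (Ob C) (gen_seq C) (cat_operad C) (\<lambda>_ _. q_gen C)"

text \<open>
  \<open>Fun_id t\<close> and \<open>Fun_cmp f g\<close> index the functoriality relations, \<open>Alg_left t\<close>, \<open>Alg_right t\<close> and
  \<open>Alg_assoc t\<close> the algebra relations, \<open>Comp_unit f\<close> and \<open>Comp_mult f\<close> the compatibility relations.
\<close>

datatype ('o, 'm) relation_index =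
    Fun_id 'o | Fun_cmp 'm 'm
  | Alg_left 'o | Alg_right 'o | Alg_assoc 'o
  | Comp_unit 'm | Comp_mult 'm
  | Perp_comm 'm 'm

definition rel_seq ::
  "('o, 'm) cat_data \<Rightarrow> ('m \<times> 'm) set \<Rightarrow> 'o \<Rightarrow> 'o list \<Rightarrow> ('o, 'm) relation_index set" where
  "rel_seq C perp t c =
     {Fun_id t | _ :: unit. t \<in> Ob C \<and> c = [t]} \<union>
     {Fun_cmp f g | f g. f \<in> Mor C \<and> g \<in> Mor C \<and> tgt C g = src C f \<and>
        t = tgt C f \<and> c = [src C g]} \<union>
     {Alg_left t | _ :: unit. t \<in> Ob C \<and> c = [t]} \<union>
     {Alg_right t | _ :: unit. t \<in> Ob C \<and> c = [t]} \<union>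
     {Alg_assoc t | _ :: unit. t \<in> Ob C \<and> c = [t, t, t]} \<union>
     {Comp_unit f | f. f \<in> Mor C \<and> t = tgt C f \<and> c = []} \<union>
     {Comp_mult f | f. f \<in> Mor C \<and> t = tgt C f \<and> c = [src C f, src C f]} \<union>
     {Perp_comm f1 f2 | f1 f2. (f1, f2) \<in> perp \<and> t = tgt C f1 \<and> c = [src C f1, src C f2]}"

definition arrow_op :: "('o, 'm) cat_data \<Rightarrow> 'm \<Rightarrow> ('o, ('o, 'm) generator) op_term set" where
  "arrow_op C f = free_gen (Ob C) (gen_seq C) (tgt C f) [src C f] (Arrow f)"

definition unit_op :: "('o, 'm) cat_data \<Rightarrow> 'o \<Rightarrow> ('o, ('o, 'm) generator) op_term set" where
  "unit_op C t = free_gen (Ob C) (gen_seq C) t [] (Unit t)"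

definition mult_op :: "('o, 'm) cat_data \<Rightarrow> 'o \<Rightarrow> ('o, ('o, 'm) generator) op_term set" where
  "mult_op C t = free_gen (Ob C) (gen_seq C) t [t, t] (Mult t)"

fun rel_lhs :: "('o, 'm) cat_data \<Rightarrow> ('o, 'm) relation_index \<Rightarrow> ('o, ('o, 'm) generator) op_term set" where
  "rel_lhs C (Fun_id t) = one (free_G C) t"
| "rel_lhs C (Fun_cmp f g) =
     gam (free_G C) (tgt C f) [src C f] [[src C g]] (arrow_op C f) [arrow_op C g]"
| "rel_lhs C (Alg_left t) =
     gam (free_G C) t [t, t] [[], [t]] (mult_op C t) [unit_op C t, one (free_G C) t]"
| "rel_lhs C (Alg_right t) =
     gam (free_G C) t [t, t] [[t], []] (mult_op C t) [one (free_G C) t, unit_op C t]"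
| "rel_lhs C (Alg_assoc t) =
     gam (free_G C) t [t, t] [[t, t], [t]] (mult_op C t) [mult_op C t, one (free_G C) t]"
| "rel_lhs C (Comp_unit f) =
     gam (free_G C) (tgt C f) [src C f] [[]] (arrow_op C f) [unit_op C (src C f)]"
| "rel_lhs C (Comp_mult f) =
     gam (free_G C) (tgt C f) [src C f] [[src C f, src C f]] (arrow_op C f) [mult_op C (src C f)]"
| "rel_lhs C (Perp_comm f1 f2) =
     gam (free_G C) (tgt C f1) [tgt C f1, tgt C f1] [[src C f1], [src C f2]]
       (mult_op C (tgt C f1)) [arrow_op C f1, arrow_op C f2]"

fun rel_rhs :: "('o, 'm) cat_data \<Rightarrow> ('o, 'm) relation_index \<Rightarrow> ('o, ('o, 'm) generator) op_term set" where
  "rel_rhs C (Fun_id t) = arrow_op C (idm C t)"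
| "rel_rhs C (Fun_cmp f g) = arrow_op C (cmp C f g)"
| "rel_rhs C (Alg_left t) = one (free_G C) t"
| "rel_rhs C (Alg_right t) = one (free_G C) t"
| "rel_rhs C (Alg_assoc t) =
     gam (free_G C) t [t, t] [[t], [t, t]] (mult_op C t) [one (free_G C) t, mult_op C t]"
| "rel_rhs C (Comp_unit f) = unit_op C (tgt C f)"
| "rel_rhs C (Comp_mult f) =
     gam (free_G C) (tgt C f) [tgt C f, tgt C f] [[src C f], [src C f]]
       (mult_op C (tgt C f)) [arrow_op C f, arrow_op C f]"
| "rel_rhs C (Perp_comm f1 f2) =
     act (free_G C) (tgt C f1) [src C f2, src C f1] (transpose 0 1)
       (gam (free_G C) (tgt C f1) [tgt C f1, tgt C f1] [[src C f2], [src C f1]]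
         (mult_op C (tgt C f1)) [arrow_op C f2, arrow_op C f1])"

abbreviation free_R ::
  "('o, 'm) cat_data \<Rightarrow> ('m \<times> 'm) set \<Rightarrow> ('o, ('o, ('o, 'm) relation_index) op_term set) operad_data" where
  "free_R C perp \<equiv> free_operad (Ob C) (rel_seq C perp)"

definition r1_mor ::
  "('o, 'm) cat_data \<Rightarrow> ('m \<times> 'm) set \<Rightarrow> 'o \<Rightarrow> 'o list \<Rightarrow>
   ('o, ('o, 'm) relation_index) op_term set \<Rightarrow> ('o, ('o, 'm) generator) op_term set" where
  "r1_mor C perp = free_ext (Ob C) (rel_seq C perp) (free_G C) (\<lambda>_ _. rel_lhs C)"

definition r2_mor ::
  "('o, 'm) cat_data \<Rightarrow> ('m \<times> 'm) set \<Rightarrow> 'o \<Rightarrow> 'o list \<Rightarrow>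
   ('o, ('o, 'm) relation_index) op_term set \<Rightarrow> ('o, ('o, 'm) generator) op_term set" where
  "r2_mor C perp = free_ext (Ob C) (rel_seq C perp) (free_G C) (\<lambda>_ _. rel_rhs C)"

section \<open>Justification of the constructions\<close>

text \<open>
  Quotients of well-typed operad data are operads with the expected universal property
  (\<open>quotient_operad\<close>, \<open>quotient_universal\<close>); this yields the universal properties of free operads
  (\<open>free_operad_universal\<close>) and of \<open>orth_operad\<close> (\<open>orth_operad_universal\<close>), for test operads in an
  arbitrary type.
\<close>

subsection \<open>Block permutations\<close>

lemma split_index:
  fixes ks :: "nat list"
  assumes "n < sum_list ks"
  obtains i j where "i < length ks" "j < ks ! i" "n = sum_list (take i ks) + j"
proof -
  have "\<exists>i j. i < length ks \<and> j < ks ! i \<and> n = sum_list (take i ks) + j"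
    using assms
  proof (induction ks arbitrary: n)
    case (Cons k ks)
    show ?case
    proof (cases "n < k")
      case True
      then show ?thesis by (intro exI[of _ 0] exI[of _ n]) auto
    next
      case False
      then have "n - k < sum_list ks" using Cons.prems by auto
      from Cons.IH[OF this] obtain i j where "i < length ks" "j < ks ! i"
        "n - k = sum_list (take i ks) + j" by blast
      then show ?thesis using False by (intro exI[of _ "Suc i"] exI[of _ j]) auto
    qed
  qed simp
  then show ?thesis using that by blast
qed

lemma offset_less:
  fixes ks :: "nat list"
  assumes "i < length ks" "j < ks ! i"
  shows "sum_list (take i ks) + j < sum_list ks"
  using assms
proof (induction ks arbitrary: i)
  case (Cons k ks)
  then show ?case by (cases i) auto
qed simp

lemma concat_nth:
  assumes "i < length cs" "j < length (cs ! i)"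
  shows "concat cs ! (sum_list (take i (map length cs)) + j) = cs ! i ! j"
  using assms
proof (induction cs arbitrary: i)
  case (Cons c cs)
  then show ?case by (cases i) (auto simp: nth_append add.assoc)
qed simp

lemma concat_nth2:
  assumes "i < length cs" "j < length (cs ! i)" "ks = map length cs"
  shows "concat cs ! (sum_list (take i ks) + j) = cs ! i ! j"
  using concat_nth[OF assms(1,2)] assms(3) by simp

lemma concat_eqI:
  assumes "length xs = sum_list ks" "ks = map length cs"
    and "\<And>i j. i < length cs \<Longrightarrow> j < length (cs ! i) \<Longrightarrow>
      xs ! (sum_list (take i ks) + j) = cs ! i ! j"
  shows "xs = concat cs"
proof (rule nth_equalityI)
  show "length xs = length (concat cs)" using assms(1,2) by (simp add: length_concat)
next
  fix n assume "n < length xs"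
  then have "n < sum_list ks" using assms(1) by simp
  then obtain i j where "i < length ks" "j < ks ! i" "n = sum_list (take i ks) + j"
    by (rule split_index)
  then show "xs ! n = concat cs ! n"
    using assms concat_nth2[of i cs j ks] by auto
qed

lemma block_index_offset:
  assumes "i < length ks" "j < ks ! i"
  shows "block_index ks (sum_list (take i ks) + j) = i"
  using assms
proof (induction ks arbitrary: i)
  case (Cons k ks)
  then show ?case by (cases i) (auto simp: add.assoc)
qed simp

lemma sum_perm_offset:
  assumes "i < length ks" "j < ks ! i" "length ss = length ks"
  shows "sum_perm ks ss (sum_list (take i ks) + j) = sum_list (take i ks) + (ss ! i) j"
  using assms
proof (induction ks arbitrary: i ss)
  case (Cons k ks)
  from Cons.prems(3) obtain s ss' where ss: "ss = s # ss'" by (cases ss) auto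
  show ?case
  proof (cases i)
    case 0
    then show ?thesis using Cons.prems ss by auto
  next
    case (Suc i')
    then show ?thesis using Cons.IH[of i' ss'] Cons.prems ss by (auto simp: add.assoc)
  qed
qed simp

lemma sum_perm_ge:
  assumes "sum_list ks \<le> n" "length ss = length ks"
  shows "sum_perm ks ss n = n"
  using assms by (induction ks ss n rule: sum_perm.induct) auto

lemma block_perm_ge: "sum_list ks \<le> n \<Longrightarrow> block_perm \<sigma> ks n = n"
  by (simp add: block_perm_def)

lemma block_perm_offset_raw:
  assumes "i < length ks" "j < ks ! i"
  shows "block_perm \<sigma> ks (sum_list (take i ks) + j) =
    (\<Sum>l | l < length ks \<and> \<sigma> l < \<sigma> i. ks ! l) + j"
  using offset_less[OF assms] by (simp add: block_perm_def block_index_offset[OF assms])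

lemma sum_list_take_sum: "i \<le> length ks \<Longrightarrow> sum_list (take i ks) = (\<Sum>l<i. ks ! l)"
  for ks :: "nat list"
  by (simp add: sum_list_sum_nth atLeast0LessThan)

lemma block_offset:
  fixes ms :: "nat list"
  assumes \<sigma>: "\<sigma> permutes {..<length ms}" and ks: "ks = permute_list \<sigma> ms" and i: "i < length ms"
  shows "(\<Sum>l | l < length ks \<and> \<sigma> l < \<sigma> i. ks ! l) = sum_list (take (\<sigma> i) ms)"
proof -
  have si: "\<sigma> i < length ms" using permutes_in_image[OF \<sigma>, of i] i by simp
  have "(\<Sum>l | l < length ks \<and> \<sigma> l < \<sigma> i. ks ! l) = (\<Sum>l\<in>{l. l < length ms \<and> \<sigma> l < \<sigma> i}. ms ! \<sigma> l)"
    using ks permute_list_nth[OF \<sigma>] by (intro sum.cong) auto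
  also have "\<dots> = (\<Sum>l<\<sigma> i. ms ! l)"
  proof (rule sum.reindex_bij_betw)
    show "bij_betw \<sigma> {l. l < length ms \<and> \<sigma> l < \<sigma> i} {..<\<sigma> i}"
    proof (rule bij_betw_imageI)
      show "inj_on \<sigma> {l. l < length ms \<and> \<sigma> l < \<sigma> i}"
        using permutes_inj[OF \<sigma>] by (auto simp: inj_on_def)
      show "\<sigma> ` {l. l < length ms \<and> \<sigma> l < \<sigma> i} = {..<\<sigma> i}"
      proof (intro equalityI subsetI)
        fix m assume m: "m \<in> {..<\<sigma> i}"
        obtain l where l: "m = \<sigma> l" using permutes_surj[OF \<sigma>] by (metis surj_def)
        then have "l < length ms" using m si permutes_in_image[OF \<sigma>, of l] by auto
        then show "m \<in> \<sigma> ` {l. l < length ms \<and> \<sigma> l < \<sigma> i}" using l m by auto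
      qed auto
    qed
  qed
  also have "\<dots> = sum_list (take (\<sigma> i) ms)" using si by (simp add: sum_list_take_sum)
  finally show ?thesis .
qed

lemma block_perm_offset:
  fixes ms :: "nat list"
  assumes \<sigma>: "\<sigma> permutes {..<length ms}" and ks: "ks = permute_list \<sigma> ms"
    and i: "i < length ms" "j < ks ! i"
  shows "block_perm \<sigma> ks (sum_list (take i ks) + j) = sum_list (take (\<sigma> i) ms) + j"
proof -
  have "i < length ks" using i ks by simp
  from block_perm_offset_raw[OF this i(2)] block_offset[OF \<sigma> ks i(1)] show ?thesis by simp
qed

lemma permutes_of_surj:
  assumes "\<And>n. S \<le> n \<Longrightarrow> f n = n" "\<And>m. m < S \<Longrightarrow> \<exists>n<S. f n = m"
  shows "f permutes {..<S::nat}"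
proof (rule bij_imp_permutes)
  have sub: "{..<S} \<subseteq> f ` {..<S}" using assms(2) by force
  have "card (f ` {..<S}) \<le> card {..<S}" by (rule card_image_le) simp
  then have im: "f ` {..<S} = {..<S}" using sub
    by (metis card_seteq finite_imageI finite_lessThan)
  then have "inj_on f {..<S}" by (simp add: eq_card_imp_inj_on)
  then show "bij_betw f {..<S} {..<S}" using im by (simp add: bij_betw_def)
qed (use assms(1) in auto)

lemma sum_list_permute_list:
  fixes ms :: "nat list"
  assumes "\<sigma> permutes {..<length ms}"
  shows "sum_list (permute_list \<sigma> ms) = sum_list ms"
  using mset_permute_list[OF assms] by (metis sum_mset_sum_list)

lemma block_perm_permutes':
  fixes ms :: "nat list"
  assumes \<sigma>: "\<sigma> permutes {..<length ms}" and ks: "ks = permute_list \<sigma> ms"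
  shows "block_perm \<sigma> ks permutes {..<sum_list ks}"
proof (rule permutes_of_surj)
  fix m assume "m < sum_list ks"
  then have "m < sum_list ms" using sum_list_permute_list[OF \<sigma>] ks by simp
  then obtain p j where pj: "p < length ms" "j < ms ! p" "m = sum_list (take p ms) + j"
    by (rule split_index)
  obtain i where i: "p = \<sigma> i" using permutes_surj[OF \<sigma>] by (metis surj_def)
  have il: "i < length ms" using permutes_in_image[OF \<sigma>, of i] pj(1) i by simp
  have jk: "j < ks ! i" using ks permute_list_nth[OF \<sigma> il] i pj by simp
  show "\<exists>n<sum_list ks. block_perm \<sigma> ks n = m"
  proof (intro exI[of _ "sum_list (take i ks) + j"] conjI)
    show "sum_list (take i ks) + j < sum_list ks"
      using il ks jk by (intro offset_less) auto
    show "block_perm \<sigma> ks (sum_list (take i ks) + j) = m"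
      using block_perm_offset[OF \<sigma> ks il jk] i pj(3) by simp
  qed
qed (simp add: block_perm_ge)

lemma permute_list_inv:
  assumes "\<sigma> permutes {..<length ks}"
  shows "ks = permute_list \<sigma> (permute_list (inv \<sigma>) ks)"
  using permute_list_compose[OF permutes_inv[OF assms], of \<sigma>] permutes_inv_o[OF assms]
    permute_list_compose[OF assms] assms by (metis permute_list_compose permute_list_id permutes_inv)

lemma block_perm_permutes:
  assumes "\<sigma> permutes {..<length ks}"
  shows "block_perm \<sigma> ks permutes {..<sum_list ks}"
  by (rule block_perm_permutes'[OF _ permute_list_inv[OF assms]]) (use assms in simp)

lemma sum_perm_permutes:
  assumes "length ss = length ks" "\<And>i. i < length ks \<Longrightarrow> ss ! i permutes {..<ks ! i}"
  shows "sum_perm ks ss permutes {..<sum_list ks}"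
proof (rule permutes_of_surj)
  fix m assume "m < sum_list ks"
  then obtain i j where ij: "i < length ks" "j < ks ! i" "m = sum_list (take i ks) + j"
    by (rule split_index)
  obtain l where l: "j = (ss ! i) l" using permutes_surj[OF assms(2)[OF ij(1)]] by (metis surj_def)
  have lk: "l < ks ! i" using permutes_in_image[OF assms(2)[OF ij(1)], of l] ij(2) l by simp
  show "\<exists>n<sum_list ks. sum_perm ks ss n = m"
    using offset_less[OF ij(1) lk] sum_perm_offset[OF ij(1) lk assms(1)] ij(3) l by metis
qed (simp add: sum_perm_ge assms(1))

lemma permute_list_block_perm:
  assumes \<sigma>: "\<sigma> permutes {..<length cs}" and ks: "ks = map length (permute_list \<sigma> cs)"
  shows "permute_list (block_perm \<sigma> ks) (concat cs) = concat (permute_list \<sigma> cs)"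
proof (rule concat_eqI[OF _ ks])
  let ?ms = "map length cs"
  have ks': "ks = permute_list \<sigma> ?ms" using ks permute_list_map[OF \<sigma>] by metis
  have \<sigma>': "\<sigma> permutes {..<length ?ms}" using \<sigma> by simp
  have len: "length (concat cs) = sum_list ks"
    using sum_list_permute_list[OF \<sigma>'] ks' by (simp add: length_concat)
  then show "length (permute_list (block_perm \<sigma> ks) (concat cs)) = sum_list ks" by simp
  fix i j assume "i < length (permute_list \<sigma> cs)" and jl: "j < length (permute_list \<sigma> cs ! i)"
  then have i: "i < length cs" by simp
  have j: "j < ks ! i" using jl ks i by simp
  have si: "\<sigma> i < length cs" using permutes_in_image[OF \<sigma>, of i] i by simp
  have jc: "j < length (cs ! \<sigma> i)" using jl permute_list_nth[OF \<sigma> i] by simp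
  have lt: "sum_list (take i ks) + j < sum_list ks" using i ks j by (intro offset_less) auto
  have "permute_list (block_perm \<sigma> ks) (concat cs) ! (sum_list (take i ks) + j) =
    concat cs ! block_perm \<sigma> ks (sum_list (take i ks) + j)"
    using lt len by (simp add: permute_list_def)
  also have "block_perm \<sigma> ks (sum_list (take i ks) + j) = sum_list (take (\<sigma> i) ?ms) + j"
    using block_perm_offset[OF \<sigma>' ks' _ j] i by simp
  also have "concat cs ! \<dots> = cs ! \<sigma> i ! j" by (rule concat_nth[OF si jc])
  finally show "permute_list (block_perm \<sigma> ks) (concat cs) ! (sum_list (take i ks) + j) =
    permute_list \<sigma> cs ! i ! j" using permute_list_nth[OF \<sigma> i] by simp
qed

lemma permute_list_sum_perm:
  assumes "length ss = length cs" "\<And>i. i < length cs \<Longrightarrow> ss ! i permutes {..<length (cs ! i)}"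
  shows "permute_list (sum_perm (map length cs) ss) (concat cs) = concat (map2 permute_list ss cs)"
proof -
  have ks: "map length cs = map length (map2 permute_list ss cs)"
    using assms(1) by (intro nth_equalityI) auto
  show ?thesis
  proof (rule concat_eqI[OF _ ks])
    show "length (permute_list (sum_perm (map length cs) ss) (concat cs)) = sum_list (map length cs)"
      by (simp add: length_concat)
  next
    fix i j assume "i < length (map2 permute_list ss cs)" "j < length (map2 permute_list ss cs ! i)"
    then have i: "i < length cs" and j: "j < length (cs ! i)" using assms(1) by auto
    have sj: "(ss ! i) j < length (cs ! i)" using permutes_in_image[OF assms(2)[OF i], of j] j by simp
    have lt: "sum_list (take i (map length cs)) + j < sum_list (map length cs)"
      using i j by (intro offset_less) auto
    show "permute_list (sum_perm (map length cs) ss) (concat cs) ! (sum_list (take i (map length cs)) + j) =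
      map2 permute_list ss cs ! i ! j"
      using lt sum_perm_offset[of i "map length cs" j ss] concat_nth[OF i sj] i j assms(1)
        permute_list_nth[OF assms(2)[OF i] j]
      by (simp add: permute_list_def[of "sum_perm _ _"] length_concat)
  qed
qed

lemma concat_concat: "concat (concat xss) = concat (map concat xss)"
  by (induction xss) auto

subsection \<open>Quotients\<close>

lemma pre_operadD:
  assumes "pre_operad K P"
  shows pre_operad_seq: "colored_seq K (ops P)"
    and pre_operad_act: "\<And>t c \<sigma> x. x \<in> ops P t c \<Longrightarrow> \<sigma> permutes {..<length c} \<Longrightarrow>
        act P t c \<sigma> x \<in> ops P t (permute_list \<sigma> c)"
    and pre_operad_gam: "\<And>t a bs x ys. x \<in> ops P t a \<Longrightarrow> ops_list P a bs ys \<Longrightarrow>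
        gam P t a bs x ys \<in> ops P t (concat bs)"
    and pre_operad_one: "\<And>t. t \<in> K \<Longrightarrow> one P t \<in> ops P t [t]"
  using assms unfolding pre_operad_def by blast+

lemma op_homD:
  assumes "op_hom K P Q h"
  shows op_hom_mem: "\<And>t c x. x \<in> ops P t c \<Longrightarrow> h t c x \<in> ops Q t c"
    and op_hom_ext: "\<And>t c x. x \<notin> ops P t c \<Longrightarrow> h t c x = undefined"
    and op_hom_act: "\<And>t c \<sigma> x. x \<in> ops P t c \<Longrightarrow> \<sigma> permutes {..<length c} \<Longrightarrow>
        h t (permute_list \<sigma> c) (act P t c \<sigma> x) = act Q t c \<sigma> (h t c x)"
    and op_hom_gam: "\<And>t a bs x ys. x \<in> ops P t a \<Longrightarrow> ops_list P a bs ys \<Longrightarrow>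
        h t (concat bs) (gam P t a bs x ys) =
        gam Q t a bs (h t a x) (map (\<lambda>i. h (a ! i) (bs ! i) (ys ! i)) [0..<length a])"
    and op_hom_one: "\<And>t. t \<in> K \<Longrightarrow> h t [t] (one P t) = one Q t"
  using assms unfolding op_hom_def by (blast, (metis PiE_arb), blast+)

lemma ops_list_map:
  assumes "length bs = length a"
    and "\<And>i. i < length a \<Longrightarrow> f i \<in> ops P (a ! i) (bs ! i)"
  shows "ops_list P a bs (map f [0..<length a])"
  using assms by (simp add: ops_list_def)

lemma ops_list_permute:
  assumes "ops_list P a bs ys" "\<sigma> permutes {..<length a}"
  shows "ops_list P (permute_list \<sigma> a) (permute_list \<sigma> bs) (permute_list \<sigma> ys)"
  unfolding ops_list_def
proof (intro conjI allI impI)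
  note l = assms(1)[unfolded ops_list_def]
  fix i assume "i < length (permute_list \<sigma> a)"
  then have i: "i < length a" by simp
  then have "\<sigma> i < length a" using permutes_in_image[OF assms(2), of i] by simp
  then have "ys ! \<sigma> i \<in> ops P (a ! \<sigma> i) (bs ! \<sigma> i)" using l by blast
  then show "permute_list \<sigma> ys ! i \<in> ops P (permute_list \<sigma> a ! i) (permute_list \<sigma> bs ! i)"
    using i l by (simp add: permute_list_def)
qed (use assms(1) in \<open>simp_all add: ops_list_def\<close>)

lemma ops_list_concat:
  assumes bs: "length bs = length a" and ccs: "length ccs = length a" and zss: "length zss = length a"
    and z: "\<forall>i<length a. ops_list P (bs ! i) (ccs ! i) (zss ! i)"
  shows "ops_list P (concat bs) (concat ccs) (concat zss)"
proof -
  have lc: "map length ccs = map length bs" and lz: "map length zss = map length bs"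
    using assms by (auto intro!: nth_equalityI simp: ops_list_def)
  show ?thesis unfolding ops_list_def
  proof (intro conjI allI impI)
    show "length (concat ccs) = length (concat bs)" "length (concat zss) = length (concat bs)"
      using lc lz by (simp_all add: length_concat)
    fix n assume "n < length (concat bs)"
    then have "n < sum_list (map length bs)" by (simp add: length_concat)
    then obtain i j where ij: "i < length (map length bs)" "j < map length bs ! i"
      "n = sum_list (take i (map length bs)) + j" by (rule split_index)
    have z': "ops_list P (bs ! i) (ccs ! i) (zss ! i)" using z ij bs by simp
    have j: "j < length (bs ! i)" "j < length (ccs ! i)" "j < length (zss ! i)"
      using ij z' by (auto simp: ops_list_def)
    have "zss ! i ! j \<in> ops P (bs ! i ! j) (ccs ! i ! j)"
      using z' j by (auto simp: ops_list_def)
    then show "concat zss ! n \<in> ops P (concat bs ! n) (concat ccs ! n)"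
      using concat_nth2[of i bs j "map length bs"] concat_nth2[of i ccs j "map length bs"]
        concat_nth2[of i zss j "map length bs"] ij j assms lc lz by simp
  qed
qed

lemma concat_singletons: "concat (map (\<lambda>s. [s]) c) = c"
  by (induction c) auto

lemma op_law_ops:
  assumes P: "pre_operad K P" and "op_law P t c x y"
  shows "x \<in> ops P t c \<and> y \<in> ops P t c"
  using assms(2)
proof cases
  case act_id
  then show ?thesis using pre_operad_act[OF P, of x _ _ id] by (simp add: permutes_id pre_operad_act[OF P])
       (metis P permute_list_id permutes_id pre_operad_act)
next
  case (act_comp x' c' \<sigma> \<tau>)
  then show ?thesis
    using pre_operad_act[OF P act_comp(4), of "\<sigma> \<circ> \<tau>"] permutes_compose[of \<tau> _ \<sigma>]
      pre_operad_act[OF P pre_operad_act[OF P act_comp(4), of \<sigma>], of \<tau>] permute_list_compose[of \<tau> c' \<sigma>]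
    by auto
next
  case unit_left
  have "t \<in> K" using P unit_left by (auto simp: pre_operad_def colored_seq_def)
  then have "one P t \<in> ops P t [t]" by (rule pre_operad_one[OF P])
  from pre_operad_gam[OF P this, of "[c]" "[y]"] unit_left show ?thesis
    by (simp add: ops_list_def)
next
  case unit_right
  have "set c \<subseteq> K" using P unit_right by (auto simp: pre_operad_def colored_seq_def)
  then have "ops_list P c (map (\<lambda>s. [s]) c) (map (one P) c)"
    using pre_operad_one[OF P] by (auto simp: ops_list_def subset_iff)
  from pre_operad_gam[OF P unit_right(2) this] unit_right show ?thesis
    by (simp add: concat_singletons)
next
  case (assoc x' a bs ys ccs zss)
  have l: "length bs = length a" using assoc by (simp add: ops_list_def)
  have 1: "gam P t a bs x' ys \<in> ops P t (concat bs)" by (rule pre_operad_gam[OF P assoc(4,5)])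
  have 2: "ops_list P (concat bs) (concat ccs) (concat zss)"
    using assoc l by (intro ops_list_concat)
  have 3: "ops_list P a (map concat ccs)
       (map (\<lambda>i. gam P (a ! i) (bs ! i) (ccs ! i) (ys ! i) (zss ! i)) [0..<length a])"
    using assoc by (intro ops_list_map) (auto intro!: pre_operad_gam[OF P] simp: ops_list_def[of P a])
  show ?thesis
    using pre_operad_gam[OF P 1 2] pre_operad_gam[OF P assoc(4) 3] assoc by (simp add: concat_concat)
next
  case (equivariance_outer x' a bs ys \<sigma>)
  have l: "length bs = length a" using equivariance_outer by (simp add: ops_list_def)
  have s: "\<sigma> permutes {..<length bs}" using l equivariance_outer by simp
  have "\<sigma> permutes {..<length (map length bs)}" using s by simp
  from block_perm_permutes'[OF this permute_list_map[OF s, symmetric]]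
  have bp: "block_perm \<sigma> (map length (permute_list \<sigma> bs)) permutes {..<length (concat bs)}"
    using sum_list_permute_list[of \<sigma> "map length bs"] s permute_list_map[OF s, of length]
    by (simp add: length_concat)
  show ?thesis
    using pre_operad_act[OF P pre_operad_gam[OF P equivariance_outer(4,5)] bp]
      pre_operad_gam[OF P pre_operad_act[OF P equivariance_outer(4,6)] ops_list_permute[OF equivariance_outer(5,6)]]
      permute_list_block_perm[OF s HOL.refl] equivariance_outer by simp
next
  case (equivariance_inner x' a bs ys \<tau>s)
  have l: "length bs = length a" using equivariance_inner by (simp add: ops_list_def)
  have sp: "sum_perm (map length bs) \<tau>s permutes {..<length (concat bs)}"
    using sum_perm_permutes[of \<tau>s "map length bs"] l equivariance_inner by (simp add: length_concat)
  have "ops_list P a (map2 permute_list \<tau>s bs)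
    (map (\<lambda>i. act P (a ! i) (bs ! i) (\<tau>s ! i) (ys ! i)) [0..<length a])"
    using equivariance_inner l
    by (intro ops_list_map) (auto intro!: pre_operad_act[OF P] simp: ops_list_def)
  then show ?thesis
    using pre_operad_act[OF P pre_operad_gam[OF P equivariance_inner(4,5)] sp]
      pre_operad_gam[OF P equivariance_inner(4)] permute_list_sum_perm[of \<tau>s bs] equivariance_inner l
    by simp
qed

lemma op_cong_ops:
  assumes P: "pre_operad K P" and "op_cong P E t c x y"
  shows "x \<in> ops P t c \<and> y \<in> ops P t c"
  using assms(2)
proof induction
  case (law t c x y)
  then show ?case by (rule op_law_ops[OF P])
next
  case (gam t a x x' bs ys ys')
  then show ?case using pre_operad_gam[OF P] by (simp add: ops_list_def)
qed (auto intro: pre_operad_act[OF P])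

lemma op_class_eq_iff:
  assumes "x \<in> ops P t c" "y \<in> ops P t c"
  shows "op_class P E t c x = op_class P E t c y \<longleftrightarrow> op_cong P E t c x y"
  using assms unfolding op_class_def
  by (auto intro: op_cong.sym op_cong.trans op_cong.refl)

lemma op_class_rep:
  assumes "x \<in> ops P t c"
  shows "op_cong P E t c x (rep (op_class P E t c x))"
proof -
  have "x \<in> op_class P E t c x" using assms by (simp add: op_class_def op_cong.refl)
  then have "rep (op_class P E t c x) \<in> op_class P E t c x" unfolding rep_def by (rule someI)
  then show ?thesis by (simp add: op_class_def)
qed

lemma op_class_eqI:
  assumes "op_cong P E t c x y"
  shows "op_class P E t c x = op_class P E t c y"
  using assms unfolding op_class_def by (auto intro: op_cong.sym op_cong.trans)

lemma quot_ops: "ops (op_quotient P E) t c = op_class P E t c ` ops P t c"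
  by (simp add: op_quotient_def)

lemma quot_one: "one (op_quotient P E) t = op_class P E t [t] (one P t)"
  by (simp add: op_quotient_def)

lemma quot_act:
  assumes "x \<in> ops P t c" "\<sigma> permutes {..<length c}"
  shows "act (op_quotient P E) t c \<sigma> (op_class P E t c x) =
    op_class P E t (permute_list \<sigma> c) (act P t c \<sigma> x)"
  using op_class_eqI[OF op_cong.act[OF op_class_rep[OF assms(1)] assms(2)]]
  by (simp add: op_quotient_def)

definition classes where
  "classes P E a bs ys = map (\<lambda>i. op_class P E (a ! i) (bs ! i) (ys ! i)) [0..<length a]"

lemma quot_gam:
  assumes "x \<in> ops P t a" "ops_list P a bs ys"
  shows "gam (op_quotient P E) t a bs (op_class P E t a x) (classes P E a bs ys) =
    op_class P E t (concat bs) (gam P t a bs x ys)"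
proof -
  have "op_cong P E t (concat bs) (gam P t a bs x ys)
    (gam P t a bs (rep (op_class P E t a x)) (map rep (classes P E a bs ys)))"
    using assms
    by (intro op_cong.gam) (auto simp: ops_list_def classes_def intro!: op_class_rep)
  from op_class_eqI[OF this] show ?thesis by (simp add: op_quotient_def)
qed

lemma quot_ops_list:
  assumes "ops_list (op_quotient P E) a bs Ys"
  obtains ys where "ops_list P a bs ys" "Ys = classes P E a bs ys"
proof -
  have "\<forall>i. \<exists>y. i < length a \<longrightarrow> y \<in> ops P (a ! i) (bs ! i) \<and> Ys ! i = op_class P E (a ! i) (bs ! i) y"
    using assms by (auto simp: ops_list_def quot_ops)
  then obtain f where f: "\<And>i. i < length a \<Longrightarrow> f i \<in> ops P (a ! i) (bs ! i) \<and>
    Ys ! i = op_class P E (a ! i) (bs ! i) (f i)" by metis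
  show ?thesis
  proof
    show "ops_list P a bs (map f [0..<length a])" using assms f by (simp add: ops_list_def)
    show "Ys = classes P E a bs (map f [0..<length a])"
      using assms f by (auto intro!: nth_equalityI simp: classes_def ops_list_def)
  qed
qed

lemma classes_ops_list:
  assumes "ops_list P a bs ys"
  shows "ops_list (op_quotient P E) a bs (classes P E a bs ys)"
  using assms by (simp add: ops_list_def classes_def quot_ops)

lemma quotient_pre_operad:
  assumes P: "pre_operad K P"
  shows "pre_operad K (op_quotient P E)"
  unfolding pre_operad_def
proof (intro conjI allI impI ballI)
  show "colored_seq K (ops (op_quotient P E))"
    using P by (auto simp: colored_seq_def quot_ops pre_operad_def)
next
  fix t c \<sigma> X assume "X \<in> ops (op_quotient P E) t c" and s: "\<sigma> permutes {..<length c}"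
  then obtain x where x: "x \<in> ops P t c" "X = op_class P E t c x" by (auto simp: quot_ops)
  then show "act (op_quotient P E) t c \<sigma> X \<in> ops (op_quotient P E) t (permute_list \<sigma> c)"
    using quot_act[OF x(1) s] pre_operad_act[OF P x(1) s] by (simp add: quot_ops)
next
  fix t a bs X Ys assume "X \<in> ops (op_quotient P E) t a" "ops_list (op_quotient P E) a bs Ys"
  then obtain x ys where x: "x \<in> ops P t a" "X = op_class P E t a x" "ops_list P a bs ys"
    "Ys = classes P E a bs ys" by (metis imageE quot_ops quot_ops_list)
  then show "gam (op_quotient P E) t a bs X Ys \<in> ops (op_quotient P E) t (concat bs)"
    using quot_gam[OF x(1,3), of E] pre_operad_gam[OF P x(1,3)] by (simp add: quot_ops)
next
  fix t assume "t \<in> K"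
  then show "one (op_quotient P E) t \<in> ops (op_quotient P E) t [t]"
    using pre_operad_one[OF P] by (simp add: quot_ops quot_one)
qed

lemma nth_upt_map: "i < n \<Longrightarrow> map f [0..<n] ! i = f i" by simp

theorem quotient_operad:
  assumes P: "pre_operad K P"
  shows "operad K (op_quotient P E)"
  unfolding operad_def
proof (intro conjI allI impI quotient_pre_operad[OF P])
  let ?Q = "op_quotient P E"
  let ?k = "op_class P E"
  note law = op_class_eqI[OF op_cong.law]
  fix t c X Y assume "op_law ?Q t c X Y"
  then show "X = Y"
  proof cases
    case act_id
    then obtain x where x: "x \<in> ops P t c" "Y = ?k t c x" by (auto simp: quot_ops)
    have "act ?Q t c id (?k t c x) = ?k t c (act P t c id x)"
      using quot_act[OF x(1) permutes_id] by simp
    also have "\<dots> = ?k t c x" by (rule law) (rule op_law.act_id[OF x(1)])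
    finally show ?thesis using act_id x by simp
  next
    case (act_comp X' c' \<sigma> \<tau>)
    then obtain x where x: "x \<in> ops P t c'" "X' = ?k t c' x" by (auto simp: quot_ops)
    have st: "\<sigma> \<circ> \<tau> permutes {..<length c'}" using act_comp permutes_compose by blast
    have t: "\<tau> permutes {..<length (permute_list \<sigma> c')}" using act_comp by simp
    have "act ?Q t c' (\<sigma> \<circ> \<tau>) (?k t c' x) = ?k t (permute_list (\<sigma> \<circ> \<tau>) c') (act P t c' (\<sigma> \<circ> \<tau>) x)"
      by (rule quot_act[OF x(1) st])
    also have "\<dots> = ?k t (permute_list (\<sigma> \<circ> \<tau>) c') (act P t (permute_list \<sigma> c') \<tau> (act P t c' \<sigma> x))"
      by (rule law) (rule op_law.act_comp[OF x(1) act_comp(5,6)])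
    also have "\<dots> = act ?Q t (permute_list \<sigma> c') \<tau> (act ?Q t c' \<sigma> (?k t c' x))"
      using quot_act[OF x(1) act_comp(5)] quot_act[OF pre_operad_act[OF P x(1) act_comp(5)] t]
        permute_list_compose[OF act_comp(6), of \<sigma>] by simp
    finally show ?thesis using act_comp x by simp
  next
    case unit_left
    then obtain x where x: "x \<in> ops P t c" "Y = ?k t c x" by (auto simp: quot_ops)
    have t: "t \<in> K" using P x by (auto simp: pre_operad_def colored_seq_def)
    have "ops_list P [t] [c] [x]" using x by (simp add: ops_list_def)
    from quot_gam[OF pre_operad_one[OF P t] this, of E]
    have "gam ?Q t [t] [c] (one ?Q t) [?k t c x] = ?k t c (gam P t [t] [c] (one P t) [x])"
      by (simp add: quot_one classes_def)
    also have "\<dots> = ?k t c x" by (rule law) (rule op_law.unit_left[OF x(1)])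
    finally show ?thesis using unit_left x by simp
  next
    case unit_right
    then obtain x where x: "x \<in> ops P t c" "Y = ?k t c x" by (auto simp: quot_ops)
    have c: "set c \<subseteq> K" using P x by (auto simp: pre_operad_def colored_seq_def)
    have ol: "ops_list P c (map (\<lambda>s. [s]) c) (map (one P) c)"
      using pre_operad_one[OF P] c by (auto simp: ops_list_def subset_iff)
    have cl: "classes P E c (map (\<lambda>s. [s]) c) (map (one P) c) = map (one ?Q) c"
      by (auto simp: classes_def quot_one intro!: nth_equalityI)
    have "gam ?Q t c (map (\<lambda>s. [s]) c) (?k t c x) (map (one ?Q) c) =
      ?k t c (gam P t c (map (\<lambda>s. [s]) c) x (map (one P) c))"
      using quot_gam[OF x(1) ol, of E] cl by (simp add: concat_singletons)
    also have "\<dots> = ?k t c x" by (rule law) (rule op_law.unit_right[OF x(1)])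
    finally show ?thesis using unit_right x by simp
  next
    case (assoc X' a bs Ys ccs Zss)
    from assoc(4) obtain x where x: "x \<in> ops P t a" "X' = ?k t a x" by (auto simp: quot_ops)
    from assoc(5) obtain ys where ys: "ops_list P a bs ys" "Ys = classes P E a bs ys"
      by (rule quot_ops_list)
    have lb: "length bs = length a" using ys by (simp add: ops_list_def)
    have "\<forall>i. \<exists>zs. i < length a \<longrightarrow> ops_list P (bs ! i) (ccs ! i) zs \<and>
      Zss ! i = classes P E (bs ! i) (ccs ! i) zs"
      using assoc(8) by (metis quot_ops_list)
    then obtain f where f: "\<And>i. i < length a \<Longrightarrow> ops_list P (bs ! i) (ccs ! i) (f i) \<and>
      Zss ! i = classes P E (bs ! i) (ccs ! i) (f i)" by metis
    define zss where "zss = map f [0..<length a]"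
    have z: "\<forall>i<length a. ops_list P (bs ! i) (ccs ! i) (zss ! i)" and lz: "length zss = length a"
      using f by (simp_all add: zss_def)
    have Z: "Zss = map (\<lambda>i. classes P E (bs ! i) (ccs ! i) (zss ! i)) [0..<length a]"
      using f assoc(7) by (auto intro!: nth_equalityI simp: zss_def)
    have lc: "map length ccs = map length bs" and lzz: "map length zss = map length bs"
      using z lz lb assoc(6) by (auto intro!: nth_equalityI simp: ops_list_def)
    have cz: "concat Zss = classes P E (concat bs) (concat ccs) (concat zss)"
    proof (rule concat_eqI[symmetric])
      show "length (classes P E (concat bs) (concat ccs) (concat zss)) = sum_list (map length bs)"
        by (simp add: classes_def length_concat)
      show "map length bs = map length Zss"
        using lb by (auto intro!: nth_equalityI simp: Z classes_def)
      fix i j assume i: "i < length Zss" and j: "j < length (Zss ! i)"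
      have i': "i < length a" using i assoc(7) by simp
      have j': "j < length (bs ! i)" using j f[OF i'] by (simp add: classes_def)
      have j'': "j < length (ccs ! i)" "j < length (zss ! i)" using j' z i' by (auto simp: ops_list_def)
      have n: "sum_list (take i (map length bs)) + j < length (concat bs)"
        using offset_less[of i "map length bs" j] i' j' lb by (simp add: length_concat)
      show "classes P E (concat bs) (concat ccs) (concat zss) ! (sum_list (take i (map length bs)) + j)
        = Zss ! i ! j"
        using n j' j'' i' lb lz assoc(6) concat_nth2[of i bs j "map length bs"]
          concat_nth2[of i ccs j "map length bs"] concat_nth2[of i zss j "map length bs"] lc lzz
        by (simp add: Z classes_def)
    qed
    have ol: "ops_list P (concat bs) (concat ccs) (concat zss)"
      using lb assoc(6) lz z by (rule ops_list_concat)
    have ol2: "ops_list P a (map concat ccs)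
       (map (\<lambda>i. gam P (a ! i) (bs ! i) (ccs ! i) (ys ! i) (zss ! i)) [0..<length a])"
      using assoc(6) z ys by (intro ops_list_map) (auto intro!: pre_operad_gam[OF P] simp: ops_list_def[of P a])
    have "X = ?k t c (gam P t (concat bs) (concat ccs) (gam P t a bs x ys) (concat zss))"
      using quot_gam[OF x(1) ys(1), of E] quot_gam[OF pre_operad_gam[OF P x(1) ys(1)] ol, of E]
        assoc x ys cz by simp
    also have "\<dots> = ?k t c (gam P t a (map concat ccs) x
       (map (\<lambda>i. gam P (a ! i) (bs ! i) (ccs ! i) (ys ! i) (zss ! i)) [0..<length a]))"
      unfolding assoc(1)
      by (rule law) (rule op_law.assoc[OF x(1) ys(1) assoc(6) lz z])
    also have "\<dots> = gam ?Q t a (map concat ccs) (?k t a x) (classes P E a (map concat ccs)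
       (map (\<lambda>i. gam P (a ! i) (bs ! i) (ccs ! i) (ys ! i) (zss ! i)) [0..<length a]))"
      using quot_gam[OF x(1) ol2, of E] assoc(1) by (simp add: concat_concat)
    also have "classes P E a (map concat ccs)
       (map (\<lambda>i. gam P (a ! i) (bs ! i) (ccs ! i) (ys ! i) (zss ! i)) [0..<length a]) =
       map (\<lambda>i. gam ?Q (a ! i) (bs ! i) (ccs ! i) (Ys ! i) (Zss ! i)) [0..<length a]"
    proof (rule nth_equalityI)
      fix i assume "i < length (classes P E a (map concat ccs)
       (map (\<lambda>i. gam P (a ! i) (bs ! i) (ccs ! i) (ys ! i) (zss ! i)) [0..<length a]))"
      then have i: "i < length a" by (simp add: classes_def)
      have y: "ys ! i \<in> ops P (a ! i) (bs ! i)" using ys i by (simp add: ops_list_def)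
      from quot_gam[OF y z[rule_format, OF i], of E]
      show "classes P E a (map concat ccs)
       (map (\<lambda>i. gam P (a ! i) (bs ! i) (ccs ! i) (ys ! i) (zss ! i)) [0..<length a]) ! i =
       map (\<lambda>i. gam ?Q (a ! i) (bs ! i) (ccs ! i) (Ys ! i) (Zss ! i)) [0..<length a] ! i"
        using i assoc(6) by (simp add: Z ys(2) classes_def)
    qed (simp add: classes_def)
    finally show ?thesis using assoc x by simp
  next
    case (equivariance_outer X' a bs Ys \<sigma>)
    from equivariance_outer(4) obtain x where x: "x \<in> ops P t a" "X' = ?k t a x" by (auto simp: quot_ops)
    from equivariance_outer(5) obtain ys where ys: "ops_list P a bs ys" "Ys = classes P E a bs ys"
      by (rule quot_ops_list)
    note s = equivariance_outer(6)
    have lb: "length bs = length a" "length ys = length a" using ys by (simp_all add: ops_list_def)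
    have sb: "\<sigma> permutes {..<length bs}" using lb s by simp
    have bp: "block_perm \<sigma> (map length (permute_list \<sigma> bs)) permutes {..<length (concat bs)}"
      using block_perm_permutes[of \<sigma> "map length (permute_list \<sigma> bs)"] sb
        sum_list_permute_list[of \<sigma> "map length bs"] permute_list_map[OF sb, of length]
      by (simp add: length_concat)
    have cl: "permute_list \<sigma> Ys =
      classes P E (permute_list \<sigma> a) (permute_list \<sigma> bs) (permute_list \<sigma> ys)"
    proof (rule nth_equalityI)
      fix i assume "i < length (permute_list \<sigma> Ys)"
      then have i: "i < length a" using ys by (simp add: classes_def)
      then have "\<sigma> i < length a" using permutes_in_image[OF s, of i] by simp
      then show "permute_list \<sigma> Ys ! i =
        classes P E (permute_list \<sigma> a) (permute_list \<sigma> bs) (permute_list \<sigma> ys) ! i"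
        using i lb by (simp add: ys(2) classes_def permute_list_def)
    qed (simp add: ys(2) classes_def)
    have "X = ?k t c (gam P t (permute_list \<sigma> a) (permute_list \<sigma> bs) (act P t a \<sigma> x) (permute_list \<sigma> ys))"
      using quot_act[OF x(1) s, of E] cl
        quot_gam[OF pre_operad_act[OF P x(1) s] ops_list_permute[OF ys(1) s], of E]
        equivariance_outer(1,2) x(2) by simp
    also have "\<dots> = ?k t c (act P t (concat bs) (block_perm \<sigma> (map length (permute_list \<sigma> bs)))
       (gam P t a bs x ys))"
      unfolding equivariance_outer(1)
      by (rule law) (rule op_law.equivariance_outer[OF x(1) ys(1) s])
    also have "\<dots> = Y"
      using quot_act[OF pre_operad_gam[OF P x(1) ys(1)] bp, of E] quot_gam[OF x(1) ys(1), of E]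
        permute_list_block_perm[OF sb HOL.refl] equivariance_outer(1,3) x(2) ys(2) by simp
    finally show ?thesis .
  next
    case (equivariance_inner X' a bs Ys \<tau>s)
    from equivariance_inner(4) obtain x where x: "x \<in> ops P t a" "X' = ?k t a x" by (auto simp: quot_ops)
    from equivariance_inner(5) obtain ys where ys: "ops_list P a bs ys" "Ys = classes P E a bs ys"
      by (rule quot_ops_list)
    note lt = equivariance_inner(6) and tp = equivariance_inner(7)
    have lb: "length bs = length a" "length ys = length a" using ys by (simp_all add: ops_list_def)
    have sp: "sum_perm (map length bs) \<tau>s permutes {..<length (concat bs)}"
      using sum_perm_permutes[of \<tau>s "map length bs"] lb lt tp by (simp add: length_concat)
    let ?bs = "map2 permute_list \<tau>s bs"
    let ?ys = "map (\<lambda>i. act P (a ! i) (bs ! i) (\<tau>s ! i) (ys ! i)) [0..<length a]"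
    have cl: "map (\<lambda>i. act ?Q (a ! i) (bs ! i) (\<tau>s ! i) (Ys ! i)) [0..<length a] =
      classes P E a ?bs ?ys"
    proof (rule nth_equalityI)
      fix i assume "i < length (map (\<lambda>i. act ?Q (a ! i) (bs ! i) (\<tau>s ! i) (Ys ! i)) [0..<length a])"
      then have i: "i < length a" by simp
      have y: "ys ! i \<in> ops P (a ! i) (bs ! i)" using ys i by (simp add: ops_list_def)
      from quot_act[OF y tp[rule_format, OF i], of E]
      show "map (\<lambda>i. act ?Q (a ! i) (bs ! i) (\<tau>s ! i) (Ys ! i)) [0..<length a] ! i =
        classes P E a ?bs ?ys ! i"
        using i lt lb by (simp add: ys(2) classes_def)
    qed (simp add: classes_def)
    have ol: "ops_list P a ?bs ?ys"
      using lt tp lb ys(1)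
      by (intro ops_list_map) (auto intro!: pre_operad_act[OF P] simp: ops_list_def)
    have "X = ?k t c (gam P t a ?bs x ?ys)"
      using cl quot_gam[OF x(1) ol, of E] equivariance_inner(1,2) x(2) by simp
    also have "\<dots> = ?k t c (act P t (concat bs) (sum_perm (map length bs) \<tau>s) (gam P t a bs x ys))"
      unfolding equivariance_inner(1)
      by (rule law) (rule op_law.equivariance_inner[OF x(1) ys(1) lt tp])
    also have "\<dots> = Y"
      using quot_act[OF pre_operad_gam[OF P x(1) ys(1)] sp, of E] quot_gam[OF x(1) ys(1), of E]
        permute_list_sum_perm[of \<tau>s bs] lt lb tp equivariance_inner(1,3) x(2) ys(2) by simp
    finally show ?thesis .
  qed
qed

lemma ops_list_hom:
  assumes "op_hom K P Q h" "ops_list P a bs ys"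
  shows "ops_list Q a bs (map (\<lambda>i. h (a ! i) (bs ! i) (ys ! i)) [0..<length a])"
  using assms by (intro ops_list_map) (auto simp: ops_list_def intro: op_hom_mem)

lemma op_law_hom:
  assumes P: "pre_operad K P" and h: "op_hom K P Q h" and "op_law P t c x y"
  shows "op_law Q t c (h t c x) (h t c y)"
  using assms(3)
proof cases
  case act_id
  then show ?thesis
    using op_hom_act[OF h act_id(2) permutes_id] op_law.act_id[OF op_hom_mem[OF h act_id(2)]] by simp
next
  case (act_comp x' c' \<sigma> \<tau>)
  have st: "\<sigma> \<circ> \<tau> permutes {..<length c'}" using act_comp permutes_compose by blast
  have t: "\<tau> permutes {..<length (permute_list \<sigma> c')}" using act_comp by simp
  show ?thesis
    using op_law.act_comp[OF op_hom_mem[OF h act_comp(4)] act_comp(5,6)]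
      op_hom_act[OF h act_comp(4) st] op_hom_act[OF h act_comp(4,5)]
      op_hom_act[OF h pre_operad_act[OF P act_comp(4,5)] t]
      permute_list_compose[OF act_comp(6), of \<sigma>] act_comp(1-3) by simp
next
  case unit_left
  have t: "t \<in> K" using P unit_left by (auto simp: pre_operad_def colored_seq_def)
  have "ops_list P [t] [c] [y]" using unit_left by (simp add: ops_list_def)
  from op_hom_gam[OF h pre_operad_one[OF P t] this] op_law.unit_left[OF op_hom_mem[OF h unit_left(2)]]
  show ?thesis using unit_left op_hom_one[OF h t] by simp
next
  case unit_right
  have c: "set c \<subseteq> K" using P unit_right by (auto simp: pre_operad_def colored_seq_def)
  have ol: "ops_list P c (map (\<lambda>s. [s]) c) (map (one P) c)"
    using pre_operad_one[OF P] c by (auto simp: ops_list_def subset_iff)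
  have "map (\<lambda>i. h (c ! i) (map (\<lambda>s. [s]) c ! i) (map (one P) c ! i)) [0..<length c] = map (one Q) c"
    using c op_hom_one[OF h] by (auto intro!: nth_equalityI simp: subset_iff)
  with op_hom_gam[OF h unit_right(2) ol] op_law.unit_right[OF op_hom_mem[OF h unit_right(2)]]
  show ?thesis using unit_right by (simp add: concat_singletons)
next
  case (assoc x' a bs ys ccs zss)
  have lb: "length bs = length a" using assoc by (simp add: ops_list_def)
  note lc = assoc(6) and lz = assoc(7) and z = assoc(8)
  have ol: "ops_list P (concat bs) (concat ccs) (concat zss)"
    using lb lc lz z by (rule ops_list_concat)
  have ol2: "ops_list P a (map concat ccs)
     (map (\<lambda>i. gam P (a ! i) (bs ! i) (ccs ! i) (ys ! i) (zss ! i)) [0..<length a])"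
    using assoc by (intro ops_list_map) (auto intro!: pre_operad_gam[OF P] simp: ops_list_def[of P a])
  define ys' where "ys' = map (\<lambda>i. h (a ! i) (bs ! i) (ys ! i)) [0..<length a]"
  define zss' where "zss' = map (\<lambda>i. map (\<lambda>j. h (bs ! i ! j) (ccs ! i ! j) (zss ! i ! j))
    [0..<length (bs ! i)]) [0..<length a]"
  have y': "ops_list Q a bs ys'" unfolding ys'_def by (rule ops_list_hom[OF h assoc(5)])
  have z': "\<forall>i<length a. ops_list Q (bs ! i) (ccs ! i) (zss' ! i)"
    using ops_list_hom[OF h z[rule_format]] by (simp add: zss'_def)
  have lcs: "map length ccs = map length bs" and lzs: "map length zss = map length bs"
    using z lz lb lc by (auto intro!: nth_equalityI simp: ops_list_def)
  have cz: "map (\<lambda>n. h (concat bs ! n) (concat ccs ! n) (concat zss ! n)) [0..<length (concat bs)] =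
    concat zss'"
  proof (rule concat_eqI)
    show "length (map (\<lambda>n. h (concat bs ! n) (concat ccs ! n) (concat zss ! n)) [0..<length (concat bs)])
      = sum_list (map length bs)" by (simp add: length_concat)
    show "map length bs = map length zss'"
      using lb by (auto intro!: nth_equalityI simp: zss'_def)
    fix i j assume "i < length zss'" and j: "j < length (zss' ! i)"
    then have i: "i < length a" by (simp add: zss'_def)
    have j': "j < length (bs ! i)" using j i by (simp add: zss'_def)
    have j'': "j < length (ccs ! i)" "j < length (zss ! i)" using j' z i by (auto simp: ops_list_def)
    have n: "sum_list (take i (map length bs)) + j < length (concat bs)"
      using offset_less[of i "map length bs" j] i j' lb by (simp add: length_concat)
    show "map (\<lambda>n. h (concat bs ! n) (concat ccs ! n) (concat zss ! n)) [0..<length (concat bs)] !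
      (sum_list (take i (map length bs)) + j) = zss' ! i ! j"
      using n j' j'' i lb lz lc concat_nth2[of i bs j "map length bs"]
        concat_nth2[of i ccs j "map length bs"] concat_nth2[of i zss j "map length bs"] lcs lzs
      by (simp add: zss'_def)
  qed
  have 1: "h t c x = gam Q t (concat bs) (concat ccs) (gam Q t a bs (h t a x') ys') (concat zss')"
    using op_hom_gam[OF h pre_operad_gam[OF P assoc(4,5)] ol] op_hom_gam[OF h assoc(4,5)] cz assoc(1,2)
    by (simp add: ys'_def)
  have "map (\<lambda>i. h (a ! i) (map concat ccs ! i)
      (map (\<lambda>i. gam P (a ! i) (bs ! i) (ccs ! i) (ys ! i) (zss ! i)) [0..<length a] ! i)) [0..<length a] =
    map (\<lambda>i. gam Q (a ! i) (bs ! i) (ccs ! i) (ys' ! i) (zss' ! i)) [0..<length a]"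
  proof (rule map_cong[OF HOL.refl])
    fix i assume "i \<in> set [0..<length a]"
    then have i: "i < length a" by simp
    have y: "ys ! i \<in> ops P (a ! i) (bs ! i)" using assoc(5) i by (simp add: ops_list_def)
    show "h (a ! i) (map concat ccs ! i)
      (map (\<lambda>i. gam P (a ! i) (bs ! i) (ccs ! i) (ys ! i) (zss ! i)) [0..<length a] ! i) =
      gam Q (a ! i) (bs ! i) (ccs ! i) (ys' ! i) (zss' ! i)"
      using op_hom_gam[OF h y z[rule_format, OF i]] i lc by (simp add: ys'_def zss'_def)
  qed
  from op_hom_gam[OF h assoc(4) ol2, unfolded this]
  have 2: "h t c y = gam Q t a (map concat ccs) (h t a x')
    (map (\<lambda>i. gam Q (a ! i) (bs ! i) (ccs ! i) (ys' ! i) (zss' ! i)) [0..<length a])"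
    using assoc(1,3) by (simp add: concat_concat)
  show ?thesis unfolding 1 2 unfolding assoc(1)
    by (rule op_law.assoc[OF op_hom_mem[OF h assoc(4)] y' lc _ z']) (simp add: zss'_def)
next
  case (equivariance_outer x' a bs ys \<sigma>)
  note s = equivariance_outer(6)
  have lb: "length bs = length a" "length ys = length a"
    using equivariance_outer(5) by (simp_all add: ops_list_def)
  have sb: "\<sigma> permutes {..<length bs}" using lb s by simp
  have bp: "block_perm \<sigma> (map length (permute_list \<sigma> bs)) permutes {..<length (concat bs)}"
    using block_perm_permutes[of \<sigma> "map length (permute_list \<sigma> bs)"] sb
      sum_list_permute_list[of \<sigma> "map length bs"] permute_list_map[OF sb, of length]
    by (simp add: length_concat)
  let ?ys = "map (\<lambda>i. h (a ! i) (bs ! i) (ys ! i)) [0..<length a]"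
  have "permute_list \<sigma> ?ys = map (\<lambda>i. h (permute_list \<sigma> a ! i) (permute_list \<sigma> bs ! i)
    (permute_list \<sigma> ys ! i)) [0..<length a]"
    using lb permutes_in_image[OF s] by (auto intro!: nth_equalityI simp: permute_list_def)
  then show ?thesis
    using op_law.equivariance_outer[OF op_hom_mem[OF h equivariance_outer(4)]
        ops_list_hom[OF h equivariance_outer(5)] s]
      op_hom_act[OF h equivariance_outer(4) s] op_hom_gam[OF h equivariance_outer(4,5)]
      op_hom_act[OF h pre_operad_gam[OF P equivariance_outer(4,5)] bp]
      op_hom_gam[OF h pre_operad_act[OF P equivariance_outer(4) s] ops_list_permute[OF equivariance_outer(5) s]]
      permute_list_block_perm[OF sb HOL.refl] equivariance_outer(1-3) by simp
next
  case (equivariance_inner x' a bs ys \<tau>s)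
  note lt = equivariance_inner(6) and tp = equivariance_inner(7)
  have lb: "length bs = length a" "length ys = length a"
    using equivariance_inner(5) by (simp_all add: ops_list_def)
  have sp: "sum_perm (map length bs) \<tau>s permutes {..<length (concat bs)}"
    using sum_perm_permutes[of \<tau>s "map length bs"] lb lt tp by (simp add: length_concat)
  let ?ys = "map (\<lambda>i. act P (a ! i) (bs ! i) (\<tau>s ! i) (ys ! i)) [0..<length a]"
  let ?hys = "map (\<lambda>i. h (a ! i) (bs ! i) (ys ! i)) [0..<length a]"
  have ol: "ops_list P a (map2 permute_list \<tau>s bs) ?ys"
    using lt tp lb equivariance_inner(5)
    by (intro ops_list_map) (auto intro!: pre_operad_act[OF P] simp: ops_list_def)
  have "map (\<lambda>i. h (a ! i) (map2 permute_list \<tau>s bs ! i) (?ys ! i)) [0..<length a] =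
    map (\<lambda>i. act Q (a ! i) (bs ! i) (\<tau>s ! i) (?hys ! i)) [0..<length a]"
  proof (rule map_cong[OF HOL.refl])
    fix i assume "i \<in> set [0..<length a]"
    then have i: "i < length a" by simp
    have y: "ys ! i \<in> ops P (a ! i) (bs ! i)" using equivariance_inner(5) i by (simp add: ops_list_def)
    show "h (a ! i) (map2 permute_list \<tau>s bs ! i) (?ys ! i) = act Q (a ! i) (bs ! i) (\<tau>s ! i) (?hys ! i)"
      using op_hom_act[OF h y tp[rule_format, OF i]] i lt lb by simp
  qed
  from op_hom_gam[OF h equivariance_inner(4) ol, unfolded this] show ?thesis
    using op_law.equivariance_inner[OF op_hom_mem[OF h equivariance_inner(4)]
        ops_list_hom[OF h equivariance_inner(5)] lt tp]
      op_hom_gam[OF h equivariance_inner(4,5)]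
      op_hom_act[OF h pre_operad_gam[OF P equivariance_inner(4,5)] sp]
      permute_list_sum_perm[of \<tau>s bs] lt lb tp equivariance_inner(1-3) by simp
qed

lemma op_cong_hom:
  assumes P: "pre_operad K P" and Q: "operad K Q" and h: "op_hom K P Q h"
    and E: "\<And>t c x y. E t c x y \<Longrightarrow> x \<in> ops P t c \<Longrightarrow> y \<in> ops P t c \<Longrightarrow> h t c x = h t c y"
    and "op_cong P E t c x y"
  shows "h t c x = h t c y"
  using assms(5)
proof induction
  case (law t c x y)
  from op_law_hom[OF P h this] show ?case using Q unfolding operad_def by blast
next
  case (act t c x y \<sigma>)
  then show ?case using op_hom_act[OF h _ act(2)] op_cong_ops[OF P act(1)] by simp
next
  case (gam t a x x' bs ys ys')
  have 1: "ops_list P a bs ys" "ops_list P a bs ys'"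
    using gam op_cong_ops[OF P, of E] by (auto simp: ops_list_def)
  have e: "map (\<lambda>i. h (a ! i) (bs ! i) (ys ! i)) [0..<length a] =
    map (\<lambda>i. h (a ! i) (bs ! i) (ys' ! i)) [0..<length a]" using gam by simp
  have x: "x \<in> ops P t a" "x' \<in> ops P t a" using op_cong_ops[OF P gam(1)] by simp_all
  show ?case unfolding op_hom_gam[OF h x(1) 1(1)] op_hom_gam[OF h x(2) 1(2)] e gam.IH(1) ..
qed (auto intro: E)

lemma op_hom_eqI:
  assumes "op_hom K P Q h" "op_hom K P Q k"
    and "\<And>t c x. x \<in> ops P t c \<Longrightarrow> h t c x = k t c x"
  shows "h = k"
  using assms op_hom_ext[OF assms(1)] op_hom_ext[OF assms(2)] by (intro ext) metis

lemma op_proj_hom: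
  assumes P: "pre_operad K P"
  shows "op_hom K P (op_quotient P E) (op_proj P E)"
  unfolding op_hom_def
proof (intro conjI allI impI ballI)
  fix t c show "op_proj P E t c \<in> ops P t c \<rightarrow>\<^sub>E ops (op_quotient P E) t c"
    by (auto simp: op_proj_def quot_ops)
next
  fix t c \<sigma> x assume x: "x \<in> ops P t c" and s: "\<sigma> permutes {..<length c}"
  show "op_proj P E t (permute_list \<sigma> c) (act P t c \<sigma> x) =
    act (op_quotient P E) t c \<sigma> (op_proj P E t c x)"
    using pre_operad_act[OF P x s] quot_act[OF x s, of E] x by (simp add: op_proj_def)
next
  fix t a bs x ys assume x: "x \<in> ops P t a" and ys: "ops_list P a bs ys"
  have "map (\<lambda>i. op_proj P E (a ! i) (bs ! i) (ys ! i)) [0..<length a] = classes P E a bs ys"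
    using ys by (simp add: classes_def op_proj_def ops_list_def)
  then show "op_proj P E t (concat bs) (gam P t a bs x ys) = gam (op_quotient P E) t a bs
    (op_proj P E t a x) (map (\<lambda>i. op_proj P E (a ! i) (bs ! i) (ys ! i)) [0..<length a])"
    using pre_operad_gam[OF P x ys] quot_gam[OF x ys, of E] x by (simp add: op_proj_def)
next
  fix t assume "t \<in> K"
  then show "op_proj P E t [t] (one P t) = one (op_quotient P E) t"
    using pre_operad_one[OF P] by (simp add: op_proj_def quot_one)
qed

lemma op_proj_identifies:
  assumes "E t c x y" "x \<in> ops P t c" "y \<in> ops P t c"
  shows "op_proj P E t c x = op_proj P E t c y"
  using op_class_eqI[OF op_cong.base[of E t c x y P]] assms by (simp add: op_proj_def)

lemma op_compose_hom:
  assumes k: "op_hom K P Q k" and h: "op_hom K Q R h" and P: "pre_operad K P"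
  shows "op_hom K P R (op_compose P h k)"
  unfolding op_hom_def
proof (intro conjI allI impI ballI)
  fix t c show "op_compose P h k t c \<in> ops P t c \<rightarrow>\<^sub>E ops R t c"
    using op_hom_mem[OF k] op_hom_mem[OF h] by (auto simp: op_compose_def compose_def)
next
  fix t c \<sigma> x assume x: "x \<in> ops P t c" and s: "\<sigma> permutes {..<length c}"
  then show "op_compose P h k t (permute_list \<sigma> c) (act P t c \<sigma> x) = act R t c \<sigma> (op_compose P h k t c x)"
    using op_hom_act[OF k x s] op_hom_act[OF h op_hom_mem[OF k x] s] pre_operad_act[OF P x s]
    by (simp add: op_compose_def compose_def)
next
  fix t a bs x ys assume x: "x \<in> ops P t a" and ys: "ops_list P a bs ys"
  let ?ys = "map (\<lambda>i. k (a ! i) (bs ! i) (ys ! i)) [0..<length a]"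
  have "map (\<lambda>i. op_compose P h k (a ! i) (bs ! i) (ys ! i)) [0..<length a] =
    map (\<lambda>i. h (a ! i) (bs ! i) (?ys ! i)) [0..<length a]"
    using ys by (simp add: op_compose_def compose_def ops_list_def)
  then show "op_compose P h k t (concat bs) (gam P t a bs x ys) = gam R t a bs
    (op_compose P h k t a x) (map (\<lambda>i. op_compose P h k (a ! i) (bs ! i) (ys ! i)) [0..<length a])"
    using op_hom_gam[OF k x ys] op_hom_gam[OF h op_hom_mem[OF k x] ops_list_hom[OF k ys]]
      pre_operad_gam[OF P x ys] x
    by (simp only:) (simp add: op_compose_def compose_def)
next
  fix t assume "t \<in> K"
  then show "op_compose P h k t [t] (one P t) = one R t"
    using pre_operad_one[OF P] op_hom_one[OF k] op_hom_one[OF h] by (simp add: op_compose_def compose_def)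
qed

theorem quotient_universal:
  fixes P :: "('o, 'x) operad_data" and Q :: "('o, 'q) operad_data"
  assumes P: "pre_operad K P" and Q: "operad K Q" and m: "op_hom K P Q m"
    and E: "\<And>t c x y. E t c x y \<Longrightarrow> x \<in> ops P t c \<Longrightarrow> y \<in> ops P t c \<Longrightarrow> m t c x = m t c y"
  shows "\<exists>!h. op_hom K (op_quotient P E) Q h \<and> op_compose P h (op_proj P E) = m"
proof (rule ex_ex1I)
  let ?P = "op_quotient P E"
  define h where "h = (\<lambda>t c. restrict (\<lambda>A. m t c (rep A)) (ops ?P t c))"
  have hk: "h t c (op_class P E t c x) = m t c x" if "x \<in> ops P t c" for t c x
  proof -
    have "op_cong P E t c x (rep (op_class P E t c x))" by (rule op_class_rep[OF that])
    from op_cong_hom[OF P Q m _ this] E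
    have "m t c x = m t c (rep (op_class P E t c x))" by blast
    then show ?thesis using that by (simp add: h_def quot_ops)
  qed
  have "op_hom K ?P Q h" unfolding op_hom_def
  proof (intro conjI allI impI ballI)
    fix t c show "h t c \<in> ops ?P t c \<rightarrow>\<^sub>E ops Q t c"
    proof (rule PiE_I)
      fix A assume "A \<in> ops ?P t c"
      then obtain x where "x \<in> ops P t c" "A = op_class P E t c x" by (auto simp: quot_ops)
      then show "h t c A \<in> ops Q t c" using hk op_hom_mem[OF m] by simp
    qed (simp add: h_def)
  next
    fix t c \<sigma> A assume "A \<in> ops ?P t c" and s: "\<sigma> permutes {..<length c}"
    then obtain x where x: "x \<in> ops P t c" "A = op_class P E t c x" by (auto simp: quot_ops)
    then show "h t (permute_list \<sigma> c) (act ?P t c \<sigma> A) = act Q t c \<sigma> (h t c A)"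
      using quot_act[OF x(1) s] hk pre_operad_act[OF P x(1) s] op_hom_act[OF m x(1) s] by simp
  next
    fix t a bs A Bs assume "A \<in> ops ?P t a" "ops_list ?P a bs Bs"
    then obtain x ys where x: "x \<in> ops P t a" "A = op_class P E t a x" and ys: "ops_list P a bs ys"
      "Bs = classes P E a bs ys" by (metis imageE quot_ops quot_ops_list)
    have e: "map (\<lambda>i. h (a ! i) (bs ! i) (Bs ! i)) [0..<length a] =
      map (\<lambda>i. m (a ! i) (bs ! i) (ys ! i)) [0..<length a]"
      using ys hk by (simp add: classes_def ops_list_def)
    show "h t (concat bs) (gam ?P t a bs A Bs) = gam Q t a bs (h t a A)
      (map (\<lambda>i. h (a ! i) (bs ! i) (Bs ! i)) [0..<length a])"
      unfolding e using x ys quot_gam[OF x(1) ys(1), of E] hk pre_operad_gam[OF P x(1) ys(1)]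
        op_hom_gam[OF m x(1) ys(1)] by simp
  next
    fix t assume "t \<in> K"
    then show "h t [t] (one ?P t) = one Q t"
      using pre_operad_one[OF P] hk op_hom_one[OF m] by (simp add: quot_one)
  qed
  moreover have "op_compose P h (op_proj P E) = m"
  proof (intro ext)
    fix t c x show "op_compose P h (op_proj P E) t c x = m t c x"
      using hk op_hom_ext[OF m] by (simp add: op_compose_def compose_def op_proj_def)
  qed
  ultimately show "\<exists>h. op_hom K ?P Q h \<and> op_compose P h (op_proj P E) = m" by blast
next
  fix h k
  assume h: "op_hom K (op_quotient P E) Q h \<and> op_compose P h (op_proj P E) = m"
    and k: "op_hom K (op_quotient P E) Q k \<and> op_compose P k (op_proj P E) = m"
  have *: "l t c (op_class P E t c x) = m t c x"
    if "op_compose P l (op_proj P E) = m" "x \<in> ops P t c" for l t c x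
    using that by (auto simp: op_compose_def compose_def op_proj_def)
  show "h = k"
  proof (rule op_hom_eqI[OF conjunct1[OF h] conjunct1[OF k]])
    fix t c A assume "A \<in> ops (op_quotient P E) t c"
    then obtain x where "x \<in> ops P t c" "A = op_class P E t c x" by (auto simp: quot_ops)
    then show "h t c A = k t c A" using *[of h x t c] *[of k x t c] h k by simp
  qed
qed

lemma term_pre_operad:
  assumes "colored_seq K X"
  shows "pre_operad K (term_operad K X)"
proof -
  have "t \<in> K \<and> set c \<subseteq> K" if "wf_term K X t c T" for t c T
    using that
  proof induction
    case (Gen x t c)
    then show ?case using assms by (auto simp: colored_seq_def)
  next
    case (Gam t a T bs Us)
    then show ?case by (auto simp: in_set_conv_nth) (metis nth_mem subsetD in_set_conv_nth)
  qed auto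
  then show ?thesis
    by (auto simp: pre_operad_def term_operad_def colored_seq_def ops_list_def intro: wf_term.intros)
qed

primrec op_eval ::
  "('o, 'y) operad_data \<Rightarrow> ('o \<Rightarrow> 'o list \<Rightarrow> 'x \<Rightarrow> 'y) \<Rightarrow> ('o, 'x) op_term \<Rightarrow> 'y" where
  "op_eval Q \<phi> (Gen t c x) = \<phi> t c x"
| "op_eval Q \<phi> (One t) = one Q t"
| "op_eval Q \<phi> (Act t c \<sigma> T) = act Q t c \<sigma> (op_eval Q \<phi> T)"
| "op_eval Q \<phi> (Gam t a bs T Us) = gam Q t a bs (op_eval Q \<phi> T) (map (op_eval Q \<phi>) Us)"

lemma term_universal:
  assumes X: "colored_seq K X" and Q: "operad K Q"
    and \<phi>: "\<And>t c x. x \<in> X t c \<Longrightarrow> \<phi> t c x \<in> ops Q t c"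
  shows "\<exists>!m. op_hom K (term_operad K X) Q m \<and> (\<forall>t c. \<forall>x\<in>X t c. m t c (Gen t c x) = \<phi> t c x)"
proof (rule ex_ex1I)
  let ?T = "term_operad K X"
  have Q': "pre_operad K Q" using Q by (simp add: operad_def)
  define m where "m = (\<lambda>t c. restrict (op_eval Q \<phi>) (ops ?T t c))"
  have ev: "op_eval Q \<phi> T \<in> ops Q t c" if "wf_term K X t c T" for t c T
    using that
  proof induction
    case (Gam t a T bs Us)
    then show ?case by (auto intro!: pre_operad_gam[OF Q'] simp: ops_list_def)
  qed (auto intro: \<phi> pre_operad_one[OF Q'] pre_operad_act[OF Q'])
  have "op_hom K ?T Q m" unfolding op_hom_def
  proof (intro conjI allI impI ballI)
    fix t a bs T Us assume T: "T \<in> ops ?T t a" and Us: "ops_list ?T a bs Us"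
    have e: "map (\<lambda>i. m (a ! i) (bs ! i) (Us ! i)) [0..<length a] = map (op_eval Q \<phi>) Us"
      using Us by (auto intro!: nth_equalityI simp: m_def ops_list_def)
    show "m t (concat bs) (gam ?T t a bs T Us) = gam Q t a bs (m t a T)
      (map (\<lambda>i. m (a ! i) (bs ! i) (Us ! i)) [0..<length a])"
      unfolding e using T pre_operad_gam[OF term_pre_operad[OF X] T Us] by (simp add: m_def) (simp add: term_operad_def)
  next
    fix t c \<sigma> T assume T: "T \<in> ops ?T t c" and s: "\<sigma> permutes {..<length c}"
    then show "m t (permute_list \<sigma> c) (act ?T t c \<sigma> T) = act Q t c \<sigma> (m t c T)"
      using pre_operad_act[OF term_pre_operad[OF X] T s] by (simp add: m_def) (simp add: term_operad_def)
  qed (auto simp: m_def term_operad_def intro: ev wf_term.intros)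
  then show "\<exists>m. op_hom K ?T Q m \<and> (\<forall>t c. \<forall>x\<in>X t c. m t c (Gen t c x) = \<phi> t c x)"
    by (intro exI[of _ m]) (auto simp: m_def term_operad_def intro: wf_term.intros)
next
  let ?T = "term_operad K X"
  fix h k
  assume h: "op_hom K ?T Q h \<and> (\<forall>t c. \<forall>x\<in>X t c. h t c (Gen t c x) = \<phi> t c x)"
    and k: "op_hom K ?T Q k \<and> (\<forall>t c. \<forall>x\<in>X t c. k t c (Gen t c x) = \<phi> t c x)"
  have *: "h t c T = k t c T" if "wf_term K X t c T" for t c T
    using that
  proof induction
    case (One t)
    have "op_hom K ?T Q h" "op_hom K ?T Q k" using h k by simp_all
    from this[THEN op_hom_one, OF One] show ?case by (simp add: term_operad_def)
  next
    case (Act t c T \<sigma>)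
    then have "T \<in> ops ?T t c" by (simp add: term_operad_def)
    then show ?case using op_hom_act[OF conjunct1[OF h] _ Act(2)] op_hom_act[OF conjunct1[OF k] _ Act(2)]
        Act by (simp add: term_operad_def)
  next
    case (Gam t a T bs Us)
    have "T \<in> ops ?T t a" "ops_list ?T a bs Us" using Gam by (simp_all add: term_operad_def ops_list_def)
    then have "l t (concat bs) (op_term.Gam t a bs T Us) = gam Q t a bs (l t a T)
      (map (\<lambda>i. l (a ! i) (bs ! i) (Us ! i)) [0..<length a])" if "op_hom K ?T Q l" for l
      using op_hom_gam[OF that] by (simp add: term_operad_def)
    note g = this[OF conjunct1[OF h]] this[OF conjunct1[OF k]]
    have e: "map (\<lambda>i. h (a ! i) (bs ! i) (Us ! i)) [0..<length a] =
      map (\<lambda>i. k (a ! i) (bs ! i) (Us ! i)) [0..<length a]" using Gam by simp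
    show ?case unfolding g e Gam.IH(1) ..
  qed (use h k in auto)
  show "h = k"
    by (rule op_hom_eqI[OF conjunct1[OF h] conjunct1[OF k]]) (simp add: * term_operad_def)
qed

theorem free_operad_operad:
  assumes "colored_seq K X"
  shows "operad K (free_operad K X)"
  unfolding free_operad_def by (rule quotient_operad[OF term_pre_operad[OF assms]])

lemma free_gen_mem: "x \<in> X t c \<Longrightarrow> free_gen K X t c x \<in> ops (free_operad K X) t c"
  by (auto simp: free_gen_def free_operad_def quot_ops term_operad_def intro: wf_term.Gen)

theorem free_operad_universal:
  fixes Q :: "('o, 'q) operad_data"
  assumes X: "colored_seq K X" and Q: "operad K Q"
    and \<phi>: "\<And>t c x. x \<in> X t c \<Longrightarrow> \<phi> t c x \<in> ops Q t c"
  shows "\<exists>!h. op_hom K (free_operad K X) Q h \<and>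
    (\<forall>t c. \<forall>x\<in>X t c. h t c (free_gen K X t c x) = \<phi> t c x)"
proof -
  let ?T = "term_operad K X" and ?E = "\<lambda>_ _ _ _. False"
  note T = term_pre_operad[OF X]
  obtain m where m: "op_hom K ?T Q m" "\<forall>t c. \<forall>x\<in>X t c. m t c (Gen t c x) = \<phi> t c x"
    using term_universal[of K X Q \<phi>, OF X Q \<phi>] by blast
  have mu: "m' = m" if "op_hom K ?T Q m'" "\<forall>t c. \<forall>x\<in>X t c. m' t c (Gen t c x) = \<phi> t c x" for m'
    using term_universal[of K X Q \<phi>, OF X Q \<phi>] m that by blast
  have gen: "op_compose ?T h (op_proj ?T ?E) t c (Gen t c x) = h t c (free_gen K X t c x)"
    if "x \<in> X t c" for h :: "'o \<Rightarrow> 'o list \<Rightarrow> _ \<Rightarrow> 'q" and t c x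
    using that by (simp add: op_compose_def compose_def op_proj_def term_operad_def free_gen_def wf_term.Gen)
  have eq: "op_hom K (free_operad K X) Q h \<and> (\<forall>t c. \<forall>x\<in>X t c. h t c (free_gen K X t c x) = \<phi> t c x) \<longleftrightarrow>
    op_hom K (op_quotient ?T ?E) Q h \<and> op_compose ?T h (op_proj ?T ?E) = m" for h
  proof
    assume h: "op_hom K (free_operad K X) Q h \<and> (\<forall>t c. \<forall>x\<in>X t c. h t c (free_gen K X t c x) = \<phi> t c x)"
    then have h': "op_hom K (op_quotient ?T ?E) Q h" by (simp add: free_operad_def)
    show "op_hom K (op_quotient ?T ?E) Q h \<and> op_compose ?T h (op_proj ?T ?E) = m"
      using h' h gen by (intro conjI mu op_compose_hom[OF op_proj_hom[OF T] h' T]) simp_all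
  next
    assume h: "op_hom K (op_quotient ?T ?E) Q h \<and> op_compose ?T h (op_proj ?T ?E) = m"
    have "h t c (free_gen K X t c x) = \<phi> t c x" if "x \<in> X t c" for t c x
      using gen[OF that, of h] h m(2) that by simp
    then show "op_hom K (free_operad K X) Q h \<and> (\<forall>t c. \<forall>x\<in>X t c. h t c (free_gen K X t c x) = \<phi> t c x)"
      using h by (simp add: free_operad_def)
  qed
  show ?thesis unfolding eq by (rule quotient_universal[OF T Q m(1)]) simp
qed

theorem free_ext_props:
  fixes Q :: "('o, 'q) operad_data"
  assumes X: "colored_seq K X" and Q: "operad K Q"
    and \<phi>: "\<And>t c x. x \<in> X t c \<Longrightarrow> \<phi> t c x \<in> ops Q t c"
  shows "op_hom K (free_operad K X) Q (free_ext K X Q \<phi>)"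
    and "\<And>t c x. x \<in> X t c \<Longrightarrow> free_ext K X Q \<phi> t c (free_gen K X t c x) = \<phi> t c x"
  using theI'[OF free_operad_universal[of K X Q \<phi>, OF X Q \<phi>]] unfolding free_ext_def by blast+

subsection \<open>The operads of an orthogonal category\<close>

lemma cat_ops_iff:
  "(\<sigma>, fs) \<in> ops (cat_operad C) t c \<longleftrightarrow> t \<in> Ob C \<and> set c \<subseteq> Ob C \<and>
     \<sigma> permutes {..<length c} \<and> length fs = length c \<and>
     (\<forall>i<length c. fs ! i \<in> Mor C \<and> src C (fs ! i) = c ! i \<and> tgt C (fs ! i) = t)"
  by (simp add: cat_operad_def)

lemma (in small_category) cat_pre_operad: "pre_operad (Ob C) (cat_operad C)"
  unfolding pre_operad_def
proof (intro conjI allI impI ballI)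
  show "colored_seq (Ob C) (ops (cat_operad C))"
    by (auto simp: colored_seq_def cat_operad_def)
next
  fix t c \<sigma>' x assume x: "x \<in> ops (cat_operad C) t c" and s: "\<sigma>' permutes {..<length c}"
  obtain \<sigma> fs where xe: "x = (\<sigma>, fs)" by (cases x)
  note x' = x[unfolded xe cat_ops_iff]
  have "\<sigma> \<circ> \<sigma>' permutes {..<length c}" using x' s permutes_compose by blast
  then show "act (cat_operad C) t c \<sigma>' x \<in> ops (cat_operad C) t (permute_list \<sigma>' c)"
    using x' s permutes_in_image[OF s]
    by (simp add: xe cat_operad_def) (simp add: permute_list_def)
next
  fix t a bs x ys assume x: "x \<in> ops (cat_operad C) t a" and ys: "ops_list (cat_operad C) a bs ys"
  obtain \<sigma> fs where xe: "x = (\<sigma>, fs)" by (cases x)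
  note x' = x[unfolded xe cat_ops_iff]
  have lb: "length bs = length a" "length ys = length a" using ys by (simp_all add: ops_list_def)
  have y: "fst (ys ! i) permutes {..<length (bs ! i)}" "length (snd (ys ! i)) = length (bs ! i)"
     "set (bs ! i) \<subseteq> Ob C"
     "\<And>j. j < length (bs ! i) \<Longrightarrow> snd (ys ! i) ! j \<in> Mor C \<and> src C (snd (ys ! i) ! j) = bs ! i ! j \<and>
       tgt C (snd (ys ! i) ! j) = a ! i" if "i < length a" for i
    using ys that cat_ops_iff[of "fst (ys ! i)" "snd (ys ! i)" C "a ! i" "bs ! i"]
    by (auto simp: ops_list_def)
  let ?ks = "map length bs"
  let ?gs = "map2 (\<lambda>f gs. map (cmp C f) gs) fs (map snd ys)"
  have "block_perm \<sigma> ?ks \<circ> sum_perm ?ks (map fst ys) permutes {..<length (concat bs)}"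
    using sum_perm_permutes[of "map fst ys" ?ks] block_perm_permutes[of \<sigma> ?ks] x' y lb
    by (intro permutes_compose) (simp_all add: length_concat)
  moreover have ml: "map length ?gs = ?ks" using lb x' y by (auto intro!: nth_equalityI)
  then have "length (concat ?gs) = length (concat bs)" by (simp add: length_concat)
  moreover have "concat ?gs ! n \<in> Mor C \<and> src C (concat ?gs ! n) = concat bs ! n \<and>
    tgt C (concat ?gs ! n) = t" if "n < length (concat bs)" for n
  proof -
    from that have "n < sum_list ?ks" by (simp add: length_concat)
    then obtain i j where ij: "i < length ?ks" "j < ?ks ! i" "n = sum_list (take i ?ks) + j"
      by (rule split_index)
    then have i: "i < length a" "j < length (bs ! i)" using lb by auto
    have "concat ?gs ! n = cmp C (fs ! i) (snd (ys ! i) ! j)" "concat bs ! n = bs ! i ! j"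
      using concat_nth2[of i ?gs j ?ks] concat_nth2[of i bs j ?ks] ml ij i lb x' y by simp_all
    then show ?thesis using x' y[OF i(1)] i by (simp add: cmp_Mor src_cmp tgt_cmp)
  qed
  moreover have "set (concat bs) \<subseteq> Ob C" using y(3) lb
    by (fastforce simp: in_set_conv_nth[of _ bs])
  ultimately show "gam (cat_operad C) t a bs x ys \<in> ops (cat_operad C) t (concat bs)"
    using x' by (simp add: xe cat_operad_def)
next
  fix t assume "t \<in> Ob C"
  then show "one (cat_operad C) t \<in> ops (cat_operad C) t [t]"
    using permutes_id by (auto simp: cat_operad_def idm_Mor src_idm tgt_idm)
qed

context orthogonal_category begin

theorem orth_operad_operad: "operad (Ob C) (orth_operad C perp)"
  unfolding orth_operad_def by (rule quotient_operad[OF cat_pre_operad])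

theorem orth_proj_hom: "op_hom (Ob C) (cat_operad C) (orth_operad C perp) (orth_proj C perp)"
  unfolding orth_operad_def orth_proj_def by (rule op_proj_hom[OF cat_pre_operad])

lemma perp_ops:
  assumes "(f1, f2) \<in> perp" "\<sigma> permutes {..<2}"
  shows "(\<sigma>, [f1, f2]) \<in> ops (cat_operad C) (tgt C f1) [src C f1, src C f2]"
  using perp_Mor[OF assms(1)] assms(2)
  by (auto simp: cat_ops_iff src_Ob tgt_Ob nth_Cons less_Suc_eq numeral_2_eq_2 split: nat.split)

lemma transpose_01: "transpose 0 1 permutes {..<2::nat}"
  by (rule permutes_swap_id) auto

theorem orth_proj_identifies:
  assumes "(f1, f2) \<in> perp"
  shows "orth_proj C perp (tgt C f1) [src C f1, src C f2] (id, [f1, f2]) =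
         orth_proj C perp (tgt C f1) [src C f1, src C f2] (transpose 0 1, [f1, f2])"
  unfolding orth_proj_def
  using assms by (intro op_proj_identifies perp_ops permutes_id transpose_01) (auto simp: perp_rel_def)

theorem orth_operad_universal:
  fixes Q :: "('o, 'q) operad_data"
  assumes Q: "operad (Ob C) Q" and m: "op_hom (Ob C) (cat_operad C) Q m"
    and perp: "\<And>f1 f2. (f1, f2) \<in> perp \<Longrightarrow>
      m (tgt C f1) [src C f1, src C f2] (id, [f1, f2]) =
      m (tgt C f1) [src C f1, src C f2] (transpose 0 1, [f1, f2])"
  shows "\<exists>!h. op_hom (Ob C) (orth_operad C perp) Q h \<and>
              op_compose (cat_operad C) h (orth_proj C perp) = m"
  unfolding orth_operad_def orth_proj_def
  by (rule quotient_universal[OF cat_pre_operad Q m]) (auto simp: perp_rel_def perp)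

lemma gen_seq_colored: "colored_seq (Ob C) (gen_seq C)"
  by (auto simp: colored_seq_def gen_seq_def src_Ob tgt_Ob)

lemma rel_seq_colored: "colored_seq (Ob C) (rel_seq C perp)"
  using perp_Mor by (auto simp: colored_seq_def rel_seq_def src_Ob tgt_Ob)

lemma q_gen_mem: "x \<in> gen_seq C t c \<Longrightarrow> q_gen C x \<in> ops (cat_operad C) t c"
  using permutes_id
  by (auto simp: gen_seq_def cat_ops_iff src_Ob tgt_Ob idm_Mor src_idm tgt_idm nth_Cons split: nat.split)

lemma free_G_pre: "pre_operad (Ob C) (free_G C)"
  using free_operad_operad[OF gen_seq_colored] by (simp add: operad_def)

lemma arrow_op_mem: "f \<in> Mor C \<Longrightarrow> arrow_op C f \<in> ops (free_G C) (tgt C f) [src C f]"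
  unfolding arrow_op_def by (rule free_gen_mem) (auto simp: gen_seq_def)

lemma unit_op_mem: "t \<in> Ob C \<Longrightarrow> unit_op C t \<in> ops (free_G C) t []"
  unfolding unit_op_def by (rule free_gen_mem) (auto simp: gen_seq_def)

lemma mult_op_mem: "t \<in> Ob C \<Longrightarrow> mult_op C t \<in> ops (free_G C) t [t, t]"
  unfolding mult_op_def by (rule free_gen_mem) (auto simp: gen_seq_def)

lemma gam1:
  assumes "x \<in> ops (free_G C) t [a]" "y \<in> ops (free_G C) a b"
  shows "gam (free_G C) t [a] [b] x [y] \<in> ops (free_G C) t b"
  using pre_operad_gam[OF free_G_pre assms(1), of "[b]" "[y]"] assms by (simp add: ops_list_def)

lemma gam2:
  assumes "x \<in> ops (free_G C) t [a, a']" "y \<in> ops (free_G C) a b" "y' \<in> ops (free_G C) a' b'"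
  shows "gam (free_G C) t [a, a'] [b, b'] x [y, y'] \<in> ops (free_G C) t (b @ b')"
  using pre_operad_gam[OF free_G_pre assms(1), of "[b, b']" "[y, y']"] assms
  by (simp add: ops_list_def nth_Cons less_Suc_eq split: nat.split)

lemma rel_lhs_mem:
  assumes "x \<in> rel_seq C perp t c"
  shows "rel_lhs C x \<in> ops (free_G C) t c"
proof (cases x)
  case (Perp_comm f1 f2)
  with assms have p: "(f1, f2) \<in> perp" and t: "t = tgt C f1" and c: "c = [src C f1, src C f2]"
    by (auto simp: rel_seq_def)
  note f = perp_Mor[OF p]
  have "gam (free_G C) t [t, t] [[src C f1], [src C f2]] (mult_op C t) [arrow_op C f1, arrow_op C f2]
      \<in> ops (free_G C) t ([src C f1] @ [src C f2])"
    using f arrow_op_mem[of f1] arrow_op_mem[of f2] mult_op_mem[of t] tgt_Ob[of f1] t by (intro gam2) auto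
  then show ?thesis using Perp_comm t c by simp
next
  case (Fun_cmp f g)
  then show ?thesis using assms gam1[of "arrow_op C f" t "src C f" "arrow_op C g" "[src C g]"]
      arrow_op_mem[of f] arrow_op_mem[of g]
    by (auto simp: rel_seq_def)
next
  case (Alg_left t')
  then show ?thesis
    using assms gam2[of "mult_op C t" t t t "unit_op C t" "[]" "one (free_G C) t" "[t]"]
    by (auto simp: rel_seq_def mult_op_mem unit_op_mem pre_operad_one[OF free_G_pre])
next
  case (Alg_right t')
  then show ?thesis
    using assms gam2[of "mult_op C t" t t t "one (free_G C) t" "[t]" "unit_op C t" "[]"]
    by (auto simp: rel_seq_def mult_op_mem unit_op_mem pre_operad_one[OF free_G_pre])
next
  case (Alg_assoc t')
  then show ?thesis
    using assms gam2[of "mult_op C t" t t t "mult_op C t" "[t, t]" "one (free_G C) t" "[t]"]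
    by (auto simp: rel_seq_def mult_op_mem pre_operad_one[OF free_G_pre])
next
  case (Comp_unit f)
  then show ?thesis
    using assms gam1[of "arrow_op C f" t "src C f" "unit_op C (src C f)" "[]"] arrow_op_mem[of f]
    by (auto simp: rel_seq_def unit_op_mem src_Ob)
next
  case (Comp_mult f)
  then show ?thesis
    using assms gam1[of "arrow_op C f" t "src C f" "mult_op C (src C f)" "[src C f, src C f]"]
      arrow_op_mem[of f]
    by (auto simp: rel_seq_def mult_op_mem src_Ob)
qed (use assms in \<open>auto simp: rel_seq_def pre_operad_one[OF free_G_pre]\<close>)

lemma rel_rhs_mem:
  assumes "x \<in> rel_seq C perp t c"
  shows "rel_rhs C x \<in> ops (free_G C) t c"
proof (cases x)
  case (Perp_comm f1 f2)
  with assms have p: "(f1, f2) \<in> perp" and t: "t = tgt C f1" and c: "c = [src C f1, src C f2]"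
    by (auto simp: rel_seq_def)
  note f = perp_Mor[OF p]
  have "gam (free_G C) t [t, t] [[src C f2], [src C f1]] (mult_op C t) [arrow_op C f2, arrow_op C f1]
      \<in> ops (free_G C) t ([src C f2] @ [src C f1])"
    using f arrow_op_mem[of f1] arrow_op_mem[of f2] mult_op_mem[of t] tgt_Ob[of f1] t by (intro gam2) auto
  from pre_operad_act[OF free_G_pre this, of "transpose 0 1"] show ?thesis
    using transpose_01 Perp_comm t c
    by (simp add: numeral_2_eq_2 permute_list_def)
next
  case (Fun_id t')
  then show ?thesis using assms arrow_op_mem[of "idm C t"]
    by (auto simp: rel_seq_def idm_Mor src_idm tgt_idm)
next
  case (Fun_cmp f g)
  then show ?thesis using assms arrow_op_mem[of "cmp C f g"]
    by (auto simp: rel_seq_def cmp_Mor src_cmp tgt_cmp)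
next
  case (Alg_assoc t')
  then show ?thesis
    using assms gam2[of "mult_op C t" t t t "one (free_G C) t" "[t]" "mult_op C t" "[t, t]"]
    by (auto simp: rel_seq_def mult_op_mem pre_operad_one[OF free_G_pre])
next
  case (Comp_mult f)
  then show ?thesis
    using assms gam2[of "mult_op C t" t t t "arrow_op C f" "[src C f]" "arrow_op C f" "[src C f]"]
    by (auto simp: rel_seq_def mult_op_mem arrow_op_mem tgt_Ob)
qed (use assms in \<open>auto simp: rel_seq_def unit_op_mem tgt_Ob pre_operad_one[OF free_G_pre]\<close>)

theorem r1_mor_props:
  "op_hom (Ob C) (free_R C perp) (free_G C) (r1_mor C perp)"
  "x \<in> rel_seq C perp t c \<Longrightarrow>
     r1_mor C perp t c (free_gen (Ob C) (rel_seq C perp) t c x) = rel_lhs C x"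
  using free_ext_props[OF rel_seq_colored free_operad_operad[OF gen_seq_colored],
      of "\<lambda>_ _. rel_lhs C", OF rel_lhs_mem]
  unfolding r1_mor_def by blast+

theorem r2_mor_props:
  "op_hom (Ob C) (free_R C perp) (free_G C) (r2_mor C perp)"
  "x \<in> rel_seq C perp t c \<Longrightarrow>
     r2_mor C perp t c (free_gen (Ob C) (rel_seq C perp) t c x) = rel_rhs C x"
  using free_ext_props[OF rel_seq_colored free_operad_operad[OF gen_seq_colored],
      of "\<lambda>_ _. rel_rhs C", OF rel_rhs_mem]
  unfolding r2_mor_def by blast+

end

end

theory Submission
  imports Defs
begin

text \<open>
  The composite \<open>p q\<close> identifies the two sides of every relation. Conversely, let \<open>m\<close> be
  a morphism from the free operad to \<open>Q\<close> that does so. Functoriality, algebra and compatibility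
  relations provide in \<open>Q\<close> operations \<open>F f\<close>, \<open>u t\<close> and \<open>mu t\<close>
  such that the \<open>mu t\<close> are monoid structures preserved by the \<open>F f\<close>. Every operation of
  \<open>O\<^sub>C\<close> has a unique normal form \<open>(\<sigma>, fs \<sigma>)\<close>; sending it to the
  \<open>\<sigma>\<close>-translate of the iterated product \<open>F f\<^sub>1 \<cdot> (F f\<^sub>2 \<cdot>
  (\<dots> \<cdot> u))\<close> is an operad morphism from \<open>O\<^sub>C\<close> to \<open>Q\<close> through
  which \<open>m\<close> factors. The \<open>\<perp>\<close>-commutativity relations say exactly that it identifies
  \<open>(e, (f\<^sub>1, f\<^sub>2))\<close> and \<open>(\<tau>, (f\<^sub>1, f\<^sub>2))\<close> for
  \<open>f\<^sub>1 \<perp> f\<^sub>2\<close>, so it factors through the quotient; uniqueness holds because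
  \<open>q\<close> and \<open>p\<close> are surjective.
\<close>

subsection \<open>The operad axioms for \<open>O\<^sub>C\<close>\<close>

text \<open>The value \<open>\<pi> x\<close> is the number of \<open>y < n\<close> with
  \<open>\<pi> y < \<pi> x\<close>, so it can be read off from the order alone.\<close>

lemma permutes_eq_if_same_order:
  fixes \<sigma> \<tau> :: "nat \<Rightarrow> nat"
  assumes \<sigma>: "\<sigma> permutes {..<n}" and \<tau>: "\<tau> permutes {..<n}"
    and less: "\<And>x y. x < n \<Longrightarrow> y < n \<Longrightarrow> \<sigma> x < \<sigma> y \<longleftrightarrow> \<tau> x < \<tau> y"
  shows "\<sigma> = \<tau>"
proof
  have rank: "\<pi> x = card {y. y < n \<and> \<pi> y < \<pi> x}" if \<pi>: "\<pi> permutes {..<n}" and x: "x < n"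
    for \<pi> :: "nat \<Rightarrow> nat" and x
  proof -
    have px: "\<pi> x < n" using permutes_in_image[OF \<pi>, of x] x by simp
    have "\<pi> ` {y. y < n \<and> \<pi> y < \<pi> x} = {..<\<pi> x}"
    proof (intro equalityI subsetI)
      fix m assume m: "m \<in> {..<\<pi> x}"
      obtain y where "m = \<pi> y" using permutes_surj[OF \<pi>] by (metis surj_def)
      then show "m \<in> \<pi> ` {y. y < n \<and> \<pi> y < \<pi> x}"
        using m px permutes_in_image[OF \<pi>, of y] by auto
    qed auto
    then show ?thesis
      using card_image[OF inj_on_subset[OF permutes_inj[OF \<pi>] subset_UNIV]]
      by (metis card_lessThan)
  qed
  fix x show "\<sigma> x = \<tau> x"
  proof (cases "x < n")
    case True
    then show ?thesis using rank[OF \<sigma> True] rank[OF \<tau> True] less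
      by (metis (mono_tags, lifting) Collect_cong)
  next
    case False
    then show ?thesis using permutes_not_in[OF \<sigma>, of x] permutes_not_in[OF \<tau>, of x] by simp
  qed
qed

text \<open>This is the composition of the associative operad, that is, the permutation component of
  \<open>gam (cat_operad C)\<close>.\<close>

definition comp_perm :: "(nat \<Rightarrow> nat) \<Rightarrow> nat list \<Rightarrow> (nat \<Rightarrow> nat) list \<Rightarrow> nat \<Rightarrow> nat" where
  "comp_perm \<sigma> ks \<tau>s = block_perm \<sigma> ks \<circ> sum_perm ks \<tau>s"

lemma comp_perm_permutes:
  assumes "\<sigma> permutes {..<length ks}" "length \<tau>s = length ks"
    and "\<And>i. i < length ks \<Longrightarrow> \<tau>s ! i permutes {..<ks ! i}"
  shows "comp_perm \<sigma> ks \<tau>s permutes {..<sum_list ks}"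
  unfolding comp_perm_def
  by (intro permutes_compose sum_perm_permutes block_perm_permutes assms)

text \<open>Since a permutation is determined by the order it induces, all identities between composite
  permutations reduce to comparing lexicographic orders.\<close>

lemma comp_perm_less:
  assumes \<sigma>: "\<sigma> permutes {..<length ks}" and len: "length \<tau>s = length ks"
    and \<tau>: "\<And>i. i < length ks \<Longrightarrow> \<tau>s ! i permutes {..<ks ! i}"
    and i: "i < length ks" "j < ks ! i" and i': "i' < length ks" "j' < ks ! i'"
  shows "comp_perm \<sigma> ks \<tau>s (sum_list (take i ks) + j) < comp_perm \<sigma> ks \<tau>s (sum_list (take i' ks) + j')
    \<longleftrightarrow> \<sigma> i < \<sigma> i' \<or> i = i' \<and> (\<tau>s ! i) j < (\<tau>s ! i) j'"
proof -
  \<comment> \<open>\<open>?S i\<close> is the position at which the \<open>i\<close>-th block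
    starts after the block permutation.\<close>
  let ?S = "\<lambda>i. \<Sum>l | l < length ks \<and> \<sigma> l < \<sigma> i. ks ! l"
  have tl: "(\<tau>s ! i) j < ks ! i" if "i < length ks" "j < ks ! i" for i j
    using permutes_in_image[OF \<tau>[OF that(1)], of j] that by simp
  have val: "comp_perm \<sigma> ks \<tau>s (sum_list (take i ks) + j) = ?S i + (\<tau>s ! i) j"
    if "i < length ks" "j < ks ! i" for i j
    using that sum_perm_offset[OF that len] block_perm_offset_raw[OF that(1) tl[OF that], of \<sigma>]
    by (simp add: comp_perm_def)
  \<comment> \<open>The sum \<open>?S i'\<close> contains the length of block \<open>i\<close> and
    every length counted in \<open>?S i\<close>.\<close>
  have mono: "?S i + ks ! i \<le> ?S i'" if "i < length ks" "\<sigma> i < \<sigma> i'" for i i'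
  proof -
    have "?S i + ks ! i = sum ((!) ks) (insert i {l. l < length ks \<and> \<sigma> l < \<sigma> i})" by simp
    also have "\<dots> \<le> ?S i'" using that by (intro sum_mono2) auto
    finally show ?thesis .
  qed
  consider "\<sigma> i < \<sigma> i'" | "\<sigma> i' < \<sigma> i" | "i = i'"
    using permutes_inj[OF \<sigma>] by (metis injD linorder_neqE_nat)
  then show ?thesis
  proof cases
    case 1
    then show ?thesis using mono[OF i(1) 1] tl[OF i] val[OF i] val[OF i'] by simp
  next
    case 2
    then show ?thesis using mono[OF i'(1) 2] tl[OF i'] val[OF i] val[OF i'] by auto
  next
    case 3
    then show ?thesis using val[OF i] val[OF i'] by simp
  qed
qed

text \<open>By \<open>split_index\<close> every position is a block offset plus an index inside the
  block, so both permutations induce the same lexicographic order.\<close>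

lemma comp_perm_eqI:
  assumes \<pi>: "\<pi> permutes {..<sum_list ks}" and \<sigma>: "\<sigma> permutes {..<length ks}"
    and len: "length \<tau>s = length ks" and \<tau>: "\<And>i. i < length ks \<Longrightarrow> \<tau>s ! i permutes {..<ks ! i}"
    and less: "\<And>i j i' j'. i < length ks \<Longrightarrow> j < ks ! i \<Longrightarrow> i' < length ks \<Longrightarrow> j' < ks ! i' \<Longrightarrow>
      \<pi> (sum_list (take i ks) + j) < \<pi> (sum_list (take i' ks) + j') \<longleftrightarrow>
      \<sigma> i < \<sigma> i' \<or> i = i' \<and> (\<tau>s ! i) j < (\<tau>s ! i) j'"
  shows "\<pi> = comp_perm \<sigma> ks \<tau>s"
proof (rule permutes_eq_if_same_order[OF \<pi> comp_perm_permutes[OF \<sigma> len \<tau>]])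
  fix x y assume "x < sum_list ks" "y < sum_list ks"
  then show "\<pi> x < \<pi> y \<longleftrightarrow> comp_perm \<sigma> ks \<tau>s x < comp_perm \<sigma> ks \<tau>s y"
    by (elim split_index) (simp add: less comp_perm_less[OF \<sigma> len \<tau>])
qed

lemma comp_perm_unit_left:
  assumes "\<sigma> permutes {..<n}"
  shows "comp_perm id [n] [\<sigma>] = \<sigma>"
  using assms permutes_id by (intro comp_perm_eqI[symmetric]) auto

lemma comp_perm_unit_right:
  assumes "\<sigma> permutes {..<n}"
  shows "comp_perm \<sigma> (replicate n (Suc 0)) (replicate n id) = \<sigma>"
  using assms permutes_id
  by (intro comp_perm_eqI[symmetric]) (auto simp: sum_list_replicate min_def)

text \<open>With no block moved and no entry permuted, the lexicographic order is the order of the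
  positions themselves.\<close>

lemma comp_perm_id:
  assumes "length ks = n"
  shows "comp_perm id ks (replicate n id) = id"
proof (rule comp_perm_eqI[symmetric])
  fix i j i' j' assume i: "i < length ks" "j < ks ! i" "i' < length ks" "j' < ks ! i'"
  have mono: "sum_list (take i ks) + ks ! i \<le> sum_list (take i' ks)" if "i < i'" "i' < length ks" for i i'
  proof -
    have "sum_list (take i ks) + ks ! i = sum_list (take (Suc i) ks)"
      using that by (simp add: take_Suc_conv_app_nth)
    also have "\<dots> \<le> sum_list (take (Suc i) ks) + sum_list (take (i' - Suc i) (drop (Suc i) ks))" by simp
    also have "\<dots> = sum_list (take i' ks)"
      using that by (metis Suc_leI le_add_diff_inverse sum_list_append take_add)
    finally show ?thesis .
  qed
  show "id (sum_list (take i ks) + j) < id (sum_list (take i' ks) + j') \<longleftrightarrow>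
      id i < id i' \<or> i = i' \<and> (replicate n id ! i) j < (replicate n id ! i) j'"
    using i assms mono[of i i'] mono[of i' i] by (cases i i' rule: linorder_cases) auto
qed (use permutes_id assms in auto)

lemma sum_list_concat: "sum_list (concat xss) = sum_list (map sum_list xss)"
  by (induction xss) auto

lemma take_concat_offset:
  assumes "i < length kss" "j \<le> length (kss ! i)"
  shows "take (sum_list (take i (map length kss)) + j) (concat kss) = concat (take i kss) @ take j (kss ! i)"
  using assms
proof (induction kss arbitrary: i)
  case (Cons k kss)
  then show ?case by (cases i) auto
qed simp

text \<open>A position is a triple \<open>(i, j, l)\<close>: group, block in the group, entry in the
  block. Both sides order these triples lexicographically by \<open>\<sigma> i\<close>, then
  \<open>(\<tau>s ! i) j\<close>, then \<open>(\<rho>ss ! i ! j) l\<close>.\<close>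

lemma comp_perm_assoc:
  assumes \<sigma>: "\<sigma> permutes {..<length kss}"
    and len: "length \<tau>s = length kss" "length \<rho>ss = length kss"
    and \<tau>: "\<And>i. i < length kss \<Longrightarrow> \<tau>s ! i permutes {..<length (kss ! i)}"
    and lr: "\<And>i. i < length kss \<Longrightarrow> length (\<rho>ss ! i) = length (kss ! i)"
    and \<rho>: "\<And>i j. i < length kss \<Longrightarrow> j < length (kss ! i) \<Longrightarrow> \<rho>ss ! i ! j permutes {..<kss ! i ! j}"
  shows "comp_perm (comp_perm \<sigma> (map length kss) \<tau>s) (concat kss) (concat \<rho>ss) =
    comp_perm \<sigma> (map sum_list kss) (map (\<lambda>i. comp_perm (\<tau>s ! i) (kss ! i) (\<rho>ss ! i)) [0..<length kss])"
    (is "?L = _")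
proof (rule comp_perm_eqI)
  have lr': "map length \<rho>ss = map length kss" using len lr by (auto intro!: nth_equalityI)
  let ?off = "\<lambda>i. sum_list (take i (map length kss))"
  have outer: "comp_perm \<sigma> (map length kss) \<tau>s permutes {..<length (concat kss)}"
    unfolding length_concat using \<sigma> len \<tau> by (intro comp_perm_permutes) auto
  have lc: "length (concat \<rho>ss) = length (concat kss)" using lr' by (simp add: length_concat)
  have at: "concat kss ! (?off i + j) = kss ! i ! j" "concat \<rho>ss ! (?off i + j) = \<rho>ss ! i ! j"
    "?off i + j < length (concat kss)" if "i < length kss" "j < length (kss ! i)" for i j
    using that concat_nth[of i kss j] concat_nth2[of i \<rho>ss j "map length kss"] lr' lr len
      offset_less[of i "map length kss" j] by (simp_all add: length_concat)
  have inner: "concat \<rho>ss ! n permutes {..<concat kss ! n}" if "n < length (concat kss)" for n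
  proof -
    have "n < sum_list (map length kss)" using that by (simp add: length_concat)
    then show ?thesis by (rule split_index) (use at \<rho> in auto)
  qed
  show "?L permutes {..<sum_list (map sum_list kss)}"
    using comp_perm_permutes[OF outer lc inner] by (simp add: sum_list_concat)
  show "\<sigma> permutes {..<length (map sum_list kss)}" using \<sigma> by simp
  show "map (\<lambda>i. comp_perm (\<tau>s ! i) (kss ! i) (\<rho>ss ! i)) [0..<length kss] ! i
      permutes {..<map sum_list kss ! i}" if "i < length (map sum_list kss)" for i
    using that \<tau> lr \<rho> by (auto intro!: comp_perm_permutes)
  fix i n i' n'
  assume "i < length (map sum_list kss)" "n < map sum_list kss ! i"
    and "i' < length (map sum_list kss)" "n' < map sum_list kss ! i'"
  then have i: "i < length kss" "n < sum_list (kss ! i)" and i': "i' < length kss" "n' < sum_list (kss ! i')"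
    by auto
  obtain j l where j: "j < length (kss ! i)" "l < kss ! i ! j" "n = sum_list (take j (kss ! i)) + l"
    using i(2) by (rule split_index)
  obtain j' l' where j': "j' < length (kss ! i')" "l' < kss ! i' ! j'" "n' = sum_list (take j' (kss ! i')) + l'"
    using i'(2) by (rule split_index)
  \<comment> \<open>The same position is described through the groups on the left and through the
    flattened list of blocks on the right.\<close>
  have pos: "sum_list (take i (map sum_list kss)) + (sum_list (take j (kss ! i)) + l) =
      sum_list (take (?off i + j) (concat kss)) + l"
    if "i < length kss" "j < length (kss ! i)" for i j l
    using that by (simp add: take_concat_offset sum_list_concat flip: take_map)
  \<comment> \<open>\<open>block_index\<close> recovers \<open>i\<close> from the index in the
    flattened list, and then \<open>j\<close> follows.\<close>
  have inj: "?off i + j = ?off i' + j' \<longleftrightarrow> i = i' \<and> j = j'"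
    using block_index_offset[of i "map length kss" j] block_index_offset[of i' "map length kss" j'] i i' j j'
    by auto
  show "?L (sum_list (take i (map sum_list kss)) + n) < ?L (sum_list (take i' (map sum_list kss)) + n') \<longleftrightarrow>
    \<sigma> i < \<sigma> i' \<or> i = i' \<and>
      (map (\<lambda>i. comp_perm (\<tau>s ! i) (kss ! i) (\<rho>ss ! i)) [0..<length kss] ! i) n <
      (map (\<lambda>i. comp_perm (\<tau>s ! i) (kss ! i) (\<rho>ss ! i)) [0..<length kss] ! i) n'"
  proof -
    have "?L (sum_list (take i (map sum_list kss)) + n) < ?L (sum_list (take i' (map sum_list kss)) + n') \<longleftrightarrow>
      comp_perm \<sigma> (map length kss) \<tau>s (?off i + j) < comp_perm \<sigma> (map length kss) \<tau>s (?off i' + j') \<or>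
      ?off i + j = ?off i' + j' \<and> (\<rho>ss ! i ! j) l < (\<rho>ss ! i ! j) l'"
      unfolding j(3) j'(3) pos[OF i(1) j(1)] pos[OF i'(1) j'(1)]
      using comp_perm_less[OF outer lc inner at(3)[OF i(1) j(1)] _ at(3)[OF i'(1) j'(1)], of l l']
        at i i' j j' by simp
    also have "comp_perm \<sigma> (map length kss) \<tau>s (?off i + j) < comp_perm \<sigma> (map length kss) \<tau>s (?off i' + j') \<longleftrightarrow>
      \<sigma> i < \<sigma> i' \<or> i = i' \<and> (\<tau>s ! i) j < (\<tau>s ! i) j'"
      using comp_perm_less[of \<sigma> "map length kss" \<tau>s i j i' j'] \<sigma> len \<tau> i i' j j' by simp
    finally show ?thesis
      using inj comp_perm_less[of "\<tau>s ! i" "kss ! i" "\<rho>ss ! i" j l j' l'] \<tau> lr \<rho> i i' j j' by auto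
  qed
qed (simp_all)

text \<open>Permutation part of outer equivariance. The block permutation carries entry
  \<open>j\<close> of block \<open>i\<close> to entry \<open>j\<close> of block
  \<open>\<sigma> i\<close>, so the order is decided by \<open>\<sigma>0 (\<sigma> i)\<close> and
  then by the permutation in block \<open>\<sigma> i\<close>.\<close>

lemma comp_perm_outer:
  assumes \<sigma>0: "\<sigma>0 permutes {..<length ks}" and \<sigma>: "\<sigma> permutes {..<length ks}"
    and len: "length \<tau>s = length ks" and \<tau>: "\<And>i. i < length ks \<Longrightarrow> \<tau>s ! i permutes {..<ks ! i}"
  shows "comp_perm \<sigma>0 ks \<tau>s \<circ> block_perm \<sigma> (permute_list \<sigma> ks) =
    comp_perm (\<sigma>0 \<circ> \<sigma>) (permute_list \<sigma> ks) (permute_list \<sigma> \<tau>s)"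
proof (rule comp_perm_eqI)
  have s: "\<sigma> i < length ks" "permute_list \<sigma> ks ! i = ks ! \<sigma> i" "permute_list \<sigma> \<tau>s ! i = \<tau>s ! \<sigma> i"
    if "i < length ks" for i
    using permutes_in_image[OF \<sigma>, of i] that \<sigma> len by (simp_all add: permute_list_nth)
  show "comp_perm \<sigma>0 ks \<tau>s \<circ> block_perm \<sigma> (permute_list \<sigma> ks) permutes {..<sum_list (permute_list \<sigma> ks)}"
    using block_perm_permutes'[OF \<sigma> HOL.refl] comp_perm_permutes[OF \<sigma>0 len \<tau>] sum_list_permute_list[OF \<sigma>]
    by (simp add: permutes_compose)
  show "\<sigma>0 \<circ> \<sigma> permutes {..<length (permute_list \<sigma> ks)}"
    using \<sigma> \<sigma>0 by (simp add: permutes_compose)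
  show "permute_list \<sigma> \<tau>s ! i permutes {..<permute_list \<sigma> ks ! i}" if "i < length (permute_list \<sigma> ks)" for i
    using that s \<tau> by simp
  fix i j i' j'
  assume "i < length (permute_list \<sigma> ks)" "j < permute_list \<sigma> ks ! i"
    "i' < length (permute_list \<sigma> ks)" "j' < permute_list \<sigma> ks ! i'"
  moreover have "\<sigma> i = \<sigma> i' \<longleftrightarrow> i = i'" using permutes_inj[OF \<sigma>] by (metis injD)
  ultimately show "(comp_perm \<sigma>0 ks \<tau>s \<circ> block_perm \<sigma> (permute_list \<sigma> ks)) (sum_list (take i (permute_list \<sigma> ks)) + j) <
    (comp_perm \<sigma>0 ks \<tau>s \<circ> block_perm \<sigma> (permute_list \<sigma> ks)) (sum_list (take i' (permute_list \<sigma> ks)) + j') \<longleftrightarrow>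
    (\<sigma>0 \<circ> \<sigma>) i < (\<sigma>0 \<circ> \<sigma>) i' \<or> i = i' \<and> (permute_list \<sigma> \<tau>s ! i) j < (permute_list \<sigma> \<tau>s ! i) j'"
    using s comp_perm_less[OF \<sigma>0 len \<tau>] by (simp add: block_perm_offset[OF \<sigma> HOL.refl])
qed (use len in simp)

text \<open>Permutation part of inner equivariance. The sum permutation stays inside each block and
  only replaces \<open>j\<close> by \<open>(\<rho>s ! i) j\<close>.\<close>

lemma comp_perm_inner:
  assumes \<sigma>: "\<sigma> permutes {..<length ks}"
    and len: "length \<tau>s = length ks" "length \<rho>s = length ks"
    and \<tau>: "\<And>i. i < length ks \<Longrightarrow> \<tau>s ! i permutes {..<ks ! i}"
    and \<rho>: "\<And>i. i < length ks \<Longrightarrow> \<rho>s ! i permutes {..<ks ! i}"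
  shows "comp_perm \<sigma> ks \<tau>s \<circ> sum_perm ks \<rho>s = comp_perm \<sigma> ks (map2 (\<circ>) \<tau>s \<rho>s)"
proof (rule comp_perm_eqI)
  show "comp_perm \<sigma> ks \<tau>s \<circ> sum_perm ks \<rho>s permutes {..<sum_list ks}"
    by (intro permutes_compose comp_perm_permutes sum_perm_permutes assms)
  show "map2 (\<circ>) \<tau>s \<rho>s ! i permutes {..<ks ! i}" if "i < length ks" for i
    using that len \<tau> \<rho> by (simp add: permutes_compose)
  have r: "(\<rho>s ! i) j < ks ! i" if "i < length ks" "j < ks ! i" for i j
    using permutes_in_image[OF \<rho>[OF that(1)], of j] that by simp
  fix i j i' j'
  assume "i < length ks" "j < ks ! i" "i' < length ks" "j' < ks ! i'"
  then show "(comp_perm \<sigma> ks \<tau>s \<circ> sum_perm ks \<rho>s) (sum_list (take i ks) + j) <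
    (comp_perm \<sigma> ks \<tau>s \<circ> sum_perm ks \<rho>s) (sum_list (take i' ks) + j') \<longleftrightarrow>
    \<sigma> i < \<sigma> i' \<or> i = i' \<and> (map2 (\<circ>) \<tau>s \<rho>s ! i) j < (map2 (\<circ>) \<tau>s \<rho>s ! i) j'"
    using r comp_perm_less[OF \<sigma> len(1) \<tau>] len by (auto simp: sum_perm_offset)
qed (use assms in simp_all)

section \<open>Grafting lists of arrows, and the laws of \<open>cat_operad C\<close>\<close>

lemma cat_opsD:
  assumes "x \<in> ops (cat_operad C) t c"
  shows "t \<in> Ob C" "set c \<subseteq> Ob C" "fst x permutes {..<length c}" "length (snd x) = length c"
    "map (src C) (snd x) = c" "\<And>f. f \<in> set (snd x) \<Longrightarrow> f \<in> Mor C" "\<And>f. f \<in> set (snd x) \<Longrightarrow> tgt C f = t"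
  using assms cat_ops_iff[of "fst x" "snd x" C t c]
  by (auto simp: in_set_conv_nth intro!: nth_equalityI)

lemma cat_gam:
  "gam (cat_operad C) t a bs x ys = (comp_perm (fst x) (map length bs) (map fst ys),
     concat (map2 (\<lambda>f gs. map (cmp C f) gs) (snd x) (map snd ys)))"
  by (cases x) (simp add: cat_operad_def comp_perm_def)

lemma cat_act: "act (cat_operad C) t c \<sigma> x = (fst x \<circ> \<sigma>, permute_list \<sigma> (snd x))"
  by (cases x) (simp add: cat_operad_def)

lemma cat_one: "one (cat_operad C) t = (id, [idm C t])"
  by (simp add: cat_operad_def)

context small_category begin

text \<open>The arrow component of \<open>gam (cat_operad C)\<close>.\<close>

abbreviation graft :: "'m list \<Rightarrow> 'm list list \<Rightarrow> 'm list" where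
  "graft fs gss \<equiv> concat (map2 (\<lambda>f gs. map (cmp C f) gs) fs gss)"

lemma graft_idm: "(\<And>f. f \<in> set fs \<Longrightarrow> f \<in> Mor C) \<Longrightarrow> graft fs (map (\<lambda>f. [idm C (src C f)]) fs) = fs"
  by (induction fs) (auto simp: idm_right)

text \<open>Associativity is assumed for exactly the composites that occur, here and in
  \<open>graft_assoc\<close>, so sources and targets are checked only where the result is
  applied.\<close>

lemma map_cmp_graft:
  assumes "length hss = length gs"
    and "\<And>j h. j < length gs \<Longrightarrow> h \<in> set (hss ! j) \<Longrightarrow> cmp C (cmp C f (gs ! j)) h = cmp C f (cmp C (gs ! j) h)"
  shows "map (cmp C f) (graft gs hss) = graft (map (cmp C f) gs) hss"
  using assms
proof (induction hss gs rule: list_induct2)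
  case (Cons hs hss g gs)
  have "map (cmp C f) (graft gs hss) = graft (map (cmp C f) gs) hss"
    using Cons.prems[of "Suc j" for j] by (intro Cons.IH) auto
  then show ?case using Cons.prems[of 0] by auto
qed simp

lemma graft_assoc:
  assumes "length gss = length fs" "length hsss = length fs"
    and "\<And>i. i < length fs \<Longrightarrow> length (hsss ! i) = length (gss ! i)"
    and "\<And>i j h. i < length fs \<Longrightarrow> j < length (gss ! i) \<Longrightarrow> h \<in> set (hsss ! i ! j) \<Longrightarrow>
      cmp C (cmp C (fs ! i) (gss ! i ! j)) h = cmp C (fs ! i) (cmp C (gss ! i ! j) h)"
  shows "graft (graft fs gss) (concat hsss) = graft fs (map2 graft gss hsss)"
  using assms
proof (induction fs arbitrary: gss hsss)
  case (Cons f fs)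
  obtain gs gss' where g: "gss = gs # gss'" using Cons.prems(1) by (cases gss) auto
  obtain hss hsss' where h: "hsss = hss # hsss'" using Cons.prems(2) by (cases hsss) auto
  have "graft (graft fs gss') (concat hsss') = graft fs (map2 graft gss' hsss')"
    using Cons.prems(1,2) Cons.prems(3)[of "Suc i" for i] Cons.prems(4)[of "Suc i" for i]
    unfolding g h by (intro Cons.IH) auto
  moreover have "map (cmp C f) (graft gs hss) = graft (map (cmp C f) gs) hss"
    using Cons.prems(3)[of 0] Cons.prems(4)[of 0] unfolding g h by (intro map_cmp_graft) auto
  moreover have "length hss = length gs" using Cons.prems(3)[of 0] g h by simp
  ultimately show ?case unfolding g h by simp
qed simp

text \<open>Before flattening, both sides permute the same list of blocks; composing with an arrow
  does not change the length of a block, so \<open>permute_list_block_perm\<close> applies.\<close>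

lemma graft_permute_outer:
  assumes "\<sigma> permutes {..<length fs}" "length gss = length fs"
  shows "graft (permute_list \<sigma> fs) (permute_list \<sigma> gss) =
    permute_list (block_perm \<sigma> (map length (permute_list \<sigma> gss))) (graft fs gss)"
proof -
  let ?cs = "map2 (\<lambda>f gs. map (cmp C f) gs) fs gss"
  have z: "\<sigma> permutes {..<length (zip fs gss)}" using assms by simp
  have "permute_list \<sigma> ?cs = map2 (\<lambda>f gs. map (cmp C f) gs) (permute_list \<sigma> fs) (permute_list \<sigma> gss)"
    using assms by (simp add: permute_list_map[OF z] permute_list_zip[OF assms(1)])
  moreover have "map length (permute_list \<sigma> ?cs) = map length (permute_list \<sigma> gss)"
    unfolding calculation using assms by (auto intro!: nth_equalityI)
  ultimately show ?thesis
    using permute_list_block_perm[of \<sigma> ?cs] assms by simp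
qed

lemma graft_permute_inner:
  assumes "length gss = length fs" "length \<tau>s = length fs"
    and "\<And>i. i < length fs \<Longrightarrow> \<tau>s ! i permutes {..<length (gss ! i)}"
  shows "graft fs (map2 permute_list \<tau>s gss) = permute_list (sum_perm (map length gss) \<tau>s) (graft fs gss)"
proof -
  let ?cs = "map2 (\<lambda>f gs. map (cmp C f) gs) fs gss"
  have "map2 (\<lambda>f gs. map (cmp C f) gs) fs (map2 permute_list \<tau>s gss) = map2 permute_list \<tau>s ?cs"
    using assms by (auto intro!: nth_equalityI simp: permute_list_map)
  moreover have "map length ?cs = map length gss"
    using assms by (auto intro!: nth_equalityI)
  ultimately show ?thesis
    using permute_list_sum_perm[of \<tau>s ?cs] assms by simp
qed

lemma cat_ops_list:
  assumes "ops_list (cat_operad C) a bs ys"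
  shows "length bs = length a" "length ys = length a"
    and "\<And>i. i < length a \<Longrightarrow> ys ! i \<in> ops (cat_operad C) (a ! i) (bs ! i)"
    and "map length (map snd ys) = map length bs"
proof -
  show 1: "length bs = length a" "length ys = length a"
    "\<And>i. i < length a \<Longrightarrow> ys ! i \<in> ops (cat_operad C) (a ! i) (bs ! i)"
    using assms by (auto simp: ops_list_def)
  show "map length (map snd ys) = map length bs"
    using 1(1,2) cat_opsD(4)[OF 1(3)] by (intro nth_equalityI) simp_all
qed

text \<open>This makes \<open>cat_operad C\<close> a legitimate target for the universal property of
  the free operad, hence \<open>q_mor C\<close> a morphism. Each law splits into a permutation
  component, settled by \<open>comp_perm\<close>, and an arrow component, settled by
  \<open>graft\<close>.\<close>

theorem cat_operad_operad: "operad (Ob C) (cat_operad C)"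
  unfolding operad_def
proof (intro conjI allI impI cat_pre_operad)
  fix t c x y assume "op_law (cat_operad C) t c x y"
  then show "x = y"
  proof cases
    case act_id
    then show ?thesis by (simp add: cat_act)
  next
    case (act_comp x c \<sigma> \<tau>)
    have "\<tau> permutes {..<length (snd x)}" using act_comp cat_opsD(4)[OF act_comp(4)] by simp
    then show ?thesis using act_comp by (simp add: cat_act permute_list_compose comp_assoc)
  next
    case unit_left
    note y = cat_opsD[OF unit_left(2)]
    have "map (cmp C (idm C t)) (snd y) = snd y" using y(6) y(7) idm_left by (metis map_idI)
    then show ?thesis using unit_left comp_perm_unit_left[OF y(3)]
      by (simp add: cat_gam cat_one)
  next
    case unit_right
    note y = cat_opsD[OF unit_right(2)]
    have "graft (snd y) (map (\<lambda>f. [idm C (src C f)]) (snd y)) = snd y" by (rule graft_idm[OF y(6)])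
    then have g: "graft (snd y) (map (\<lambda>s. [idm C s]) c) = snd y"
      using y(5) by (metis (no_types, lifting) map_map comp_def map_cong)
    show ?thesis using unit_right comp_perm_unit_right[OF y(3)] g
      by (simp add: cat_gam cat_one comp_def map_replicate_const)
  next
    case (assoc x a bs ys ccs zss)
    note xD = cat_opsD[OF assoc(4)] and yD = cat_ops_list[OF assoc(5)]
    have zD: "ops_list (cat_operad C) (bs ! i) (ccs ! i) (zss ! i)" if "i < length a" for i
      using assoc that by simp
    note y = cat_opsD[OF yD(3)] and z = cat_ops_list[OF zD] and zz = cat_opsD[OF cat_ops_list(3)[OF zD]]
    \<comment> \<open>Permutation component: the block lengths are those of the input lists in
      \<open>ccs\<close>, grouped as in \<open>bs\<close>.\<close>
    have "comp_perm (comp_perm (fst x) (map length (map (map length) ccs)) (map fst ys))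
        (concat (map (map length) ccs)) (concat (map (map fst) zss)) =
      comp_perm (fst x) (map sum_list (map (map length) ccs))
        (map (\<lambda>i. comp_perm (map fst ys ! i) (map (map length) ccs ! i) (map (map fst) zss ! i)) [0..<length ccs])"
      using xD(3) yD y z zz assoc by (subst comp_perm_assoc) auto
    moreover have "map length (map (map length) ccs) = map length bs"
      using assoc yD z by (auto intro!: nth_equalityI)
    moreover have "map sum_list (map (map length) ccs) = map length (map concat ccs)"
      by (simp add: length_concat comp_def)
    moreover have "map (\<lambda>i. comp_perm (map fst ys ! i) (map (map length) ccs ! i) (map (map fst) zss ! i)) [0..<length ccs] =
        map (\<lambda>i. comp_perm (fst (ys ! i)) (map length (ccs ! i)) (map fst (zss ! i))) [0..<length a]"
      using assoc yD by auto
    ultimately have 1: "comp_perm (comp_perm (fst x) (map length bs) (map fst ys))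
        (map length (concat ccs)) (map fst (concat zss)) =
      comp_perm (fst x) (map length (map concat ccs))
        (map (\<lambda>i. comp_perm (fst (ys ! i)) (map length (ccs ! i)) (map fst (zss ! i))) [0..<length a])"
      by (simp only: map_concat)
    \<comment> \<open>Arrow component: the composites are defined because the arrows from
      \<open>ys\<close> and \<open>x\<close> have sources \<open>bs ! i ! j\<close> and
      \<open>a ! i\<close>.\<close>
    have "graft (graft (snd x) (map snd ys)) (concat (map (map snd) zss)) =
      graft (snd x) (map2 graft (map snd ys) (map (map snd) zss))"
    proof (rule graft_assoc)
      fix i j h assume i: "i < length (snd x)" and j: "j < length (map snd ys ! i)"
        and h: "h \<in> set (map (map snd) zss ! i ! j)"
      have i': "i < length a" using i xD by simp
      have j': "j < length (bs ! i)" "j < length (snd (ys ! i))" using j i' yD y(4)[OF i'] by auto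
      have h': "h \<in> set (snd (zss ! i ! j))" using h i' j' assoc z(2)[OF i'] by simp
      have gm: "snd (ys ! i) ! j \<in> set (snd (ys ! i))" using j' by simp
      have fm: "snd x ! i \<in> set (snd x)" using i by simp
      have "src C (snd (ys ! i) ! j) = bs ! i ! j" using y(5)[OF i'] j' by (metis nth_map)
      moreover have "src C (snd x ! i) = a ! i" using xD(5) i by (metis nth_map)
      ultimately show "cmp C (cmp C (snd x ! i) (map snd ys ! i ! j)) h =
          cmp C (snd x ! i) (cmp C (map snd ys ! i ! j) h)"
        using zz(6,7)[OF i' j'(1) h'] y(6,7)[OF i' gm] xD(6)[OF fm] i' yD
        by (simp add: cmp_assoc)
    qed (use xD yD y z assoc in auto)
    moreover have "map2 graft (map snd ys) (map (map snd) zss) =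
        map (\<lambda>i. graft (snd (ys ! i)) (map snd (zss ! i))) [0..<length a]"
      using yD assoc by (auto intro!: nth_equalityI)
    ultimately have 2: "graft (graft (snd x) (map snd ys)) (map snd (concat zss)) =
        graft (snd x) (map (\<lambda>i. graft (snd (ys ! i)) (map snd (zss ! i))) [0..<length a])"
      by (simp add: map_concat)
    show ?thesis using assoc 1 2 by (simp add: cat_gam comp_def)
  next
    case (equivariance_outer x a bs ys \<sigma>)
    note xD = cat_opsD[OF equivariance_outer(4)] and yD = cat_ops_list[OF equivariance_outer(5)]
    note y = cat_opsD[OF yD(3)]
    have s: "\<sigma> permutes {..<length bs}" "\<sigma> permutes {..<length ys}"
      using equivariance_outer yD by auto
    have "graft (permute_list \<sigma> (snd x)) (permute_list \<sigma> (map snd ys)) =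
      permute_list (block_perm \<sigma> (map length (permute_list \<sigma> (map snd ys)))) (graft (snd x) (map snd ys))"
      using xD yD equivariance_outer by (intro graft_permute_outer) auto
    moreover have "map length (permute_list \<sigma> (map snd ys)) = map length (permute_list \<sigma> bs)"
      using s yD(4) permute_list_map[of \<sigma> "map snd ys" length] permute_list_map[of \<sigma> bs length] by simp
    moreover have "comp_perm (fst x) (map length bs) (map fst ys) \<circ>
        block_perm \<sigma> (permute_list \<sigma> (map length bs)) =
      comp_perm (fst x \<circ> \<sigma>) (permute_list \<sigma> (map length bs)) (permute_list \<sigma> (map fst ys))"
      using xD yD y s by (intro comp_perm_outer) auto
    ultimately show ?thesis using equivariance_outer s
      by (simp add: cat_gam cat_act permute_list_map)
  next
    case (equivariance_inner x a bs ys \<tau>s)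
    note xD = cat_opsD[OF equivariance_inner(4)] and yD = cat_ops_list[OF equivariance_inner(5)]
    note y = cat_opsD[OF yD(3)]
    have t: "\<tau>s ! i permutes {..<length (bs ! i)}" if "i < length a" for i
      using equivariance_inner that by blast
    have "graft (snd x) (map2 permute_list \<tau>s (map snd ys)) =
      permute_list (sum_perm (map length (map snd ys)) \<tau>s) (graft (snd x) (map snd ys))"
      using xD yD y t equivariance_inner by (intro graft_permute_inner) auto
    moreover have "map2 permute_list \<tau>s (map snd ys) = map (\<lambda>i. permute_list (\<tau>s ! i) (snd (ys ! i))) [0..<length a]"
      using yD equivariance_inner by (auto intro!: nth_equalityI)
    moreover have "comp_perm (fst x) (map length bs) (map fst ys) \<circ> sum_perm (map length bs) \<tau>s =
      comp_perm (fst x) (map length bs) (map2 (\<circ>) (map fst ys) \<tau>s)"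
      using xD yD y t equivariance_inner by (intro comp_perm_inner) auto
    moreover have "map2 (\<circ>) (map fst ys) \<tau>s = map (\<lambda>i. fst (ys ! i) \<circ> (\<tau>s ! i)) [0..<length a]"
      using yD equivariance_inner by (auto intro!: nth_equalityI)
    moreover have "map length (map2 permute_list \<tau>s bs) = map length bs"
      using yD equivariance_inner by (auto intro!: nth_equalityI)
    ultimately show ?thesis using equivariance_inner yD(4)
      by (simp add: cat_gam cat_act comp_def)
  qed
qed

end

subsection \<open>Iterated multiplications\<close>

lemma operadD:
  assumes "operad K P"
  shows operad_pre: "pre_operad K P" and operad_law: "op_law P t c x y \<Longrightarrow> x = y"
  using assms by (auto simp: operad_def)

lemma ops_list_Nil: "ops_list P [] [] []"
  by (simp add: ops_list_def)

lemma ops_list_Cons: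
  "y \<in> ops P s b \<Longrightarrow> ops_list P a bs ys \<Longrightarrow> ops_list P (s # a) (b # bs) (y # ys)"
  by (auto simp: ops_list_def nth_Cons split: nat.split)

lemma operad_assoc1:
  assumes P: "operad K P" and x: "x \<in> ops P t [a]" and y: "y \<in> ops P a b" and zs: "ops_list P b cs zs"
  shows "gam P t b cs (gam P t [a] [b] x [y]) zs = gam P t [a] [concat cs] x [gam P a b cs y zs]"
  using operad_law[OF P op_law.assoc[of x P t "[a]" "[b]" "[y]" "[cs]" "[zs]"]] assms
  by (simp add: ops_list_Nil ops_list_Cons)

lemma operad_assoc2:
  assumes P: "operad K P" and x: "x \<in> ops P t [a, a']" and y: "y \<in> ops P a b" and y': "y' \<in> ops P a' b'"
    and zs: "ops_list P b cs zs" and zs': "ops_list P b' cs' zs'"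
  shows "gam P t (b @ b') (cs @ cs') (gam P t [a, a'] [b, b'] x [y, y']) (zs @ zs') =
    gam P t [a, a'] [concat cs, concat cs'] x [gam P a b cs y zs, gam P a' b' cs' y' zs']"
  using operad_law[OF P op_law.assoc[of x P t "[a, a']" "[b, b']" "[y, y']" "[cs, cs']" "[zs, zs']"]] assms
  by (simp add: ops_list_Nil ops_list_Cons less_Suc_eq numeral_2_eq_2)

lemma operad_unit_left: "operad K P \<Longrightarrow> x \<in> ops P t c \<Longrightarrow> gam P t [t] [c] (one P t) [x] = x"
  by (rule operad_law[OF _ op_law.unit_left])

lemma operad_unit_right:
  "operad K P \<Longrightarrow> x \<in> ops P t c \<Longrightarrow> gam P t c (map (\<lambda>s. [s]) c) x (map (one P) c) = x"
  by (rule operad_law[OF _ op_law.unit_right])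

lemma operad_gam2:
  assumes "operad K P" "x \<in> ops P t [a, a']" "y \<in> ops P a b" "y' \<in> ops P a' b'"
  shows "gam P t [a, a'] [b, b'] x [y, y'] \<in> ops P t (b @ b')"
  using pre_operad_gam[OF operad_pre[OF assms(1)] assms(2), of "[b, b']" "[y, y']"] assms
  by (simp add: ops_list_Nil ops_list_Cons)

lemma op_hom_gam1:
  assumes "op_hom K P Q h" "x \<in> ops P t [a]" "y \<in> ops P a b"
  shows "h t b (gam P t [a] [b] x [y]) = gam Q t [a] [b] (h t [a] x) [h a b y]"
  using op_hom_gam[OF assms(1,2), of "[b]" "[y]"] assms by (simp add: ops_list_Nil ops_list_Cons)

lemma op_hom_gam2:
  assumes "op_hom K P Q h" "x \<in> ops P t [a, a']" "y \<in> ops P a b" "y' \<in> ops P a' b'"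
  shows "h t (b @ b') (gam P t [a, a'] [b, b'] x [y, y']) =
    gam Q t [a, a'] [b, b'] (h t [a, a'] x) [h a b y, h a' b' y']"
  using op_hom_gam[OF assms(1,2), of "[b, b']" "[y, y']"] assms by (simp add: ops_list_Nil ops_list_Cons)

lemma permute_list_inv':
  assumes "\<sigma> permutes {..<length xs}"
  shows "permute_list (inv \<sigma>) (permute_list \<sigma> xs) = xs"
  using permute_list_compose[of "inv \<sigma>" xs \<sigma>] permutes_inv[OF assms] permutes_inv_o(1)[OF assms] by simp

section \<open>Monoids in an operad and their iterated products\<close>

text \<open>The assumptions mirror the functoriality, algebra and compatibility relations: a functor
  \<open>F\<close> into the unary operations of \<open>Q\<close>, with monoids preserved by every
  \<open>F f\<close>. Such a model corresponds to a morphism from \<open>cat_operad C\<close>,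
  before orthogonality enters.\<close>

locale category_model = small_category C
  for C :: "('o, 'm) cat_data" +
  fixes Q :: "('o, 'q) operad_data" and F :: "'m \<Rightarrow> 'q" and u mu :: "'o \<Rightarrow> 'q"
  assumes Q: "operad (Ob C) Q"
    and F_ops: "f \<in> Mor C \<Longrightarrow> F f \<in> ops Q (tgt C f) [src C f]"
    and u_ops: "t \<in> Ob C \<Longrightarrow> u t \<in> ops Q t []"
    and mu_ops: "t \<in> Ob C \<Longrightarrow> mu t \<in> ops Q t [t, t]"
    and F_idm: "t \<in> Ob C \<Longrightarrow> F (idm C t) = one Q t"
    and F_cmp: "f \<in> Mor C \<Longrightarrow> g \<in> Mor C \<Longrightarrow> tgt C g = src C f \<Longrightarrow>
      gam Q (tgt C f) [src C f] [[src C g]] (F f) [F g] = F (cmp C f g)"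
    and mu_left: "t \<in> Ob C \<Longrightarrow> gam Q t [t, t] [[], [t]] (mu t) [u t, one Q t] = one Q t"
    and mu_right: "t \<in> Ob C \<Longrightarrow> gam Q t [t, t] [[t], []] (mu t) [one Q t, u t] = one Q t"
    and mu_assoc: "t \<in> Ob C \<Longrightarrow> gam Q t [t, t] [[t, t], [t]] (mu t) [mu t, one Q t] =
      gam Q t [t, t] [[t], [t, t]] (mu t) [one Q t, mu t]"
    and F_unit: "f \<in> Mor C \<Longrightarrow> gam Q (tgt C f) [src C f] [[]] (F f) [u (src C f)] = u (tgt C f)"
    and F_mult: "f \<in> Mor C \<Longrightarrow>
      gam Q (tgt C f) [src C f] [[src C f, src C f]] (F f) [mu (src C f)] =
      gam Q (tgt C f) [tgt C f, tgt C f] [[src C f], [src C f]] (mu (tgt C f)) [F f, F f]"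
begin

abbreviation arr :: "'o \<Rightarrow> 'm set" where
  "arr t \<equiv> {f \<in> Mor C. tgt C f = t}"

abbreviation mult :: "'o \<Rightarrow> 'o list \<Rightarrow> 'o list \<Rightarrow> 'q \<Rightarrow> 'q \<Rightarrow> 'q" where
  "mult t c c' x y \<equiv> gam Q t [t, t] [c, c'] (mu t) [x, y]"

text \<open>Products are bracketed to the right and end in the unit, so the empty list is covered,
  while a singleton gives \<open>F f\<close> only after the unit law
  (\<open>mult_list_single\<close>).\<close>

primrec mult_list :: "'o \<Rightarrow> 'm list \<Rightarrow> 'q" where
  "mult_list t [] = u t"
| "mult_list t (f # fs) = mult t [src C f] (map (src C) fs) (F f) (mult_list t fs)"

lemma one_ops: "t \<in> Ob C \<Longrightarrow> one Q t \<in> ops Q t [t]"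
  by (rule pre_operad_one[OF operad_pre[OF Q]])

lemma mult_list_ops:
  assumes "t \<in> Ob C" "set fs \<subseteq> arr t"
  shows "mult_list t fs \<in> ops Q t (map (src C) fs)"
  using assms(2)
proof (induction fs)
  case (Cons f fs)
  then have "F f \<in> ops Q t [src C f]" using F_ops[of f] by auto
  from operad_gam2[OF Q mu_ops[OF assms(1)] this] Cons show ?case by fastforce
qed (simp add: u_ops assms(1))

text \<open>Obtained by inserting \<open>y\<close> into the single input of both sides of
  \<open>mu_left\<close>.\<close>

lemma mult_unit_left:
  assumes t: "t \<in> Ob C" and y: "y \<in> ops Q t c"
  shows "mult t [] c (u t) y = y"
proof -
  \<comment> \<open>Associativity also composes \<open>u t\<close>, which has no inputs, with the
    empty list; the right unit law removes this composition.\<close>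
  have "gam Q t [] [] (u t) [] = u t" using operad_unit_right[OF Q u_ops[OF t]] by simp
  then show ?thesis
    using operad_assoc2[OF Q mu_ops[OF t] u_ops[OF t] one_ops[OF t], of "[]" "[]" "[c]" "[y]"]
      operad_unit_left[OF Q y] mu_left[OF t] y
    by (simp add: ops_list_Nil ops_list_Cons)
qed

lemma mult_unit_right:
  assumes t: "t \<in> Ob C" and y: "y \<in> ops Q t c"
  shows "mult t c [] y (u t) = y"
proof -
  have "gam Q t [] [] (u t) [] = u t" using operad_unit_right[OF Q u_ops[OF t]] by simp
  then show ?thesis
    using operad_assoc2[OF Q mu_ops[OF t] one_ops[OF t] u_ops[OF t], of "[c]" "[y]" "[]" "[]"]
      operad_unit_left[OF Q y] mu_right[OF t] y
    by (simp add: ops_list_Nil ops_list_Cons)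
qed

text \<open>Obtained by inserting \<open>x\<close>, \<open>y\<close> and \<open>z\<close> into both
  sides of \<open>mu_assoc\<close>.\<close>

lemma mult_assoc:
  assumes t: "t \<in> Ob C" and x: "x \<in> ops Q t c" and y: "y \<in> ops Q t c'" and z: "z \<in> ops Q t c''"
  shows "mult t (c @ c') c'' (mult t c c' x y) z = mult t c (c' @ c'') x (mult t c' c'' y z)"
  using operad_assoc2[OF Q mu_ops[OF t] mu_ops[OF t] one_ops[OF t], of "[c, c']" "[x, y]" "[c'']" "[z]"]
    operad_assoc2[OF Q mu_ops[OF t] one_ops[OF t] mu_ops[OF t], of "[c]" "[x]" "[c', c'']" "[y, z]"]
    mu_assoc[OF t] operad_unit_left[OF Q x] operad_unit_left[OF Q z] x y z
  by (simp add: ops_list_Nil ops_list_Cons)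

lemma mult_list_append:
  assumes t: "t \<in> Ob C" and "set fs \<subseteq> arr t" and gs: "set gs \<subseteq> arr t"
  shows "mult_list t (fs @ gs) = mult t (map (src C) fs) (map (src C) gs) (mult_list t fs) (mult_list t gs)"
  using assms(2)
proof (induction fs)
  case Nil
  then show ?case by (simp add: mult_unit_left[OF t mult_list_ops[OF t gs]])
next
  case (Cons f fs)
  then have f: "F f \<in> ops Q t [src C f]" using F_ops[of f] by auto
  show ?case using Cons mult_assoc[OF t f mult_list_ops[OF t, of fs] mult_list_ops[OF t gs]] by simp
qed

text \<open>Obtained by inserting \<open>x\<close> and \<open>y\<close> into both sides of
  \<open>F_mult\<close>.\<close>

lemma F_mult_distrib:
  assumes f: "f \<in> Mor C" and x: "x \<in> ops Q (src C f) c" and y: "y \<in> ops Q (src C f) c'"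
  shows "gam Q (tgt C f) [src C f] [c @ c'] (F f) [mult (src C f) c c' x y] =
    mult (tgt C f) c c' (gam Q (tgt C f) [src C f] [c] (F f) [x]) (gam Q (tgt C f) [src C f] [c'] (F f) [y])"
  using operad_assoc1[OF Q F_ops[OF f] mu_ops[OF src_Ob[OF f]], of "[c, c']" "[x, y]"] F_mult[OF f]
    operad_assoc2[OF Q mu_ops[OF tgt_Ob[OF f]] F_ops[OF f] F_ops[OF f], of "[c]" "[x]" "[c']" "[y]"] x y
  by (simp add: ops_list_Nil ops_list_Cons)

lemma F_mult_list:
  assumes f: "f \<in> Mor C" and "set gs \<subseteq> arr (src C f)"
  shows "gam Q (tgt C f) [src C f] [map (src C) gs] (F f) [mult_list (src C f) gs] =
    mult_list (tgt C f) (map (cmp C f) gs)"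
  using assms(2)
proof (induction gs)
  case Nil
  then show ?case by (simp add: F_unit f)
next
  case (Cons g gs)
  then have g: "F g \<in> ops Q (src C f) [src C g]" using F_ops[of g] by auto
  have "map (src C \<circ> cmp C f) gs = map (src C) gs"
    using Cons.prems f by (auto simp: src_cmp)
  then show ?case
    using Cons F_mult_distrib[OF f g mult_list_ops[OF src_Ob[OF f], of gs]] F_cmp[OF f, of g] f
    by (auto simp: src_cmp simp del: map_eq_conv)
qed

lemma graft_arr:
  assumes "length gss = length fs" "set fs \<subseteq> arr t"
    and "\<And>i. i < length fs \<Longrightarrow> set (gss ! i) \<subseteq> arr (src C (fs ! i))"
  shows "set (graft fs gss) \<subseteq> arr t" "map (src C) (graft fs gss) = concat (map (map (src C)) gss)"
proof -
  have "set (graft fs gss) \<subseteq> arr t \<and> map (src C) (graft fs gss) = concat (map (map (src C)) gss)"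
    using assms
  proof (induction gss fs rule: list_induct2)
    case (Cons gs gss f fs)
    have "set (graft fs gss) \<subseteq> arr t \<and> map (src C) (graft fs gss) = concat (map (map (src C)) gss)"
      using Cons.prems(1) Cons.prems(2)[of "Suc i" for i] by (intro Cons.IH) auto
    moreover have "f \<in> Mor C" "tgt C f = t" "set gs \<subseteq> arr (src C f)"
      using Cons.prems(1) Cons.prems(2)[of 0] by auto
    ultimately show ?case by (auto simp: cmp_Mor tgt_cmp src_cmp subset_iff)
  qed simp
  then show "set (graft fs gss) \<subseteq> arr t" "map (src C) (graft fs gss) = concat (map (map (src C)) gss)"
    by blast+
qed

lemma mult_list_ops_list:
  assumes "length gss = length fs" "set fs \<subseteq> Mor C"
    and "\<And>i. i < length fs \<Longrightarrow> set (gss ! i) \<subseteq> arr (src C (fs ! i))"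
  shows "ops_list Q (map (src C) fs) (map (map (src C)) gss) (map2 (\<lambda>f. mult_list (src C f)) fs gss)"
  using assms by (auto simp: ops_list_def subset_iff intro!: mult_list_ops src_Ob)

text \<open>This is compatibility with composition when all permutations are identities.
  Associativity splits off the first factor, \<open>F_mult_list\<close> pushes \<open>F f\<close>
  through the product inserted there, and \<open>mult_list_append\<close> joins it to the
  rest.\<close>

lemma mult_list_graft:
  assumes t: "t \<in> Ob C" and "length gss = length fs" "set fs \<subseteq> arr t"
    and "\<And>i. i < length fs \<Longrightarrow> set (gss ! i) \<subseteq> arr (src C (fs ! i))"
  shows "gam Q t (map (src C) fs) (map (map (src C)) gss) (mult_list t fs) (map2 (\<lambda>f. mult_list (src C f)) fs gss) =
    mult_list t (graft fs gss)"
  using assms(2-)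
proof (induction gss fs rule: list_induct2)
  case Nil
  then show ?case using operad_unit_right[OF Q u_ops[OF t]] by simp
next
  case (Cons gs gss f fs)
  have f: "f \<in> Mor C" "tgt C f = t" and gs: "set gs \<subseteq> arr (src C f)"
    using Cons.prems(1) Cons.prems(2)[of 0] by auto
  have fs: "set fs \<subseteq> arr t" and gss: "\<And>i. i < length fs \<Longrightarrow> set (gss ! i) \<subseteq> arr (src C (fs ! i))"
    using Cons.prems(1) Cons.prems(2)[of "Suc i" for i] by auto
  have Ff: "F f \<in> ops Q t [src C f]" using F_ops[OF f(1)] f(2) by simp
  have gr: "set (graft fs gss) \<subseteq> arr t" "map (src C) (graft fs gss) = concat (map (map (src C)) gss)"
    using graft_arr[OF Cons.hyps fs gss] by blast+
  have cg: "set (map (cmp C f) gs) \<subseteq> arr t" "map (src C \<circ> cmp C f) gs = map (src C) gs"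
    using f gs by (auto simp: cmp_Mor tgt_cmp src_cmp)
  have "ops_list Q (map (src C) fs) (map (map (src C)) gss) (map2 (\<lambda>f. mult_list (src C f)) fs gss)"
    using mult_list_ops_list[OF Cons.hyps _ gss] fs by blast
  then show ?case
    using operad_assoc2[OF Q mu_ops[OF t] Ff mult_list_ops[OF t fs], of "[map (src C) gs]" "[mult_list (src C f) gs]"]
      mult_list_ops[OF src_Ob[OF f(1)] gs] F_mult_list[OF f(1) gs] Cons.IH[OF fs gss] f
      mult_list_append[OF t cg(1) gr(1)] cg(2) gr(2)
    by (simp add: ops_list_Nil ops_list_Cons del: map_eq_conv)
qed

section \<open>The morphism from \<open>cat_operad C\<close> induced by a model\<close>

text \<open>Since \<open>(\<sigma>, fs)\<close> is \<open>\<sigma>\<close> acting on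
  \<open>(id, fs')\<close>, equivariance forces this value once \<open>(id, fs')\<close> is sent to
  the product. The restriction provides the extensionality that \<open>op_hom\<close>
  demands.\<close>

definition extension :: "'o \<Rightarrow> 'o list \<Rightarrow> (nat \<Rightarrow> nat) \<times> 'm list \<Rightarrow> 'q" where
  "extension t c = restrict (\<lambda>(\<sigma>, fs). let fs' = permute_list (inv \<sigma>) fs in act Q t (map (src C) fs') \<sigma> (mult_list t fs'))
    (ops (cat_operad C) t c)"

text \<open>Presents an operation as a translate of \<open>(id, fs)\<close>, so that
  \<open>extension_eq\<close> evaluates it without an inverse permutation.\<close>

lemma cat_ops_sorted:
  assumes "x \<in> ops (cat_operad C) t c"
  obtains \<sigma> fs where "x = (\<sigma>, permute_list \<sigma> fs)" "c = permute_list \<sigma> (map (src C) fs)"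
    "\<sigma> permutes {..<length fs}" "set fs \<subseteq> arr t" "t \<in> Ob C"
proof
  note x = cat_opsD[OF assms]
  let ?fs = "permute_list (inv (fst x)) (snd x)"
  have i: "inv (fst x) permutes {..<length (snd x)}" using permutes_inv[OF x(3)] x(4) by simp
  have s: "permute_list (fst x) ?fs = snd x" using permute_list_inv[of "fst x" "snd x"] x(3,4) by simp
  then show "x = (fst x, permute_list (fst x) ?fs)" by simp
  show p: "fst x permutes {..<length ?fs}" using x(3,4) by simp
  show "c = permute_list (fst x) (map (src C) ?fs)"
    using permute_list_map[OF p, of "src C"] s x(5) by simp
  show "set ?fs \<subseteq> arr t" using x(6,7) i by auto
  show "t \<in> Ob C" by (rule x(1))
qed

lemma extension_eq:
  assumes "x \<in> ops (cat_operad C) t c" "x = (\<sigma>, permute_list \<sigma> fs)"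
  shows "extension t c x = act Q t (map (src C) fs) \<sigma> (mult_list t fs)"
  using cat_opsD(3,4)[OF assms(1)] assms permute_list_inv'[of \<sigma> fs] by (simp add: extension_def)

lemma Q_act_comp:
  assumes "x \<in> ops Q t c" "\<sigma> permutes {..<length c}" "\<tau> permutes {..<length c}"
  shows "act Q t (permute_list \<sigma> c) \<tau> (act Q t c \<sigma> x) = act Q t c (\<sigma> \<circ> \<tau>) x"
  using operad_law[OF Q op_law.act_comp[OF assms]] by simp

text \<open>All permutations are pulled out of the composite, both in \<open>cat_operad C\<close>
  and in \<open>Q\<close>. The same permutation appears on both sides, and what remains is
  \<open>mult_list_graft\<close>.\<close>

lemma extension_gam:
  assumes x: "x \<in> ops (cat_operad C) t a" and ys: "ops_list (cat_operad C) a bs ys"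
  shows "extension t (concat bs) (gam (cat_operad C) t a bs x ys) =
    gam Q t a bs (extension t a x) (map (\<lambda>i. extension (a ! i) (bs ! i) (ys ! i)) [0..<length a])"
proof -
  obtain \<sigma> fs where xe: "x = (\<sigma>, permute_list \<sigma> fs)" and a: "a = permute_list \<sigma> (map (src C) fs)"
    and \<sigma>: "\<sigma> permutes {..<length fs}" and fs: "set fs \<subseteq> arr t" and t: "t \<in> Ob C"
    using x by (rule cat_ops_sorted)
  have la: "length a = length fs" using a by simp
  note yD = cat_ops_list[OF ys]
  \<comment> \<open>The permutation is fixed as \<open>fst (ys ! i)\<close>, so only the sorted list
    has to be chosen for each \<open>i\<close>.\<close>
  have "\<exists>gs. ys ! i = (fst (ys ! i), permute_list (fst (ys ! i)) gs) \<and>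
      bs ! i = permute_list (fst (ys ! i)) (map (src C) gs) \<and>
      fst (ys ! i) permutes {..<length gs} \<and> set gs \<subseteq> arr (a ! i)" if "i < length a" for i
  proof (rule cat_ops_sorted[OF yD(3)[OF that]])
    fix \<tau> gs
    assume "ys ! i = (\<tau>, permute_list \<tau> gs)" "bs ! i = permute_list \<tau> (map (src C) gs)"
      "\<tau> permutes {..<length gs}" "set gs \<subseteq> arr (a ! i)"
    then show ?thesis by (intro exI[of _ gs]) (simp only: fst_conv)
  qed
  then have "\<forall>i. \<exists>gs. i < length a \<longrightarrow> ys ! i = (fst (ys ! i), permute_list (fst (ys ! i)) gs) \<and>
      bs ! i = permute_list (fst (ys ! i)) (map (src C) gs) \<and>
      fst (ys ! i) permutes {..<length gs} \<and> set gs \<subseteq> arr (a ! i)" by blast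
  from choice[OF this] obtain G where G: "\<And>i. i < length a \<Longrightarrow> ys ! i = (fst (ys ! i), permute_list (fst (ys ! i)) (G i)) \<and>
      bs ! i = permute_list (fst (ys ! i)) (map (src C) (G i)) \<and>
      fst (ys ! i) permutes {..<length (G i)} \<and> set (G i) \<subseteq> arr (a ! i)"
    by blast
  \<comment> \<open>\<open>gss'\<close> follows the inputs \<open>a\<close> of \<open>x\<close>,
    which are already permuted by \<open>\<sigma>\<close>; \<open>gss\<close> is rearranged to match
    the sorted list \<open>fs\<close>.\<close>
  define gss' where "gss' = map G [0..<length a]"
  define gss where "gss = permute_list (inv \<sigma>) gss'"
  define \<tau>s where "\<tau>s = map fst ys"
  have lg: "length gss' = length a" "length gss = length fs" "length \<tau>s = length a"
    using la yD by (simp_all add: gss'_def gss_def \<tau>s_def)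
  have gss': "gss' = permute_list \<sigma> gss"
    unfolding gss_def using \<sigma> lg la by (intro permute_list_inv) simp
  have n: "gss' ! i = G i" "\<tau>s ! i = fst (ys ! i)" if "i < length a" for i
    using that yD by (simp_all add: gss'_def \<tau>s_def)
  have nG: "ys ! i = (\<tau>s ! i, permute_list (\<tau>s ! i) (gss' ! i))"
    "bs ! i = permute_list (\<tau>s ! i) (map (src C) (gss' ! i))"
    "\<tau>s ! i permutes {..<length (gss' ! i)}" "set (gss' ! i) \<subseteq> arr (a ! i)" if "i < length a" for i
    using G[OF that] unfolding n[OF that] by blast+
  have gss: "set (gss ! i) \<subseteq> arr (src C (fs ! i))" if i: "i < length fs" for i
  proof -
    obtain j where j: "i = \<sigma> j" using permutes_surj[OF \<sigma>] by (metis surj_def)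
    then have jl: "j < length fs" using permutes_in_image[OF \<sigma>, of j] i by simp
    have "gss' ! j = gss ! i" "a ! j = src C (fs ! i)"
      using permute_list_nth[of \<sigma> gss j] permute_list_nth[of \<sigma> "map (src C) fs" j] j jl i \<sigma> lg a gss' by simp_all
    then show ?thesis using nG(4)[of j] jl la by simp
  qed
  have fs': "set fs \<subseteq> Mor C" using fs by blast
  let ?a = "map (src C) fs" and ?bs = "map (map (src C)) gss" and ?bs' = "map (map (src C)) gss'"
  let ?ks = "map length gss'"
  let ?Bs = "map2 (\<lambda>f. mult_list (src C f)) fs gss"
  let ?g = "graft fs gss"
  have gr: "set ?g \<subseteq> arr t" "map (src C) ?g = concat ?bs"
    using graft_arr[OF lg(2) fs gss] by blast+
  have Bs: "ops_list Q ?a ?bs ?Bs" by (rule mult_list_ops_list[OF lg(2) fs' gss])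
  note B = mult_list_ops[OF t fs]
  have bs: "bs = map2 permute_list \<tau>s ?bs'"
    using yD lg nG by (auto intro!: nth_equalityI)
  have snds: "map snd ys = map2 permute_list \<tau>s gss'"
  proof (rule nth_equalityI)
    fix i assume "i < length (map snd ys)"
    then show "map snd ys ! i = map2 permute_list \<tau>s gss' ! i"
      using nG(1)[of i] yD lg by (simp add: prod_eq_iff)
  qed (use yD lg in simp)
  have ks: "map length bs = ?ks" using yD lg nG(2) by (auto intro!: nth_equalityI)
  have bs': "?bs' = permute_list \<sigma> ?bs" using permute_list_map[of \<sigma> gss "map (src C)"] gss' \<sigma> lg by simp
  \<comment> \<open>Outer equivariance needs the products indexed by the inputs of \<open>x\<close>
    as a \<open>\<sigma>\<close>-permutation of those indexed by \<open>fs\<close>.\<close>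
  have Bs': "map (\<lambda>i. mult_list (a ! i) (gss' ! i)) [0..<length a] = permute_list \<sigma> ?Bs"
  proof (rule nth_equalityI)
    fix i assume "i < length (map (\<lambda>i. mult_list (a ! i) (gss' ! i)) [0..<length a])"
    then have i: "i < length fs" using la by simp
    then have "\<sigma> i < length fs" using permutes_in_image[OF \<sigma>, of i] by simp
    then show "map (\<lambda>i. mult_list (a ! i) (gss' ! i)) [0..<length a] ! i = permute_list \<sigma> ?Bs ! i"
      using i la lg \<sigma> permute_list_nth[of \<sigma> gss i] permute_list_nth[of \<sigma> ?a i] permute_list_nth[of \<sigma> ?Bs i]
      by (simp add: a gss')
  qed (use la lg in simp)
  have \<sigma>a: "\<sigma> permutes {..<length ?a}" using \<sigma> by simp
  have kb: "?ks = map length (permute_list \<sigma> ?bs)" unfolding bs'[symmetric] by simp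
  have lcb: "length (concat ?bs) = length ?g" using arg_cong[OF gr(2), of length] by simp
  have "length ?g = sum_list (map length gss)"
    using arg_cong[OF gr(2), of length] by (simp add: length_concat comp_def)
  then have lcg: "length ?g = sum_list ?ks"
    using sum_list_permute_list[of \<sigma> "map length gss"] permute_list_map[of \<sigma> gss length] \<sigma> lg gss' by simp
  have bp: "block_perm \<sigma> ?ks permutes {..<length ?g}"
    using block_perm_permutes[of \<sigma> ?ks] \<sigma> lg la lcg by simp
  have sp: "sum_perm ?ks \<tau>s permutes {..<length ?g}"
    using sum_perm_permutes[of \<tau>s ?ks] lg nG(3) lcg by simp
  \<comment> \<open>In \<open>cat_operad C\<close>, the inner permutations are pulled out first and
    then \<open>\<sigma>\<close>, leaving the graft of the sorted lists.\<close>
  have "snd (gam (cat_operad C) t a bs x ys) = graft (permute_list \<sigma> fs) (map2 permute_list \<tau>s gss')"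
    by (simp add: cat_gam xe snds)
  also have "\<dots> = permute_list (sum_perm ?ks \<tau>s) (graft (permute_list \<sigma> fs) gss')"
    using lg la nG(3) by (intro graft_permute_inner) auto
  also have "graft (permute_list \<sigma> fs) gss' = permute_list (block_perm \<sigma> ?ks) ?g"
    using graft_permute_outer[OF \<sigma> lg(2)] gss' by simp
  also have "permute_list (sum_perm ?ks \<tau>s) \<dots> = permute_list (block_perm \<sigma> ?ks \<circ> sum_perm ?ks \<tau>s) ?g"
    by (rule permute_list_compose[OF sp, symmetric])
  finally have "gam (cat_operad C) t a bs x ys =
      (block_perm \<sigma> ?ks \<circ> sum_perm ?ks \<tau>s, permute_list (block_perm \<sigma> ?ks \<circ> sum_perm ?ks \<tau>s) ?g)"
    by (simp add: prod_eq_iff) (simp add: cat_gam xe comp_perm_def ks \<tau>s_def)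
  from extension_eq[OF pre_operad_gam[OF cat_pre_operad x ys] this]
  have L: "extension t (concat bs) (gam (cat_operad C) t a bs x ys) =
      act Q t (concat ?bs) (block_perm \<sigma> ?ks \<circ> sum_perm ?ks \<tau>s) (mult_list t ?g)"
    using gr(2) by simp
  have ext_y: "map (\<lambda>i. extension (a ! i) (bs ! i) (ys ! i)) [0..<length a] =
      map (\<lambda>i. act Q (a ! i) (?bs' ! i) (\<tau>s ! i) (permute_list \<sigma> ?Bs ! i)) [0..<length a]"
    using extension_eq[OF yD(3) nG(1)] lg by (simp flip: Bs')
  have ext_x: "extension t a x = act Q t ?a \<sigma> (mult_list t fs)" by (rule extension_eq[OF x xe])
  have Bsp: "ops_list Q a ?bs' (permute_list \<sigma> ?Bs)"
    using ops_list_permute[OF Bs \<sigma>a] a bs' by simp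
  \<comment> \<open>In \<open>Q\<close>, inner and then outer equivariance extract the same
    permutations in the same order.\<close>
  have "gam Q t a bs (extension t a x) (map (\<lambda>i. extension (a ! i) (bs ! i) (ys ! i)) [0..<length a]) =
      act Q t (concat ?bs') (sum_perm (map length ?bs') \<tau>s) (gam Q t a ?bs' (extension t a x) (permute_list \<sigma> ?Bs))"
    unfolding ext_y unfolding bs
    using pre_operad_act[OF operad_pre[OF Q] B \<sigma>a] ext_x a Bsp lg nG(3)
    by (intro operad_law[OF Q op_law.equivariance_inner]) simp_all
  also have "gam Q t a ?bs' (extension t a x) (permute_list \<sigma> ?Bs) =
      act Q t (concat ?bs) (block_perm \<sigma> (map length ?bs')) (gam Q t ?a ?bs (mult_list t fs) ?Bs)"
    using operad_law[OF Q op_law.equivariance_outer[OF B Bs \<sigma>a]] a bs' ext_x by simp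
  also have "gam Q t ?a ?bs (mult_list t fs) ?Bs = mult_list t ?g"
    by (rule mult_list_graft[OF t lg(2) fs gss])
  also have "map length ?bs' = ?ks" by simp
  also have "concat ?bs' = permute_list (block_perm \<sigma> ?ks) (concat ?bs)"
    unfolding bs' by (rule permute_list_block_perm[OF _ kb, symmetric]) (use \<sigma> lg in simp)
  also have "act Q t \<dots> (sum_perm ?ks \<tau>s) (act Q t (concat ?bs) (block_perm \<sigma> ?ks) (mult_list t ?g)) =
      act Q t (concat ?bs) (block_perm \<sigma> ?ks \<circ> sum_perm ?ks \<tau>s) (mult_list t ?g)"
    using bp sp unfolding lcb[symmetric] by (rule Q_act_comp[OF mult_list_ops[OF t gr(1), unfolded gr(2)]])
  finally show ?thesis using L by simp
qed

lemma act_id: "x \<in> ops Q t c \<Longrightarrow> act Q t c id x = x"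
  by (rule operad_law[OF Q op_law.act_id])

lemma mult_list_single:
  assumes "f \<in> Mor C"
  shows "mult_list (tgt C f) [f] = F f"
  using mult_unit_right[OF tgt_Ob F_ops] assms by simp

lemma mult_list_pair:
  assumes "f \<in> Mor C" "g \<in> Mor C" "tgt C g = tgt C f"
  shows "mult_list (tgt C f) [f, g] = mult (tgt C f) [src C f] [src C g] (F f) (F g)"
  using mult_list_single[OF assms(2)] assms(3) by simp

lemma extension_id:
  assumes "(id, fs) \<in> ops (cat_operad C) t c"
  shows "extension t c (id, fs) = mult_list t fs"
proof -
  note x = cat_opsD[OF assms, simplified]
  then have "mult_list t fs \<in> ops Q t c" using mult_list_ops[of t fs] by auto
  then show ?thesis using extension_eq[OF assms, of id fs] x act_id by simp
qed

lemma extension_hom: "op_hom (Ob C) (cat_operad C) Q extension"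
  unfolding op_hom_def
proof (intro conjI allI impI ballI)
  fix t c show "extension t c \<in> ops (cat_operad C) t c \<rightarrow>\<^sub>E ops Q t c"
  proof (rule PiE_I)
    fix x assume x: "x \<in> ops (cat_operad C) t c"
    then obtain \<sigma> fs where xe: "x = (\<sigma>, permute_list \<sigma> fs)" and c: "c = permute_list \<sigma> (map (src C) fs)"
      and \<sigma>: "\<sigma> permutes {..<length fs}" and fs: "set fs \<subseteq> arr t" and t: "t \<in> Ob C"
      by (rule cat_ops_sorted)
    show "extension t c x \<in> ops Q t c"
      using pre_operad_act[OF operad_pre[OF Q] mult_list_ops[OF t fs], of \<sigma>] extension_eq[OF x xe] c \<sigma> by simp
  qed (simp add: extension_def)
next
  fix t c \<sigma>' x assume x: "x \<in> ops (cat_operad C) t c" and s: "\<sigma>' permutes {..<length c}"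
  obtain \<sigma> fs where xe: "x = (\<sigma>, permute_list \<sigma> fs)" and c: "c = permute_list \<sigma> (map (src C) fs)"
    and \<sigma>: "\<sigma> permutes {..<length fs}" and fs: "set fs \<subseteq> arr t" and t: "t \<in> Ob C"
    using x by (rule cat_ops_sorted)
  have s': "\<sigma>' permutes {..<length fs}" using s c by simp
  \<comment> \<open>Acting by \<open>\<sigma>'\<close> changes the permutation but not the sorted
    list.\<close>
  have "act (cat_operad C) t c \<sigma>' x = (\<sigma> \<circ> \<sigma>', permute_list (\<sigma> \<circ> \<sigma>') fs)"
    using permute_list_compose[OF s', of \<sigma>] by (simp add: cat_act xe)
  from extension_eq[OF pre_operad_act[OF cat_pre_operad x s] this]
  show "extension t (permute_list \<sigma>' c) (act (cat_operad C) t c \<sigma>' x) = act Q t c \<sigma>' (extension t c x)"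
    using Q_act_comp[OF mult_list_ops[OF t fs], of \<sigma> \<sigma>'] \<sigma> s' extension_eq[OF x xe] c by simp
next
  fix t assume t: "t \<in> Ob C"
  have "one (cat_operad C) t \<in> ops (cat_operad C) t [t]" by (rule pre_operad_one[OF cat_pre_operad t])
  then show "extension t [t] (one (cat_operad C) t) = one Q t"
    using extension_id[of "[idm C t]" t "[t]"] mult_list_single[OF idm_Mor[OF t]] F_idm[OF t] t
    by (simp add: cat_one tgt_idm)
qed (rule extension_gam)

lemma extension_gen:
  shows "f \<in> Mor C \<Longrightarrow> extension (tgt C f) [src C f] (id, [f]) = F f"
    and "t \<in> Ob C \<Longrightarrow> extension t [] (id, []) = u t"
    and "t \<in> Ob C \<Longrightarrow> extension t [t, t] (id, [idm C t, idm C t]) = mu t"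
proof -
  show "extension (tgt C f) [src C f] (id, [f]) = F f" if "f \<in> Mor C"
    using that mult_list_single[OF that] permutes_id by (subst extension_id) (auto simp: cat_ops_iff src_Ob tgt_Ob)
  show "extension t [] (id, []) = u t" if "t \<in> Ob C"
    using that permutes_id by (subst extension_id) (auto simp: cat_ops_iff)
  show "extension t [t, t] (id, [idm C t, idm C t]) = mu t" if t: "t \<in> Ob C"
  proof -
    \<comment> \<open>Both factors \<open>F (idm C t)\<close> are units of \<open>Q\<close>, so the
      product is \<open>mu t\<close> composed with units.\<close>
    have "mult_list t [idm C t, idm C t] = mu t"
      using mult_list_pair[OF idm_Mor[OF t] idm_Mor[OF t]] operad_unit_right[OF Q mu_ops[OF t]] t
      by (simp add: tgt_idm src_idm F_idm)
    then show ?thesis using t permutes_id idm_Mor[OF t]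
      by (subst extension_id) (auto simp: cat_ops_iff tgt_idm src_idm less_Suc_eq)
  qed
qed

end

section \<open>Computing composites and comparing morphisms\<close>

lemma comp_perm_id1: "comp_perm id [k] [id] = id"
  using comp_perm_id[of "[k]" 1] by simp

lemma comp_perm_id2: "comp_perm id [k, l] [id, id] = id"
  using comp_perm_id[of "[k, l]" 2] by (simp add: numeral_2_eq_2)

text \<open>Uniqueness in \<open>free_operad_universal\<close>, with the values of \<open>k\<close>
  on generators as prescribed data.\<close>

lemma free_hom_eqI:
  assumes X: "colored_seq K X" and Q: "operad K Q"
    and h: "op_hom K (free_operad K X) Q h" and k: "op_hom K (free_operad K X) Q k"
    and eq: "\<And>t c x. x \<in> X t c \<Longrightarrow> h t c (free_gen K X t c x) = k t c (free_gen K X t c x)"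
  shows "h = k"
proof -
  have "k t c (free_gen K X t c x) \<in> ops Q t c" if "x \<in> X t c" for t c x
    by (rule op_hom_mem[OF k free_gen_mem[of _ X, OF that]])
  from free_operad_universal[OF X Q, of "\<lambda>t c x. k t c (free_gen K X t c x)", OF this]
  show ?thesis using h k eq by blast
qed

lemma op_compose_apply: "x \<in> ops P t c \<Longrightarrow> op_compose P h k t c x = h t c (k t c x)"
  by (simp add: op_compose_def compose_def)

text \<open>Composites are undefined outside the operations of their domain, so the reason is that
  \<open>k\<close> maps operations of \<open>P\<close> to operations of \<open>P'\<close>.\<close>

lemma op_compose_assoc:
  assumes "op_hom K P P' k"
  shows "op_compose P h' (op_compose P h k) = op_compose P (op_compose P' h' h) k"
  using op_hom_mem[OF assms] by (intro ext) (auto simp: op_compose_def compose_def restrict_def)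

subsection \<open>The coequalizer\<close>

context orthogonal_category begin

section \<open>Surjectivity of \<open>q_mor C\<close> and the relations in
  \<open>orth_operad C perp\<close>\<close>

lemma q_hom: "op_hom (Ob C) (free_G C) (cat_operad C) (q_mor C)"
  and q_gen: "x \<in> gen_seq C t c \<Longrightarrow> q_mor C t c (free_gen (Ob C) (gen_seq C) t c x) = q_gen C x"
  using free_ext_props[OF gen_seq_colored cat_operad_operad, of "\<lambda>_ _. q_gen C", OF q_gen_mem]
  unfolding q_mor_def by blast+

lemma q_arrow: "f \<in> Mor C \<Longrightarrow> q_mor C (tgt C f) [src C f] (arrow_op C f) = (id, [f])"
  and q_unit: "t \<in> Ob C \<Longrightarrow> q_mor C t [] (unit_op C t) = (id, [])"
  and q_mult: "t \<in> Ob C \<Longrightarrow> q_mor C t [t, t] (mult_op C t) = (id, [idm C t, idm C t])"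
  unfolding arrow_op_def unit_op_def mult_op_def by (subst q_gen; auto simp: gen_seq_def)+

text \<open>Together with surjectivity of the quotient map, this gives uniqueness of the
  factorization in the coequalizer.\<close>

lemma q_surj:
  assumes "x \<in> ops (cat_operad C) t c"
  shows "\<exists>z\<in>ops (free_G C) t c. q_mor C t c z = x"
proof -
  note x = cat_opsD[OF assms]
  let ?fs = "permute_list (inv (fst x)) (snd x)"
  have i: "inv (fst x) permutes {..<length (snd x)}" using permutes_inv[OF x(3)] x(4) by simp
  have s: "permute_list (fst x) ?fs = snd x" using permute_list_inv[of "fst x" "snd x"] x(3,4) by simp
  have p: "fst x permutes {..<length ?fs}" using x(3,4) by simp
  have c: "permute_list (fst x) (map (src C) ?fs) = c"
    using permute_list_map[OF p, of "src C"] s x(5) by simp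
  \<comment> \<open>Right-bracketed products of arrow generators, ending in the unit generator,
    reach every operation with identity permutation.\<close>
  have "\<exists>z\<in>ops (free_G C) t (map (src C) fs). q_mor C t (map (src C) fs) z = (id, fs)"
    if "set fs \<subseteq> {f \<in> Mor C. tgt C f = t}" for fs
    using that
  proof (induction fs)
    case Nil
    show ?case using q_unit[OF x(1)] unit_op_mem[OF x(1)] unfolding list.map by (rule bexI)
  next
    case (Cons f fs)
    then have "set fs \<subseteq> {f \<in> Mor C. tgt C f = t}" by simp
    from Cons.IH[OF this] obtain z
      where z: "z \<in> ops (free_G C) t (map (src C) fs)" "q_mor C t (map (src C) fs) z = (id, fs)" by blast
    have f: "f \<in> Mor C" "tgt C f = t" using Cons.prems by auto
    have "cmp C (idm C t) g = g" if "g \<in> set fs" for g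
      using idm_left[of g] that Cons.prems by auto
    then have map_fs: "map (cmp C (idm C t)) fs = fs" by (intro map_idI)
    let ?z = "gam (free_G C) t [t, t] [[src C f], map (src C) fs] (mult_op C t) [arrow_op C f, z]"
    from map_fs have "q_mor C t ([src C f] @ map (src C) fs) ?z = (id, f # fs)"
      using f q_arrow[OF f(1)] q_mult[OF x(1)] z idm_left[OF f(1)] arrow_op_mem[OF f(1)]
      by (subst op_hom_gam2[OF q_hom mult_op_mem[OF x(1)]]) (auto simp: cat_gam comp_perm_id2)
    then have 1: "q_mor C t (map (src C) (f # fs)) ?z = (id, f # fs)" by simp
    have "?z \<in> ops (free_G C) t ([src C f] @ map (src C) fs)"
      using arrow_op_mem[OF f(1)] f z by (intro gam2 mult_op_mem x(1)) simp_all
    then have 2: "?z \<in> ops (free_G C) t (map (src C) (f # fs))" by simp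
    from 1 2 show ?case by (rule bexI)
  qed
  moreover have "set ?fs \<subseteq> {f \<in> Mor C. tgt C f = t}" using x(6,7) i by auto
  ultimately obtain z where z: "z \<in> ops (free_G C) t (map (src C) ?fs)"
    "q_mor C t (map (src C) ?fs) z = (id, ?fs)" by blast
  have p': "fst x permutes {..<length (map (src C) ?fs)}" using p by simp
  \<comment> \<open>The action then supplies the permutation of \<open>x\<close>.\<close>
  have "q_mor C t c (act (free_G C) t (map (src C) ?fs) (fst x) z) = x"
    using op_hom_act[OF q_hom z(1) p'] z(2) c s by (simp add: cat_act)
  then show ?thesis using pre_operad_act[OF free_G_pre z(1) p'] c by auto
qed

abbreviation pq where
  "pq \<equiv> op_compose (free_G C) (orth_proj C perp) (q_mor C)"

lemma pq_hom: "op_hom (Ob C) (free_G C) (orth_operad C perp) pq"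
  by (rule op_compose_hom[OF q_hom orth_proj_hom free_G_pre])

text \<open>By \<open>perp_sym\<close> this evaluates both products occurring in a
  \<open>Perp_comm\<close> relation.\<close>

lemma q_perp:
  assumes "(f1, f2) \<in> perp"
  shows "q_mor C (tgt C f1) [src C f1, src C f2]
    (gam (free_G C) (tgt C f1) [tgt C f1, tgt C f1] [[src C f1], [src C f2]]
       (mult_op C (tgt C f1)) [arrow_op C f1, arrow_op C f2]) = (id, [f1, f2])"
proof -
  note f = perp_Mor[OF assms]
  then have t: "tgt C f1 \<in> Ob C" by (simp add: tgt_Ob)
  have a: "arrow_op C f2 \<in> ops (free_G C) (tgt C f1) [src C f2]"
    "q_mor C (tgt C f1) [src C f1] (arrow_op C f1) = (id, [f1])"
    "q_mor C (tgt C f1) [src C f2] (arrow_op C f2) = (id, [f2])"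
    "cmp C (idm C (tgt C f1)) f1 = f1" "cmp C (idm C (tgt C f1)) f2 = f2"
    using arrow_op_mem[of f2] q_arrow[of f1] q_arrow[of f2] idm_left[of f1] idm_left[of f2] f by auto
  show ?thesis
    using op_hom_gam2[OF q_hom mult_op_mem[OF t] arrow_op_mem[of f1] a(1)] a f t
    by (simp add: q_mult cat_gam comp_perm_id2)
qed

text \<open>These relations hold before passing to the quotient: both sides have the identity
  permutation, and their arrow lists agree by the identity laws and the rule for composing
  lists.\<close>

lemma q_rel:
  assumes x: "x \<in> rel_seq C perp t c" and "\<forall>f1 f2. x \<noteq> Perp_comm f1 f2"
  shows "q_mor C t c (rel_lhs C x) = q_mor C t c (rel_rhs C x)"
proof (cases x)
  case (Fun_id t')
  then show ?thesis using x op_hom_one[OF q_hom, of t] q_arrow[of "idm C t"]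
    by (auto simp: rel_seq_def cat_one idm_Mor src_idm tgt_idm)
next
  case (Fun_cmp f g)
  then have fg: "f \<in> Mor C" "g \<in> Mor C" "tgt C g = src C f" "t = tgt C f" "c = [src C g]"
    using x by (auto simp: rel_seq_def)
  have "q_mor C (src C f) [src C g] (arrow_op C g) = (id, [g])" using q_arrow[OF fg(2)] fg(3) by simp
  then show ?thesis
    using Fun_cmp fg op_hom_gam1[OF q_hom arrow_op_mem[of f], of "arrow_op C g"] arrow_op_mem[of g]
      q_arrow[OF cmp_Mor[OF fg(1-3)]]
    by (simp add: src_cmp tgt_cmp q_arrow cat_gam comp_perm_id1)
next
  case (Alg_left t')
  then have t: "t \<in> Ob C" "t' = t" "c = [t]" using x by (auto simp: rel_seq_def)
  show ?thesis
    using Alg_left t op_hom_gam2[OF q_hom mult_op_mem[OF t(1)] unit_op_mem pre_operad_one[OF free_G_pre]]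
      idm_left[OF idm_Mor]
    by (simp add: q_unit q_mult op_hom_one[OF q_hom] cat_one cat_gam comp_perm_id2 tgt_idm)
next
  case (Alg_right t')
  then have t: "t \<in> Ob C" "t' = t" "c = [t]" using x by (auto simp: rel_seq_def)
  show ?thesis
    using Alg_right t op_hom_gam2[OF q_hom mult_op_mem[OF t(1)] pre_operad_one[OF free_G_pre] unit_op_mem]
      idm_left[OF idm_Mor]
    by (simp add: q_unit q_mult op_hom_one[OF q_hom] cat_one cat_gam comp_perm_id2 tgt_idm)
next
  case (Alg_assoc t')
  then have t: "t \<in> Ob C" "t' = t" "c = [t, t, t]" using x by (auto simp: rel_seq_def)
  show ?thesis
    using Alg_assoc t op_hom_gam2[OF q_hom mult_op_mem[OF t(1)] mult_op_mem pre_operad_one[OF free_G_pre]]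
      op_hom_gam2[OF q_hom mult_op_mem[OF t(1)] pre_operad_one[OF free_G_pre] mult_op_mem]
      idm_left[OF idm_Mor]
    by (simp add: q_unit q_mult op_hom_one[OF q_hom] cat_one cat_gam comp_perm_id2 tgt_idm)
next
  case (Comp_unit f)
  then have f: "f \<in> Mor C" "t = tgt C f" "c = []" using x by (auto simp: rel_seq_def)
  show ?thesis
    using Comp_unit f op_hom_gam1[OF q_hom arrow_op_mem[of f] unit_op_mem]
    by (simp add: q_arrow q_unit cat_gam comp_perm_id1 src_Ob tgt_Ob)
next
  case (Comp_mult f)
  then have f: "f \<in> Mor C" "t = tgt C f" "c = [src C f, src C f]" using x by (auto simp: rel_seq_def)
  show ?thesis
    using Comp_mult f op_hom_gam1[OF q_hom arrow_op_mem[of f] mult_op_mem]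
      op_hom_gam2[OF q_hom mult_op_mem[of "tgt C f"] arrow_op_mem[of f] arrow_op_mem[of f]]
    by (simp add: q_arrow q_mult cat_gam comp_perm_id1 comp_perm_id2 src_Ob tgt_Ob idm_left idm_right)
qed (use assms(2) in blast)

lemma pq_rel:
  assumes x: "x \<in> rel_seq C perp t c"
  shows "pq t c (rel_lhs C x) = pq t c (rel_rhs C x)"
proof (cases "\<exists>f1 f2. x = Perp_comm f1 f2")
  case True
  then obtain f1 f2 where xe: "x = Perp_comm f1 f2" by blast
  with x have p: "(f1, f2) \<in> perp" and t: "t = tgt C f1" and c: "c = [src C f1, src C f2]"
    by (auto simp: rel_seq_def)
  note f = perp_Mor[OF p]
  have m: "gam (free_G C) t [t, t] [[src C f2], [src C f1]] (mult_op C t) [arrow_op C f2, arrow_op C f1]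
      \<in> ops (free_G C) t [src C f2, src C f1]"
    using f arrow_op_mem[of f1] arrow_op_mem[of f2] gam2[OF mult_op_mem[of t], of "arrow_op C f2" "[src C f2]"
      "arrow_op C f1" "[src C f1]"] t tgt_Ob[of f1] by simp
  have "permute_list (transpose 0 1) [src C f2, src C f1] = c" "permute_list (transpose 0 1) [f2, f1] = [f1, f2]"
    using c by (simp_all add: permute_list_def)
  \<comment> \<open>The transposition acts on \<open>(id, [f2, f1])\<close>, which restores the
    order of the arrows and leaves precisely the operation that \<open>orth_proj C perp\<close>
    identifies with \<open>(id, [f1, f2])\<close>.\<close>
  then have "q_mor C t c (rel_rhs C x) = (transpose 0 1, [f1, f2])"
    using op_hom_act[OF q_hom m, of "transpose 0 1"] q_perp[OF perp_sym[OF p]] f t xe transpose_01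
    by (simp add: cat_act numeral_2_eq_2)
  then show ?thesis
    using orth_proj_identifies[OF p] q_perp[OF p] rel_lhs_mem[OF x] rel_rhs_mem[OF x] xe t c
    by (simp add: op_compose_apply del: rel_rhs.simps)
next
  case False
  then show ?thesis using q_rel[OF x] rel_lhs_mem[OF x] rel_rhs_mem[OF x] by (simp add: op_compose_apply)
qed

section \<open>Factorization through the quotient\<close>

text \<open>Both composites are morphisms out of a free operad, hence determined by their values on
  the relation indices, which \<open>r1_mor\<close> and \<open>r2_mor\<close> send to the two
  sides.\<close>

lemma coequalizes_iff:
  assumes Q: "operad (Ob C) Q" and m: "op_hom (Ob C) (free_G C) Q m"
  shows "op_compose (free_R C perp) m (r1_mor C perp) = op_compose (free_R C perp) m (r2_mor C perp) \<longleftrightarrow>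
    (\<forall>t c. \<forall>x\<in>rel_seq C perp t c. m t c (rel_lhs C x) = m t c (rel_rhs C x))" (is "?l = ?r \<longleftrightarrow> ?R")
proof -
  have val: "?l t c (free_gen (Ob C) (rel_seq C perp) t c x) = m t c (rel_lhs C x)"
    "?r t c (free_gen (Ob C) (rel_seq C perp) t c x) = m t c (rel_rhs C x)"
    if "x \<in> rel_seq C perp t c" for t c x
    using that free_gen_mem[of x "rel_seq C perp" t c "Ob C"]
    by (simp_all add: op_compose_apply r1_mor_props(2) r2_mor_props(2))
  have pre: "pre_operad (Ob C) (free_R C perp)" by (rule operad_pre[OF free_operad_operad[OF rel_seq_colored]])
  show ?thesis
  proof
    assume "?l = ?r"
    then show ?R using val by metis
  next
    assume ?R
    then show "?l = ?r"
      using val by (intro free_hom_eqI[OF rel_seq_colored Q] op_compose_hom[OF r1_mor_props(1) m pre]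
        op_compose_hom[OF r2_mor_props(1) m pre]) simp
  qed
qed

text \<open>Each equation is the image under \<open>m\<close> of one kind of relation, rewritten
  because \<open>m\<close> preserves compositions and units.\<close>

lemma category_model_hom:
  assumes Q: "operad (Ob C) Q" and m: "op_hom (Ob C) (free_G C) Q m"
    and rel: "\<And>t c x. x \<in> rel_seq C perp t c \<Longrightarrow> m t c (rel_lhs C x) = m t c (rel_rhs C x)"
  shows "category_model C Q (\<lambda>f. m (tgt C f) [src C f] (arrow_op C f))
    (\<lambda>t. m t [] (unit_op C t)) (\<lambda>t. m t [t, t] (mult_op C t))"
proof
  show "m (tgt C f) [src C f] (arrow_op C f) \<in> ops Q (tgt C f) [src C f]" if "f \<in> Mor C" for f
    by (rule op_hom_mem[OF m arrow_op_mem[OF that]])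
  fix f assume f: "f \<in> Mor C"
  show "gam Q (tgt C f) [src C f] [[]] (m (tgt C f) [src C f] (arrow_op C f))
      [m (src C f) [] (unit_op C (src C f))] = m (tgt C f) [] (unit_op C (tgt C f))"
    using rel[of "Comp_unit f" "tgt C f" "[]"] op_hom_gam1[OF m arrow_op_mem[OF f] unit_op_mem[OF src_Ob[OF f]]] f
    by (simp add: rel_seq_def)
  show "gam Q (tgt C f) [src C f] [[src C f, src C f]] (m (tgt C f) [src C f] (arrow_op C f))
      [m (src C f) [src C f, src C f] (mult_op C (src C f))] =
    gam Q (tgt C f) [tgt C f, tgt C f] [[src C f], [src C f]] (m (tgt C f) [tgt C f, tgt C f] (mult_op C (tgt C f)))
      [m (tgt C f) [src C f] (arrow_op C f), m (tgt C f) [src C f] (arrow_op C f)]"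
    using rel[of "Comp_mult f" "tgt C f" "[src C f, src C f]"]
      op_hom_gam1[OF m arrow_op_mem[OF f] mult_op_mem[OF src_Ob[OF f]]]
      op_hom_gam2[OF m mult_op_mem[OF tgt_Ob[OF f]] arrow_op_mem[OF f] arrow_op_mem[OF f]] f
    by (simp add: rel_seq_def)
  show "gam Q (tgt C f) [src C f] [[src C g]] (m (tgt C f) [src C f] (arrow_op C f))
      [m (tgt C g) [src C g] (arrow_op C g)] =
    m (tgt C (cmp C f g)) [src C (cmp C f g)] (arrow_op C (cmp C f g))"
    if g: "g \<in> Mor C" "tgt C g = src C f" for g
    using rel[of "Fun_cmp f g" "tgt C f" "[src C g]"] f g arrow_op_mem[OF g(1)]
      op_hom_gam1[OF m arrow_op_mem[OF f], of "arrow_op C g" "[src C g]"]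
    by (simp add: rel_seq_def src_cmp tgt_cmp)
next
  fix t assume t: "t \<in> Ob C"
  note o = pre_operad_one[OF free_G_pre t]
  show "m t [] (unit_op C t) \<in> ops Q t []" by (rule op_hom_mem[OF m unit_op_mem[OF t]])
  show "m t [t, t] (mult_op C t) \<in> ops Q t [t, t]" by (rule op_hom_mem[OF m mult_op_mem[OF t]])
  show "m (tgt C (idm C t)) [src C (idm C t)] (arrow_op C (idm C t)) = one Q t"
    using rel[of "Fun_id t" t "[t]"] op_hom_one[OF m t] t by (simp add: rel_seq_def src_idm tgt_idm)
  show "gam Q t [t, t] [[], [t]] (m t [t, t] (mult_op C t)) [m t [] (unit_op C t), one Q t] = one Q t"
    using rel[of "Alg_left t" t "[t]"] op_hom_one[OF m t] t
      op_hom_gam2[OF m mult_op_mem[OF t] unit_op_mem[OF t] o] by (simp add: rel_seq_def)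
  show "gam Q t [t, t] [[t], []] (m t [t, t] (mult_op C t)) [one Q t, m t [] (unit_op C t)] = one Q t"
    using rel[of "Alg_right t" t "[t]"] op_hom_one[OF m t] t
      op_hom_gam2[OF m mult_op_mem[OF t] o unit_op_mem[OF t]] by (simp add: rel_seq_def)
  show "gam Q t [t, t] [[t, t], [t]] (m t [t, t] (mult_op C t)) [m t [t, t] (mult_op C t), one Q t] =
    gam Q t [t, t] [[t], [t, t]] (m t [t, t] (mult_op C t)) [one Q t, m t [t, t] (mult_op C t)]"
    using rel[of "Alg_assoc t" t "[t, t, t]"] op_hom_one[OF m t] t
      op_hom_gam2[OF m mult_op_mem[OF t] mult_op_mem[OF t] o]
      op_hom_gam2[OF m mult_op_mem[OF t] o mult_op_mem[OF t]] by (simp add: rel_seq_def)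
qed (rule Q)

lemma factor_through_cat_operad:
  fixes Q :: "('o, 'q) operad_data"
  assumes Q: "operad (Ob C) Q" and m: "op_hom (Ob C) (free_G C) Q m"
    and rel: "\<And>t c x. x \<in> rel_seq C perp t c \<Longrightarrow> m t c (rel_lhs C x) = m t c (rel_rhs C x)"
  obtains h where "op_hom (Ob C) (cat_operad C) Q h" "op_compose (free_G C) h (q_mor C) = m"
    "\<And>f1 f2. (f1, f2) \<in> perp \<Longrightarrow> h (tgt C f1) [src C f1, src C f2] (id, [f1, f2]) =
      h (tgt C f1) [src C f1, src C f2] (transpose 0 1, [f1, f2])"
proof -
  interpret M: category_model C Q "\<lambda>f. m (tgt C f) [src C f] (arrow_op C f)"
    "\<lambda>t. m t [] (unit_op C t)" "\<lambda>t. m t [t, t] (mult_op C t)"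
    by (rule category_model_hom[OF Q m rel])
  have "op_compose (free_G C) M.extension (q_mor C) = m"
  \<comment> \<open>Two morphisms out of the free operad are compared on generators, where
    \<open>extension_gen\<close> returns the data of the model.\<close>
  proof (rule free_hom_eqI[OF gen_seq_colored Q op_compose_hom[OF q_hom M.extension_hom free_G_pre] m])
    fix t c x assume x: "x \<in> gen_seq C t c"
    have "op_compose (free_G C) M.extension (q_mor C) t c (free_gen (Ob C) (gen_seq C) t c x) = M.extension t c (q_gen C x)"
      using free_gen_mem[of x "gen_seq C", OF x] q_gen[OF x] by (simp add: op_compose_apply)
    also have "\<dots> = m t c (free_gen (Ob C) (gen_seq C) t c x)"
      using x M.extension_gen
      by (cases x) (auto simp: gen_seq_def arrow_op_def unit_op_def mult_op_def)
    finally show "op_compose (free_G C) M.extension (q_mor C) t c (free_gen (Ob C) (gen_seq C) t c x) =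
      m t c (free_gen (Ob C) (gen_seq C) t c x)" .
  qed
  moreover have "M.extension (tgt C f1) [src C f1, src C f2] (id, [f1, f2]) =
      M.extension (tgt C f1) [src C f1, src C f2] (transpose 0 1, [f1, f2])" if p: "(f1, f2) \<in> perp" for f1 f2
  proof -
    note f = perp_Mor[OF p]
    let ?t = "tgt C f1"
    have a: "arrow_op C f1 \<in> ops (free_G C) ?t [src C f1]" "arrow_op C f2 \<in> ops (free_G C) ?t [src C f2]"
      and t: "?t \<in> Ob C"
      using arrow_op_mem[of f1] arrow_op_mem[of f2] f tgt_Ob[of f1] by auto
    have g: "gam (free_G C) ?t [?t, ?t] [[src C f2], [src C f1]] (mult_op C ?t) [arrow_op C f2, arrow_op C f1]
        \<in> ops (free_G C) ?t [src C f2, src C f1]"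
      using gam2[OF mult_op_mem[OF t] a(2,1)] by simp
    have s: "transpose 0 1 permutes {..<length [src C f2, src C f1]}"
      using transpose_01 by (simp add: numeral_2_eq_2)
    have ps: "permute_list (transpose 0 1) [src C f2, src C f1] = [src C f1, src C f2]"
      "permute_list (transpose 0 1) [f2, f1] = [f1, f2]"
      by (simp_all add: permute_list_def)
    have "M.extension ?t [src C f1, src C f2] (id, [f1, f2]) =
      gam Q ?t [?t, ?t] [[src C f1], [src C f2]] (m ?t [?t, ?t] (mult_op C ?t))
        [m ?t [src C f1] (arrow_op C f1), m ?t [src C f2] (arrow_op C f2)]"
      using M.extension_id[OF perp_ops[OF p permutes_id]] M.mult_list_pair[of f1 f2] f by simp
    also have "\<dots> = m ?t [src C f1, src C f2] (rel_lhs C (Perp_comm f1 f2))"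
      using op_hom_gam2[OF m mult_op_mem[OF t] a] by simp
    also have "\<dots> = m ?t [src C f1, src C f2] (rel_rhs C (Perp_comm f1 f2))"
      using p by (intro rel) (simp add: rel_seq_def)
    also have "\<dots> = act Q ?t [src C f2, src C f1] (transpose 0 1)
      (gam Q ?t [?t, ?t] [[src C f2], [src C f1]] (m ?t [?t, ?t] (mult_op C ?t))
        [m ?t [src C f2] (arrow_op C f2), m ?t [src C f1] (arrow_op C f1)])"
      using op_hom_act[OF m g s] op_hom_gam2[OF m mult_op_mem[OF t] a(2,1)] ps by simp
    \<comment> \<open>The sorted list belonging to \<open>(transpose 0 1, [f1, f2])\<close> is
      \<open>[f2, f1]\<close>, so \<open>extension\<close> is the transposition acting on that
      product.\<close>
    also have "\<dots> = M.extension ?t [src C f1, src C f2] (transpose 0 1, [f1, f2])"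
      using M.extension_eq[OF perp_ops[OF p transpose_01], of "transpose 0 1" "[f2, f1]"] ps(2)
        M.mult_list_pair[of f2 f1] f by simp
    finally show ?thesis .
  qed
  ultimately show ?thesis using that M.extension_hom by blast
qed

end

theorem theorem3p14:
  fixes C :: "('o, 'm) cat_data" and perp :: "('m \<times> 'm) set"
  assumes "orthogonal_category C perp"
  shows "op_coequalizer TYPE('q) (Ob C)
           (free_R C perp) (free_G C) (orth_operad C perp)
           (r1_mor C perp) (r2_mor C perp)
           (op_compose (free_G C) (orth_proj C perp) (q_mor C))"
proof -
  interpret orthogonal_category C perp by fact
  have "\<exists>!h. op_hom (Ob C) (orth_operad C perp) Q h \<and> op_compose (free_G C) h pq = m"
    if Q: "operad (Ob C) Q" and m: "op_hom (Ob C) (free_G C) Q m"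
      and eq: "op_compose (free_R C perp) m (r1_mor C perp) = op_compose (free_R C perp) m (r2_mor C perp)"
    for Q :: "('o, 'q) operad_data" and m
  proof -
    have "m t c (rel_lhs C x) = m t c (rel_rhs C x)" if "x \<in> rel_seq C perp t c" for t c x
      using coequalizes_iff[OF Q m] eq that by blast
    then obtain k where k: "op_hom (Ob C) (cat_operad C) Q k" "op_compose (free_G C) k (q_mor C) = m"
      "\<And>f1 f2. (f1, f2) \<in> perp \<Longrightarrow> k (tgt C f1) [src C f1, src C f2] (id, [f1, f2]) =
        k (tgt C f1) [src C f1, src C f2] (transpose 0 1, [f1, f2])"
      using factor_through_cat_operad[OF Q m] by blast
    obtain h where h: "op_hom (Ob C) (orth_operad C perp) Q h" "op_compose (cat_operad C) h (orth_proj C perp) = k"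
      using orth_operad_universal[OF Q k(1,3)] by blast
    show ?thesis
    proof (rule ex1I[of _ h])
      show "op_hom (Ob C) (orth_operad C perp) Q h \<and> op_compose (free_G C) h pq = m"
        using h k(2) op_compose_assoc[OF q_hom, of h "orth_proj C perp"] by simp
      fix h' assume h': "op_hom (Ob C) (orth_operad C perp) Q h' \<and> op_compose (free_G C) h' pq = m"
      show "h' = h"
      proof (rule op_hom_eqI[OF conjunct1[OF h'] h(1)])
        fix t c x assume "x \<in> ops (orth_operad C perp) t c"
        then obtain y where y: "y \<in> ops (cat_operad C) t c" "x = orth_proj C perp t c y"
          \<comment> \<open>Operations of the quotient are classes of operations of
            \<open>cat_operad C\<close>, so each has a preimage under the projection.\<close>
          by (auto simp: orth_operad_def orth_proj_def quot_ops op_proj_def)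
        then obtain z where z: "z \<in> ops (free_G C) t c" "x = pq t c z"
          using q_surj[OF y(1)] by (auto simp: op_compose_apply)
        then show "h' t c x = h t c x"
          using h' h k(2) op_compose_assoc[OF q_hom, of h "orth_proj C perp"] op_compose_apply[OF z(1)] by metis
      qed
    qed
  qed
  \<comment> \<open>The criterion is applied to \<open>pq\<close> itself, with
    \<open>orth_operad C perp\<close> as target.\<close>
  moreover have "op_compose (free_R C perp) pq (r1_mor C perp) = op_compose (free_R C perp) pq (r2_mor C perp)"
    using coequalizes_iff[OF orth_operad_operad pq_hom] pq_rel by blast
  ultimately show ?thesis
    unfolding op_coequalizer_def
    using free_operad_operad[OF rel_seq_colored] free_operad_operad[OF gen_seq_colored] orth_operad_operad
      r1_mor_props(1) r2_mor_props(1) pq_hom by blast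
qed

end
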